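(* Let $\omega$ be a radial weight and $1<p<\infty$, with $\frac1p+\frac1{p'}=1$. Let $Y_p\in\{H(\infty,p),H^p,D^p_{p-1},HL(p)\}$ and $T\in\{H_\omega,\widetilde{H_\omega}\}$. Then the following statements are equivalent: (i) $T:L^p_{[0,1)}\to Y_p$ is bounded; (ii) $\omega\in\mathcal{D}$ and $$m_p(\omega)=\sup_{0<r<1}\left(1+\int_0^r\frac{1}{\widehat{\omega}(t)^p}\,dt\right)^{1/p}\left(\int_r^1\omega(t)^{p'}\,dt\right)^{1/p'}<\infty;$$ (iii) $\omega\in\widehat{\mathcal{D}}$ and $m_p(\omega)<\infty$.
   Context: $\mathbb{D}$ is the open unit disc of $\mathbb{C}$, $\mathcal{H}(\mathbb{D})$ the space of analytic functions on $\mathbb{D}$, $dA=\frac{dx\,dy}{\pi}$. $L^p_{[0,1)}$ is the Lebesgue space of measurable functions on $[0,1)$ with $\|f\|^p=\int_0^1|f(t)|^p\,dt<\infty$. Radial weights: a radial weight is a nonnegative $\omega\in L^1([0,1))$, extended to $\mathbb{D}$ by $\omega(z)=\omega(|z|)$; standing assumption: $\widehat{\omega}(r)=\int_r^1\omega(s)\,ds>0$ for all $0\le r<1$. Moments: $\omega_x=\int_0^1 r^x\omega(r)\,dr$, $x\ge0$. $\omega\in\widehat{\mathcal{D}}$ if there is $C>1$ with $\widehat{\omega}(r)\le C\,\widehat{\omega}(\frac{1+r}{2})$ for all $0\le r<1$. $\omega\in\check{\mathcal{D}}$ if there are $K>1$, $C>1$ with $\widehat{\omega}(r)\ge C\,\widehat{\omega}(1-\frac{1-r}{K})$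 for all $0\le r<1$. $\mathcal{D}=\widehat{\mathcal{D}}\cap\check{\mathcal{D}}$. Operators: $B^\omega_z(\zeta)=\sum_{n\ge0}\frac{(\overline{z}\zeta)^n}{2\omega_{2n+1}}$ is the reproducing kernel of the Bergman space $A^2_\omega=\{f\in\mathcal{H}(\mathbb{D}):\int_{\mathbb{D}}|f|^2\omega\,dA<\infty\}$, and $$H_\omega(f)(z)=\int_0^1 f(t)\left(\frac1z\int_0^zB^\omega_t(\zeta)\,d\zeta\right)\omega(t)\,dt,\qquad \widetilde{H_\omega}(f)(z)=\int_0^1|f(t)|\left(\frac1z\int_0^zB^\omega_t(\zeta)\,d\zeta\right)\omega(t)\,dt.$$ $T:X\to Y$ is bounded if $T(f)$ is well defined and belongs to $Y$ for every $f\in X$, and $\sup_{\|f\|_X\le1}\|T(f)\|_Y<\infty$. Spaces (of $f(z)=\sum_{n\ge 0}\widehat f(n)z^n\in\mathcal{H}(\mathbb{D})$ with finite norm), where $M_p(r,f)=\left(\frac1{2\pi}\int_0^{2\pi}|f(re^{i\theta})|^pd\theta\right)^{1/p}$ and $M_\infty(r,f)=\max_\theta|f(re^{i\theta})|$: $H^p$: $\|f\|_{H^p}=\sup_{0<r<1}M_p(r,f)$; $D^p_{p-1}$: $\|f\|^p=|f(0)|^p+\int_{\mathbb{D}}|f'(z)|^p(1-|z|)^{p-1}dA(z)$; $HL(p)$: $\|f\|^p=\sum_{n\ge0}|\widehat f(n)|^p(n+1)^{p-2}$; $H(\infty,p)$: $\|f\|^p=\int_0^1M_\infty^p(r,f)\,dr$.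 *)

theory Defs
  imports "HOL-Complex_Analysis.Complex_Analysis"
begin

text \<open>
  Weights are functions \<open>real \<Rightarrow> real\<close> of which only the values on \<open>[0,1)\<close> matter. All integrals are
  Lebesgue integrals; possibly infinite quantities (norms, \<open>m\<^sub>p(\<omega>)\<close>) take values in \<^typ>\<open>ennreal\<close>.
\<close>

text \<open>\<open>x\<^sup>a\<close> on \<open>[0,\<infinity>]\<close>; meant for \<open>a > 0\<close> only.\<close>

definition enn_powr :: "ennreal \<Rightarrow> real \<Rightarrow> ennreal" where
  "enn_powr x a = (if x = top then top else ennreal (enn2real x powr a))"


subsection \<open>Radial weights\<close>

definition tail :: "(real \<Rightarrow> real) \<Rightarrow> real \<Rightarrow> real" where
  "tail \<omega> r = (\<integral>s. \<omega> s \<partial>lebesgue_on {r..<1})"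

definition radial_weight :: "(real \<Rightarrow> real) \<Rightarrow> bool" where
  "radial_weight \<omega> \<longleftrightarrow>
     (\<forall>r\<in>{0..<1}. 0 \<le> \<omega> r) \<and> integrable (lebesgue_on {0..<1}) \<omega> \<and> (\<forall>r\<in>{0..<1}. 0 < tail \<omega> r)"

definition moment :: "(real \<Rightarrow> real) \<Rightarrow> real \<Rightarrow> real" where
  "moment \<omega> x = (\<integral>r. r powr x * \<omega> r \<partial>lebesgue_on {0..<1})"

definition D_hat :: "(real \<Rightarrow> real) set" where
  "D_hat = {\<omega>. \<exists>C>1. \<forall>r\<in>{0..<1}. tail \<omega> r \<le> C * tail \<omega> ((1 + r) / 2)}"

definition D_check :: "(real \<Rightarrow> real) set" where
  "D_check = {\<omega>. \<exists>K>1. \<exists>C>1. \<forall>r\<in>{0..<1}. tail \<omega> r \<ge> C * tail \<omega> (1 - (1 - r) / K)}"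

definition D_class :: "(real \<Rightarrow> real) set" where
  "D_class = D_hat \<inter> D_check"

text \<open>\<open>q\<close> is the conjugate exponent of \<open>p\<close>.\<close>

definition m_const :: "real \<Rightarrow> real \<Rightarrow> (real \<Rightarrow> real) \<Rightarrow> ennreal" where
  "m_const p q \<omega> =
     (SUP r\<in>{0<..<1}.
        enn_powr (1 + (\<integral>\<^sup>+t. ennreal (1 / tail \<omega> t powr p) \<partial>lebesgue_on {0..r})) (1 / p) *
        enn_powr (\<integral>\<^sup>+t. ennreal (\<omega> t powr q) \<partial>lebesgue_on {r..<1}) (1 / q))"


subsection \<open>The space \<open>L\<^sup>p\<close> on \<open>[0,1)\<close>\<close>

definition norm_Lp :: "real \<Rightarrow> (real \<Rightarrow> complex) \<Rightarrow> ennreal" where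
  "norm_Lp p f = enn_powr (\<integral>\<^sup>+t. ennreal (norm (f t) powr p) \<partial>lebesgue_on {0..<1}) (1 / p)"

definition space_Lp :: "real \<Rightarrow> (real \<Rightarrow> complex) set" where
  "space_Lp p = {f. f \<in> borel_measurable (lebesgue_on {0..<1}) \<and> norm_Lp p f < top}"


subsection \<open>Spaces of analytic functions on the unit disc\<close>

text \<open>A space is given by its \<open>[0,\<infinity>]\<close>-valued norm on functions holomorphic on the disc.\<close>

definition analytic_space :: "((complex \<Rightarrow> complex) \<Rightarrow> ennreal) \<Rightarrow> (complex \<Rightarrow> complex) set" where
  "analytic_space N = {f. f holomorphic_on ball 0 1 \<and> N f < top}"

definition mean_p :: "real \<Rightarrow> real \<Rightarrow> (complex \<Rightarrow> complex) \<Rightarrow> real" where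
  "mean_p p r f =
     (1 / (2 * pi) * (\<integral>\<theta>. norm (f (of_real r * cis \<theta>)) powr p \<partial>lebesgue_on {0..2 * pi})) powr (1 / p)"

definition mean_infty :: "real \<Rightarrow> (complex \<Rightarrow> complex) \<Rightarrow> real" where
  "mean_infty r f = (SUP \<theta>. norm (f (of_real r * cis \<theta>)))"

definition norm_Hardy :: "real \<Rightarrow> (complex \<Rightarrow> complex) \<Rightarrow> ennreal" where
  "norm_Hardy p f = (SUP r\<in>{0<..<1}. ennreal (mean_p p r f))"

text \<open>The factor \<open>1 / pi\<close> comes from the normalised area measure \<open>dA = dx dy / \<pi>\<close>.\<close>

definition norm_Dirichlet :: "real \<Rightarrow> (complex \<Rightarrow> complex) \<Rightarrow> ennreal" where
  "norm_Dirichlet p f =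
     enn_powr (ennreal (norm (f 0) powr p) +
       (\<integral>\<^sup>+z. ennreal (norm (deriv f z) powr p * (1 - norm z) powr (p - 1) / pi)
          \<partial>lebesgue_on (ball 0 1))) (1 / p)"

definition taylor_coeff :: "(complex \<Rightarrow> complex) \<Rightarrow> nat \<Rightarrow> complex" where
  "taylor_coeff f n = (deriv ^^ n) f 0 / fact n"

definition norm_HL :: "real \<Rightarrow> (complex \<Rightarrow> complex) \<Rightarrow> ennreal" where
  "norm_HL p f =
     enn_powr (\<Sum>n. ennreal (norm (taylor_coeff f n) powr p * (real n + 1) powr (p - 2))) (1 / p)"

definition norm_H_infty :: "real \<Rightarrow> (complex \<Rightarrow> complex) \<Rightarrow> ennreal" where
  "norm_H_infty p f = enn_powr (\<integral>\<^sup>+r. ennreal (mean_infty r f powr p) \<partial>lebesgue_on {0..<1}) (1 / p)"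


subsection \<open>The Hilbert-type operators\<close>

definition bergman_kernel :: "(real \<Rightarrow> real) \<Rightarrow> complex \<Rightarrow> complex \<Rightarrow> complex" where
  "bergman_kernel \<omega> z \<zeta> = (\<Sum>n. (cnj z * \<zeta>) ^ n / of_real (2 * moment \<omega> (2 * real n + 1)))"

text \<open>
  \<open>(1/z) \<integral>\<^sub>0\<^sup>z B\<^sub>t\<^sup>\<omega>(\<zeta>) d\<zeta>\<close>, where the removable singularity at \<open>z = 0\<close> is filled by the limit \<open>B\<^sub>t\<^sup>\<omega>(0)\<close>.
\<close>

definition hilbert_kernel :: "(real \<Rightarrow> real) \<Rightarrow> real \<Rightarrow> complex \<Rightarrow> complex" where
  "hilbert_kernel \<omega> t z =
     (if z = 0 then bergman_kernel \<omega> (of_real t) 0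
      else 1 / z * contour_integral (linepath 0 z) (bergman_kernel \<omega> (of_real t)))"

text \<open>
  The operators are partial: they are defined at \<open>f\<close> iff the defining integral converges (absolutely)
  for every \<open>z\<close> in the disc.
\<close>

definition hilbert_op :: "(real \<Rightarrow> real) \<Rightarrow> (real \<Rightarrow> complex) \<rightharpoonup> (complex \<Rightarrow> complex)" where
  "hilbert_op \<omega> f =
     (if \<forall>z\<in>ball 0 1. integrable (lebesgue_on {0..<1}) (\<lambda>t. f t * hilbert_kernel \<omega> t z * of_real (\<omega> t))
      then Some (\<lambda>z. \<integral>t. f t * hilbert_kernel \<omega> t z * of_real (\<omega> t) \<partial>lebesgue_on {0..<1})
      else None)"

definition hilbert_op_abs :: "(real \<Rightarrow> real) \<Rightarrow> (real \<Rightarrow> complex) \<rightharpoonup> (complex \<Rightarrow> complex)" where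
  "hilbert_op_abs \<omega> f = hilbert_op \<omega> (\<lambda>t. of_real (norm (f t)))"

definition bounded_from_Lp ::
    "real \<Rightarrow> ((complex \<Rightarrow> complex) \<Rightarrow> ennreal) \<Rightarrow> ((real \<Rightarrow> complex) \<rightharpoonup> (complex \<Rightarrow> complex)) \<Rightarrow> bool" where
  "bounded_from_Lp p N T \<longleftrightarrow>
     (\<forall>f\<in>space_Lp p. \<exists>g. T f = Some g \<and> g \<in> analytic_space N) \<and>
     (SUP f\<in>{f \<in> space_Lp p. norm_Lp p f \<le> 1}. N (the (T f))) < top"

end

theory Submission
  imports Defs
begin

text \<open>
  Let \<open>W k\<close> be the tail of \<open>\<omega>\<close> at \<open>1 - 2 ^ (-k)\<close>. Once \<open>\<omega> \<in> D_hat\<close>, i.e. \<open>W k \<le> C * W (k + 1)\<close>, the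
  condition \<open>m_const p q \<omega> < \<infinity>\<close> amounts to the reverse Hoelder inequality that the \<open>L\<^sup>q\<close> norm of \<open>\<omega>\<close> on
  \<open>[1 - 2 ^ (-k), 1)\<close> is at most \<open>A * 2 powr (k / p) * W k\<close>. It improves itself: the \<open>L\<^sup>q\<close> norms decay
  geometrically, so \<open>W k\<close> decays faster than \<open>2 powr (- k / p)\<close>. In particular \<open>\<omega> \<in> D_check\<close>.

  Sufficiency: by Hoelder on each dyadic interval, the coefficients of the image of \<open>f\<close> with
  indices \<open>n\<close> in \<open>[2 ^ j, 2 ^ (j + 1))\<close>, and their total variation there, are at most
  \<open>2 powr (j / p - j) * x j\<close>, where \<open>x\<close> is a discrete convolution with a geometric kernel of the \<open>L\<^sup>p\<close>
  norms of \<open>f\<close> on the dyadic intervals; so \<open>x \<in> l\<^sup>p\<close>. Abel summation turns such coefficient bounds into a bound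
  for each of the four norms.

  Necessity: for a series with nonnegative coefficients each of the four norms controls the sum
  of the coefficients over \<open>[N, 2 * N)\<close>, up to the factor \<open>N powr (1 / p)\<close>. Testing with the powers \<open>t ^ m\<close> gives
  \<open>\<omega> \<in> D_hat\<close>, and testing with truncations of \<open>\<omega> powr (q - 1)\<close> gives the reverse Hoelder inequality.
\<close>

section \<open>Hoelder's inequality\<close>

text \<open>The obstacle is that \<open>f\<close> is complex valued: the coefficients of its image
  are not monotone, and for \<open>p < 2\<close> their sizes alone do not control a Hardy norm. The
  variation over each block replaces monotonicity. It is bounded at no extra cost, since
  \<open>t ^ n - t ^ Suc n\<close> is nonnegative on [0,1): differences of moments of
  \<open>f\<close> are dominated by those of \<open>norm f\<close>, which telescope. The geometric
  kernel between block \<open>j\<close> and dyadic interval \<open>k\<close> has two sources. For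
  \<open>k\<close> above \<open>j\<close> it is the decay of the tail norms of \<omega>. For
  \<open>k\<close> below \<open>j\<close>, \<open>t ^ n\<close> is at most of order
  \<open>exp (- (2 ^ (j - k)) / 2)\<close>, which beats the growth \<open>C ^ (j - k)\<close> that
  doubling permits. The self-improvement is a hole-filling argument, and finiteness of
  \<open>m_const\<close> depends on it: the reverse Hoelder inequality as it stands bounds every
  dyadic piece of the integral of \<open>1 / tail powr p\<close> by the same constant, so that the
  sum would grow with the number of pieces. Necessity tests nonnegative functions only, where both
  operators agree.\<close>

lemma conjugate_exponent_gt_1:
  fixes p q :: real
  assumes "1 < p" "1 / p + 1 / q = 1"
  shows "1 < q"
proof -
  have "1 / q = 1 - 1 / p" using assms by simp
  moreover have "0 < 1 - 1 / p" "1 - 1 / p < 1" using assms by auto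
  ultimately have "0 < 1 / q" "1 / q < 1" by auto
  then show ?thesis by (auto simp: divide_less_eq_1 zero_less_divide_iff)
qed

text \<open>Young's inequality for \<open>f x / A\<close> and \<open>g x / B\<close>, integrated;
  the weights \<open>1 / p\<close> and \<open>1 / q\<close> add up to 1. Bounds \<open>A\<close> and
  \<open>B\<close> in place of the norms keep infinite values out, and their positivity allows the
  division.\<close>

lemma nn_integral_Holder_pos:
  fixes f g :: "'a \<Rightarrow> real"
  assumes pq: "1 < p" "1 / p + 1 / q = (1::real)"
    and [measurable]: "f \<in> borel_measurable M" "g \<in> borel_measurable M"
    and f0: "\<And>x. 0 \<le> f x" and g0: "\<And>x. 0 \<le> g x"
    and A: "0 < A" "(\<integral>\<^sup>+x. ennreal (f x powr p) \<partial>M) \<le> ennreal (A powr p)"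
    and B: "0 < B" "(\<integral>\<^sup>+x. ennreal (g x powr q) \<partial>M) \<le> ennreal (B powr q)"
  shows "(\<integral>\<^sup>+x. ennreal (f x * g x) \<partial>M) \<le> ennreal (A * B)"
proof -
  have q: "q > 1"
    using conjugate_exponent_gt_1[OF pq] .
  have *: "ennreal (f x * g x) \<le> ennreal (A * B) * (ennreal (inverse (p * A powr p)) * ennreal (f x powr p)
      + ennreal (inverse (q * B powr q)) * ennreal (g x powr q))" for x
  proof -
    have "(f x / A) * (g x / B) \<le> (f x / A) powr p / p + (g x / B) powr q / q"
      using pq q f0 g0 A B by (intro Youngs_inequality) auto
    also have "\<dots> = inverse (p * A powr p) * f x powr p + inverse (q * B powr q) * g x powr q"
      using f0 g0 A B by (simp add: powr_divide field_simps)
    finally have "f x * g x \<le> A * B * (inverse (p * A powr p) * f x powr p + inverse (q * B powr q) * g x powr q)"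
      using A B by (simp add: field_simps)
    then show ?thesis
      using A B pq q by (simp flip: ennreal_mult' ennreal_plus add: ennreal_leI)
  qed
  have "(\<integral>\<^sup>+x. ennreal (f x * g x) \<partial>M) \<le> (\<integral>\<^sup>+x. ennreal (A * B) * (ennreal (inverse (p * A powr p)) * ennreal (f x powr p)
      + ennreal (inverse (q * B powr q)) * ennreal (g x powr q)) \<partial>M)"
    by (intro nn_integral_mono *)
  also have "\<dots> = ennreal (A * B) * (ennreal (inverse (p * A powr p)) * (\<integral>\<^sup>+x. ennreal (f x powr p) \<partial>M)
      + ennreal (inverse (q * B powr q)) * (\<integral>\<^sup>+x. ennreal (g x powr q) \<partial>M))"
    by (simp add: nn_integral_cmult nn_integral_add)
  also have "\<dots> \<le> ennreal (A * B) * (ennreal (inverse (p * A powr p)) * ennreal (A powr p)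
      + ennreal (inverse (q * B powr q)) * ennreal (B powr q))"
    by (intro mult_left_mono add_mono A B) auto
  also have "\<dots> = ennreal (A * B * (1 / p + 1 / q))"
    using A B pq q by (simp flip: ennreal_mult' ennreal_plus add: field_simps)
  also have "\<dots> = ennreal (A * B)" using pq by simp
  finally show ?thesis .
qed

text \<open>Vanishing bounds are reached by applying the positive case to \<open>A + e\<close> and
  \<open>B + e\<close> and letting \<open>e\<close> tend to 0 from the right.\<close>

lemma nn_integral_Holder:
  fixes f g :: "'a \<Rightarrow> real"
  assumes pq: "1 < p" "1 / p + 1 / q = (1::real)"
    and m: "f \<in> borel_measurable M" "g \<in> borel_measurable M"
    and nn: "\<And>x. 0 \<le> f x" "\<And>x. 0 \<le> g x"
    and A: "0 \<le> A" "(\<integral>\<^sup>+x. ennreal (f x powr p) \<partial>M) \<le> ennreal (A powr p)"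
    and B: "0 \<le> B" "(\<integral>\<^sup>+x. ennreal (g x powr q) \<partial>M) \<le> ennreal (B powr q)"
  shows "(\<integral>\<^sup>+x. ennreal (f x * g x) \<partial>M) \<le> ennreal (A * B)"
proof -
  have q: "q > 0"
    using conjugate_exponent_gt_1[OF pq] by simp
  have *: "(\<integral>\<^sup>+x. ennreal (f x * g x) \<partial>M) \<le> ennreal ((A + e) * (B + e))" if "e > 0" for e
  proof (rule nn_integral_Holder_pos[OF pq m nn])
    show "(\<integral>\<^sup>+x. ennreal (f x powr p) \<partial>M) \<le> ennreal ((A + e) powr p)"
      using A(2) that A(1) pq by (rule_tac order_trans) (auto intro!: ennreal_leI powr_mono2)
    show "(\<integral>\<^sup>+x. ennreal (g x powr q) \<partial>M) \<le> ennreal ((B + e) powr q)"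
      using B(2) that B(1) q by (rule_tac order_trans) (auto intro!: ennreal_leI powr_mono2)
  qed (use A B that in auto)
  have "((\<lambda>e. ennreal ((A + e) * (B + e))) \<longlongrightarrow> ennreal ((A + 0) * (B + 0))) (at_right 0)"
    by (intro tendsto_intros tendsto_ennrealI)
  moreover have "eventually (\<lambda>e. (\<integral>\<^sup>+x. ennreal (f x * g x) \<partial>M) \<le> ennreal ((A + e) * (B + e))) (at_right 0)"
    using * by (auto simp: eventually_at_right_field intro!: exI[of _ 1])
  ultimately show ?thesis
    by (intro tendsto_lowerbound[where f="\<lambda>e. ennreal ((A + e) * (B + e))" and F="at_right 0"]) auto
qed

section \<open>Discrete convolution with a geometric kernel\<close>

text \<open>With truncated subtraction, \<open>(i - j) + (j - i)\<close> is the distance between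
  \<open>i\<close> and \<open>j\<close>. The terms on either side of \<open>i\<close> are bounded by
  one geometric series each.\<close>

lemma sum_geometric_kernel:
  fixes b :: real
  assumes "0 < b" "b < 1"
  shows "(\<Sum>j. ennreal (b ^ ((i - j) + (j - i)))) \<le> ennreal (2 / (1 - b))"
proof -
  have g: "(\<lambda>n. b ^ n) sums (1 / (1 - b))" using assms by (intro geometric_sums) auto
  have "(\<Sum>j. ennreal (b ^ ((i - (j+i)) + ((j+i) - i)))) = (\<Sum>j. ennreal (b ^ j))" by simp
  also have "\<dots> = ennreal (1 / (1 - b))"
    using g assms by (intro suminf_ennreal_eq) auto
  finally have 1: "(\<Sum>j. ennreal (b ^ ((i - (j+i)) + ((j+i) - i)))) = ennreal (1 / (1 - b))" .
  have "(\<Sum>j<i. ennreal (b ^ ((i - j) + (j - i)))) = (\<Sum>j<i. ennreal (b ^ (i - j)))"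
    by (intro sum.cong) auto
  also have "\<dots> = ennreal (\<Sum>j<i. b ^ (i - j))" using assms by (simp add: sum_ennreal)
  also have "(\<Sum>j<i. b ^ (i - j)) = (\<Sum>j<i. b ^ Suc j)"
    using sum.nat_diff_reindex[of "\<lambda>j. b ^ Suc j" i] by (simp add: Suc_diff_Suc del: power_Suc)
  also have "\<dots> \<le> (\<Sum>j<i. b ^ j)" using assms by (intro sum_mono) (auto intro: mult_left_le_one_le)
  also have "\<dots> \<le> 1 / (1 - b)" using g assms sum_le_suminf[of "\<lambda>n. b ^ n" "{..<i}"] by (simp add: sums_iff)
  finally have 2: "(\<Sum>j<i. ennreal (b ^ ((i - j) + (j - i)))) \<le> ennreal (1 / (1 - b))"
    by (simp add: ennreal_leI)
  have "(\<Sum>j. ennreal (b ^ ((i - j) + (j - i)))) = (\<Sum>j. ennreal (b ^ ((i - (j+i)) + ((j+i) - i)))) + (\<Sum>j<i. ennreal (b ^ ((i - j) + (j - i))))"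
    by (rule suminf_offset) auto
  also have "\<dots> \<le> ennreal (1 / (1 - b)) + ennreal (1 / (1 - b))"
    unfolding 1 by (intro add_left_mono 2)
  also have "\<dots> = ennreal (2 / (1 - b))"
    using assms by (subst ennreal_plus[symmetric]) auto
  finally show ?thesis .
qed

text \<open>Boundedness on little l^p of the convolution with a power of \<open>b\<close>.
  \<open>C\<close> multiplies \<open>H\<close>, a bound for the p-th power of the norm. Summability
  belongs to the claim because the inner series is a real one, whose value means nothing unless it
  converges.\<close>

definition geometric_convolution_bounded :: "real \<Rightarrow> real \<Rightarrow> real \<Rightarrow> bool" where
  "geometric_convolution_bounded b p C \<longleftrightarrow> (\<forall>h H. (\<forall>j. 0 \<le> h j) \<longrightarrow> 0 \<le> H \<longrightarrow> (\<Sum>j. ennreal (h j powr p)) \<le> ennreal H \<longrightarrow>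
     (\<forall>i. summable (\<lambda>j. b ^ ((i - j) + (j - i)) * h j)) \<and>
     (\<Sum>i. ennreal ((\<Sum>j. b ^ ((i - j) + (j - i)) * h j) powr p)) \<le> ennreal (C * H))"

lemma geometric_convolution_boundedD:
  assumes "geometric_convolution_bounded b p C" "\<And>j. 0 \<le> h j" "0 \<le> H" "(\<Sum>j. ennreal (h j powr p)) \<le> ennreal H"
  shows "(\<forall>i. summable (\<lambda>j. b ^ ((i - j) + (j - i)) * h j)) \<and>
     (\<Sum>i. ennreal ((\<Sum>j. b ^ ((i - j) + (j - i)) * h j) powr p)) \<le> ennreal (C * H)"
  using assms unfolding geometric_convolution_bounded_def by blast

text \<open>Schur's test. The kernel \<open>w\<close> is split as
  \<open>w powr (1 / p) * w powr (1 / q)\<close> for Hoelder, so the row sums, at most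
  \<open>S\<close>, enter with the power \<open>p / q\<close>. Summation over \<open>i\<close> then
  brings in the column sums, which equal the row sums by symmetry.\<close>

lemma geometric_convolution_bound:
  fixes b p :: real
  assumes b: "0 < b" "b < 1" and p: "1 < p"
  shows "\<exists>C>0. geometric_convolution_bounded b p C"
proof -
  define S where "S = 2 / (1 - b)"
  have S: "S > 0" using b by (auto simp: S_def)
  define q where "q = p / (p - 1)"
  have pq: "1 / p + 1 / q = 1" and q: "q > 1" using p by (auto simp: q_def field_simps)
  show ?thesis
    unfolding geometric_convolution_bounded_def
  proof (intro exI[of _ "S powr (p / q) * S"] conjI allI impI)
    show "S powr (p / q) * S > 0" using S by simp
    fix h :: "nat \<Rightarrow> real" and H :: real
    assume h': "\<forall>j. 0 \<le> h j" and H: "0 \<le> H" and sh: "(\<Sum>j. ennreal (h j powr p)) \<le> ennreal H"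
    have h: "\<And>j. 0 \<le> h j" using h' by simp
    define w where "w i j = b ^ ((i - j) + (j - i))" for i j
    have w: "w i j > 0" for i j using b by (simp add: w_def)
    have wS: "(\<Sum>j. ennreal (w i j)) \<le> ennreal S" for i
      using sum_geometric_kernel[OF b] by (simp add: w_def S_def)
    define G where "G i = (\<Sum>j. ennreal (w i j * h j powr p))" for i
    have G: "(\<Sum>i. G i) \<le> ennreal (S * H)"
    proof -
      have "(\<Sum>i. G i) = (\<integral>\<^sup>+i. \<integral>\<^sup>+j. ennreal (w i j * h j powr p) \<partial>count_space UNIV \<partial>count_space UNIV)"
        by (simp add: G_def nn_integral_count_space_nat)
      also have "\<dots> = (\<integral>\<^sup>+j. \<integral>\<^sup>+i. ennreal (w i j * h j powr p) \<partial>count_space UNIV \<partial>count_space UNIV)"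
        by (rule pair_sigma_finite.Fubini')
          (auto simp: pair_sigma_finite_def sigma_finite_measure_count_space sigma_finite_measure_count_space_countable pair_measure_countable)
      also have "\<dots> = (\<Sum>j. (\<Sum>i. ennreal (w j i)) * ennreal (h j powr p))"
        unfolding nn_integral_count_space_nat
        by (intro suminf_cong) (simp add: w_def ennreal_mult'' add.commute)
      also have "\<dots> \<le> (\<Sum>j. ennreal S * ennreal (h j powr p))"
        by (intro suminf_le mult_right_mono wS) auto
      also have "\<dots> = ennreal S * (\<Sum>j. ennreal (h j powr p))" by simp
      also have "\<dots> \<le> ennreal S * ennreal H" by (intro mult_left_mono sh) auto
      finally show ?thesis using S by (simp add: ennreal_mult')
    qed
    have Gfin: "G i < top" for i
    proof -
      have "G i \<le> (\<Sum>i. G i)" by (rule sum_le_suminf[of G "{i}", simplified])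
      then show ?thesis using G by (meson ennreal_less_top le_less_trans)
    qed
    have key: "(\<Sum>j. ennreal (w i j * h j)) \<le> ennreal (S powr (1/q) * (enn2real (G i)) powr (1/p))" for i
    proof -
      have "(\<integral>\<^sup>+j. ennreal ((w i j powr (1/p) * h j) * w i j powr (1/q)) \<partial>count_space UNIV)
          \<le> ennreal ((enn2real (G i)) powr (1/p) * S powr (1/q))"
      proof (rule nn_integral_Holder[OF p pq])
        show "(\<integral>\<^sup>+ x. ennreal ((w i x powr (1 / p) * h x) powr p) \<partial>count_space UNIV)
          \<le> ennreal ((enn2real (G i) powr (1 / p)) powr p)"
          using p h w[of i] Gfin[of i] unfolding nn_integral_count_space_nat
          by (simp add: powr_mult powr_powr less_imp_le G_def)
        show "(\<integral>\<^sup>+ x. ennreal ((w i x powr (1 / q)) powr q) \<partial>count_space UNIV)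
          \<le> ennreal ((S powr (1 / q)) powr q)"
          using q w[of i] wS S unfolding nn_integral_count_space_nat
          by (simp add: powr_mult powr_powr less_imp_le)
      qed (use h w S in auto)
      also have "(\<lambda>j. (w i j powr (1/p) * h j) * w i j powr (1/q)) = (\<lambda>j. w i j * h j)"
        using w[of i] pq by (intro ext) (simp add: mult.commute[of "_ powr _" "h _"] mult.assoc powr_add[symmetric] less_imp_le)
      finally show ?thesis unfolding nn_integral_count_space_nat by (simp add: mult.commute)
    qed
    have summ: "summable (\<lambda>j. w i j * h j)" for i
      using key[of i] w h by (intro summable_suminf_not_top)
        (auto simp: less_imp_le top_unique simp flip: top.not_eq_extremum dest: le_less_trans)
    have "(\<Sum>i. ennreal ((\<Sum>j. w i j * h j) powr p)) \<le> (\<Sum>i. ennreal (S powr (p/q)) * G i)"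
    proof (intro suminf_le)
      fix i
      have nn: "(\<Sum>j. w i j * h j) \<ge> 0" using w h by (intro suminf_nonneg summ) (auto simp: less_imp_le)
      have "ennreal (\<Sum>j. w i j * h j) \<le> ennreal (S powr (1/q) * (enn2real (G i)) powr (1/p))"
        using key[of i] w h summ[of i] by (subst (asm) suminf_ennreal2) (auto simp: less_imp_le)
      then have "(\<Sum>j. w i j * h j) \<le> S powr (1/q) * (enn2real (G i)) powr (1/p)"
        by (subst (asm) ennreal_le_iff) auto
      then have "(\<Sum>j. w i j * h j) powr p \<le> (S powr (1/q) * (enn2real (G i)) powr (1/p)) powr p"
        using p nn by (intro powr_mono2) auto
      also have "\<dots> = S powr (p/q) * enn2real (G i)"
        using p S by (simp add: powr_mult powr_powr)
      finally have "ennreal ((\<Sum>j. w i j * h j) powr p) \<le> ennreal (S powr (p/q) * enn2real (G i))"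
        by (rule ennreal_leI)
      also have "\<dots> = ennreal (S powr (p/q)) * G i"
        using Gfin[of i] by (simp add: ennreal_mult'')
      finally show "ennreal ((\<Sum>j. w i j * h j) powr p) \<le> ennreal (S powr (p/q)) * G i" .
    qed auto
    also have "\<dots> \<le> ennreal (S powr (p/q)) * ennreal (S * H)"
      using G by (simp add: mult_left_mono)
    also have "\<dots> = ennreal (S powr (p/q) * S * H)" by (simp add: ennreal_mult'' S H mult.assoc less_imp_le)
    finally show "(\<Sum>i. ennreal ((\<Sum>j. b ^ ((i - j) + (j - i)) * h j) powr p)) \<le> ennreal (S powr (p/q) * S * H)"
      by (simp add: w_def)
    show "summable (\<lambda>j. b ^ ((i - j) + (j - i)) * h j)" for i
      using summ by (simp add: w_def)
  qed
qed

section \<open>Dyadic decompositions\<close>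

text \<open>\<open>exp x\<close> is at least \<open>(x / a) ^ a\<close>. With \<open>a\<close>
  chosen such that \<open>2 * A \<le> 2 ^ a\<close>, the factor
  \<open>(2 ^ m) ^ a = (2 ^ a) ^ m\<close> absorbs \<open>(2 * A) ^ m\<close>. It is applied to the
  doubling constant of a weight and to \<open>2 powr (1 / p)\<close>.\<close>

lemma superexponential_decay:
  fixes A c :: real
  assumes "0 < A" "0 < c"
  obtains C where "C > 0" "\<And>m::nat. A ^ m * exp (- (c * 2 ^ m)) \<le> C * (1/2) ^ m"
proof -
  obtain a0 :: nat where "2 * A < 2 ^ a0" using real_arch_pow[of 2 "2*A"] by auto
  then have a: "2 * A \<le> 2 ^ Suc a0" using assms by simp
  define a where "a = Suc a0"
  have a: "2 * A \<le> 2 ^ a" "a > 0" using a by (auto simp: a_def)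
  show thesis
  proof (rule that)
    show "(real a / c) ^ a > 0" using a assms by simp
    fix m :: nat
    have "(c * 2 ^ m / a) ^ a \<le> exp (c * 2 ^ m / a) ^ a"
    proof (intro power_mono)
      have "x \<le> exp x" for x :: real using exp_ge_add_one_self[of x] by linarith
      then show "c * 2 ^ m / a \<le> exp (c * 2 ^ m / a)" .
    qed (use assms in auto)
    also have "\<dots> = exp (c * 2 ^ m)" using a by (simp flip: exp_of_nat_mult)
    finally have e: "(c / a) ^ a * (2 ^ m) ^ a \<le> exp (c * 2 ^ m)"
      by (simp add: power_divide power_mult_distrib)
    have "(2 * A) ^ m \<le> (2 ^ a) ^ m" using a assms by (intro power_mono) auto
    also have "\<dots> = (2 ^ m) ^ a" by (simp add: mult.commute flip: power_mult)
    also have "\<dots> \<le> (real a / c) ^ a * exp (c * 2 ^ m)"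
      using e assms a by (simp add: power_divide field_simps)
    finally show "A ^ m * exp (- (c * 2 ^ m)) \<le> (real a / c) ^ a * (1/2) ^ m"
      using assms a by (simp add: exp_minus power_mult_distrib power_divide divide_simps mult_ac)
  qed
qed

section \<open>Dyadic points, dyadic intervals and blocks of indices\<close>

definition dyad :: "nat \<Rightarrow> real" where "dyad k = 1 - (1/2) ^ k"

definition dyad_interval :: "nat \<Rightarrow> real set" where "dyad_interval k = {dyad k..<dyad (Suc k)}"

text \<open>The index is shifted, \<open>2 ^ j \<le> n + 1 < 2 ^ (j + 1)\<close>, so that the blocks also cover \<open>n = 0\<close>.\<close>

definition block :: "nat \<Rightarrow> nat set" where "block j = {2 ^ j - 1..<2 ^ Suc j - 1}"

lemma dyad_0 [simp]: "dyad 0 = 0"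
  by (simp add: dyad_def)

lemma dyad_nonneg: "0 \<le> dyad k" and dyad_less_1: "dyad k < 1"
  by (simp_all add: dyad_def power_le_one)

lemma dyad_mono: "i \<le> j \<Longrightarrow> dyad i \<le> dyad j"
  by (simp add: dyad_def power_decreasing)

lemma dyad_interval_exists:
  assumes "0 \<le> t" "t < 1"
  obtains k where "t \<in> dyad_interval k"
proof -
  have "\<exists>n. (1/2) ^ n < 1 - t" using assms by (intro real_arch_pow_inv) auto
  then have ex: "\<exists>n. t < dyad n" by (simp add: dyad_def algebra_simps)
  define n where "n = (LEAST n. t < dyad n)"
  have n: "t < dyad n" unfolding n_def using ex by (rule LeastI_ex)
  then have "n \<noteq> 0" using assms by (auto intro: ccontr)
  then obtain k where k: "n = Suc k" by (cases n) auto
  have "\<not> t < dyad k" unfolding n_def using not_less_Least[of k "\<lambda>n. t < dyad n"] k n_def by simp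
  then show thesis using n k by (intro that[of k]) (auto simp: dyad_interval_def)
qed

lemma dyad_interval_subset: "dyad_interval k \<subseteq> {0..<1}"
  using dyad_nonneg[of k] dyad_less_1[of "Suc k"] by (auto simp: dyad_interval_def)

lemma UN_dyad_interval: "(\<Union>k. dyad_interval k) = {0..<1}"
proof (intro set_eqI iffI)
  fix t assume "t \<in> (\<Union>k. dyad_interval k)"
  then show "t \<in> {0..<1}" using dyad_interval_subset by blast
next
  fix t :: real assume "t \<in> {0..<1}"
  then show "t \<in> (\<Union>k. dyad_interval k)" using dyad_interval_exists[of t] by auto
qed

lemma disjoint_dyad_interval: "disjoint_family dyad_interval"
proof (unfold disjoint_family_on_def, intro ballI impI)
  fix m n :: nat assume "m \<noteq> n"
  then consider "Suc m \<le> n" | "Suc n \<le> m" by linarith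
  then show "dyad_interval m \<inter> dyad_interval n = {}"
    by cases (use dyad_mono[of "Suc m" n] dyad_mono[of "Suc n" m] in \<open>auto simp: dyad_interval_def\<close>)
qed

lemma dyad_interval_borel [measurable]: "dyad_interval k \<in> sets borel"
  by (simp add: dyad_interval_def)

lemma indicator_UN_dyad: "indicator {0..<1} t = (\<Sum>k. indicator (dyad_interval k) t :: ennreal)"
  using suminf_indicator[OF disjoint_dyad_interval, of t] by (simp add: UN_dyad_interval)

lemma nn_integral_dyad:
  assumes [measurable]: "f \<in> borel_measurable lebesgue"
  shows "(\<integral>\<^sup>+t. f t * indicator {0..<1} t \<partial>lebesgue) = (\<Sum>k. \<integral>\<^sup>+t. f t * indicator (dyad_interval k) t \<partial>lebesgue)"
proof -
  have [measurable]: "dyad_interval k \<in> sets lebesgue" for k by simp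
  have "(\<Sum>k. \<integral>\<^sup>+t. f t * indicator (dyad_interval k) t \<partial>lebesgue) = (\<integral>\<^sup>+t. (\<Sum>k. f t * indicator (dyad_interval k) t) \<partial>lebesgue)"
    by (intro nn_integral_suminf[symmetric]) measurable
  then show ?thesis by (simp add: indicator_UN_dyad)
qed

lemma emeasure_dyad_interval: "emeasure lborel (dyad_interval k) = ennreal ((1/2) ^ Suc k)"
  by (simp add: dyad_interval_def dyad_def power_decreasing)

lemma dyad_step_le:
  assumes "\<And>i t. t \<in> dyad_interval i \<Longrightarrow> F t \<le> (B i :: ennreal)"
  shows "F t * indicator {0..<1} t \<le> (\<Sum>i. B i * indicator (dyad_interval i) t)"
proof (cases "t \<in> {0..<1}")
  case True
  then obtain k where k: "t \<in> dyad_interval k" using dyad_interval_exists by auto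
  have "F t \<le> B k" using assms k by simp
  also have "\<dots> = (\<Sum>i\<in>{k}. B i * indicator (dyad_interval i) t)" using k by simp
  also have "\<dots> \<le> (\<Sum>i. B i * indicator (dyad_interval i) t)" by (intro sum_le_suminf) auto
  finally show ?thesis using True by simp
qed auto

text \<open>\<open>F\<close> is replaced by a step function before anything is integrated termwise,
  so the lemma applies directly to powers of \<open>1 / tail \<omega> t\<close>.\<close>

lemma nn_integral_dyad_le:
  fixes F :: "real \<Rightarrow> ennreal"
  assumes "\<And>i t. t \<in> dyad_interval i \<Longrightarrow> F t \<le> B i"
  shows "(\<integral>\<^sup>+t. F t * indicator {0..<1} t \<partial>lborel) \<le> (\<Sum>i. ennreal ((1/2) ^ Suc i) * B i)"
proof -
  have "(\<integral>\<^sup>+t. F t * indicator {0..<1} t \<partial>lborel) \<le> (\<integral>\<^sup>+t. (\<Sum>i. B i * indicator (dyad_interval i) t) \<partial>lborel)"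
    by (intro nn_integral_mono dyad_step_le assms)
  also have "\<dots> = (\<Sum>i. ennreal ((1/2) ^ Suc i) * B i)"
    by (simp add: nn_integral_suminf nn_integral_cmult_indicator emeasure_dyad_interval mult.commute)
  finally show ?thesis .
qed

text \<open>From \<open>1 - x \<le> exp (- x)\<close> with \<open>x = 2 ^ (-k)\<close>. The exponent
  available is \<open>n\<close>, while the hypothesis bounds \<open>Suc n\<close>; the missing
  factor \<open>exp x\<close> is at most \<open>exp 1\<close>.\<close>

lemma power_le_exp_dyad:
  assumes "0 \<le> t" "t \<le> dyad k" "2 ^ j \<le> Suc n"
  shows "t ^ n \<le> exp 1 * exp (- (2 ^ j / 2 ^ k))"
proof -
  define x where "x = (1/2::real) ^ k"
  have x: "0 < x" "x \<le> 1" by (auto simp: x_def power_le_one)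
  have "t ^ n \<le> (1 - x) ^ n" using assms by (intro power_mono) (auto simp: dyad_def x_def)
  also have "\<dots> \<le> exp (- x) ^ n" using x exp_ge_add_one_self[of "-x"] by (intro power_mono) auto
  also have "\<dots> = exp (x - real (Suc n) * x)" by (simp add: algebra_simps flip: exp_of_nat_mult)
  also have "\<dots> \<le> exp (1 - 2 ^ j * x)"
  proof -
    have "(2::real) ^ j \<le> real (Suc n)" using assms(3) by (metis of_nat_le_iff of_nat_numeral of_nat_power)
    then show ?thesis using x by (auto intro!: diff_mono mult_right_mono)
  qed
  also have "\<dots> = exp 1 * exp (- (2 ^ j / 2 ^ k))" by (simp add: x_def power_divide flip: exp_add)
  finally show ?thesis .
qed

lemma blockD:
  assumes "n \<in> block j"
  shows "2 ^ j \<le> Suc n" "Suc n < 2 ^ Suc j"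
  using assms by (auto simp: block_def)

lemma finite_block [simp]: "finite (block j)" by (simp add: block_def)

lemma card_block [simp]: "card (block j) = 2 ^ j" by (simp add: block_def)

lemma sum_lessThan_block: "(\<Sum>n<2 ^ J - 1. f n) = (\<Sum>j<J. \<Sum>n\<in>block j. f n)" for f :: "nat \<Rightarrow> 'a::comm_monoid_add"
proof (induction J)
  case (Suc J)
  have "{..<2 ^ Suc J - 1} = {..<2 ^ J - 1} \<union> block J"
    by (auto simp: block_def)
  moreover have "{..<2 ^ J - 1} \<inter> block J = {}" by (auto simp: block_def)
  ultimately have "(\<Sum>n<2 ^ Suc J - 1. f n) = (\<Sum>n<2 ^ J - 1. f n) + (\<Sum>n\<in>block J. f n)"
    by (metis finite_block finite_lessThan sum.union_disjoint)
  then show ?case using Suc by simp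
qed auto

lemma sums_block:
  fixes f :: "nat \<Rightarrow> 'a::{topological_space, comm_monoid_add}"
  assumes "f sums s"
  shows "(\<lambda>j. \<Sum>n\<in>block j. f n) sums s"
proof -
  have "strict_mono (\<lambda>J::nat. 2 ^ J - 1 :: nat)"
    by (rule strict_mono_onI) (simp add: diff_less_mono)
  then have "(\<lambda>J. \<Sum>n<2 ^ J - 1. f n) \<longlonglongrightarrow> s"
    using assms LIMSEQ_subseq_LIMSEQ[of "\<lambda>N. \<Sum>n<N. f n" s "\<lambda>J. 2 ^ J - 1"] by (simp add: sums_def o_def)
  then show ?thesis by (simp only: sums_def sum_lessThan_block)
qed

lemma suminf_block: "(\<Sum>n. f n) = (\<Sum>j. \<Sum>n\<in>block j. f n :: ennreal)"
  using sums_block[of f "\<Sum>n. f n"] by (simp add: sums_iff)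

text \<open>Here \<open>j\<close> numbers a block and \<open>i\<close> a dyadic interval of radii,
  on which the exponential is the size of \<open>r ^ (2 ^ j - 1)\<close>. For
  \<open>j \<le> i\<close> the decay is that of \<open>2 powr ((j - i) / p)\<close>; for
  \<open>j > i\<close> the exponential outweighs the growth of this factor.\<close>

lemma dyadic_kernel_bound:
  fixes p :: real
  assumes "0 < p"
  obtains b C where "0 < b" "b < 1" "C > 0"
    "\<And>i j. 2 powr (real j / p) * exp (- (2 ^ j / 2 ^ Suc i)) \<le> C * 2 powr (real i / p) * b ^ ((i - j) + (j - i))"
proof -
  define b where "b = max (1/2) (2 powr - (1/p))"
  have b: "0 < b" "b < 1" using assms by (auto simp: b_def powr_less_one)
  obtain C where C: "C > 0" "\<And>m::nat. (2 powr (1/p)) ^ m * exp (- (1/2 * 2 ^ m)) \<le> C * (1/2) ^ m"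
    using superexponential_decay[of "2 powr (1/p)" "1/2"] by auto
  have "2 powr (real j / p) * exp (- (2 ^ j / 2 ^ Suc i)) \<le> (C + 1) * 2 powr (real i / p) * b ^ ((i - j) + (j - i))" for i j
  proof (cases "j \<le> i")
    case True
    have "2 powr (real j / p) * exp (- (2 ^ j / 2 ^ Suc i)) \<le> 2 powr (real j / p)" by simp
    also have "\<dots> = 2 powr (real i / p) * (2 powr - (1/p)) ^ (i - j)"
      using True by (simp add: powr_power of_nat_diff diff_divide_distrib flip: powr_add)
    also have "\<dots> \<le> 2 powr (real i / p) * b ^ (i - j)"
      by (intro mult_left_mono power_mono) (auto simp: b_def)
    also have "\<dots> \<le> (C + 1) * (2 powr (real i / p) * b ^ (i - j))"
      using C b mult_right_mono[of 1 "C + 1" "2 powr (real i / p) * b ^ (i - j)"] by simp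
    finally show ?thesis using True by (simp add: mult_ac)
  next
    case False
    then obtain m where m: "j = i + m" using le_iff_add[of i j] by auto
    have "2 powr (real j / p) * exp (- (2 ^ j / 2 ^ Suc i)) = 2 powr (real i / p) * ((2 powr (1/p)) ^ m * exp (- (1/2 * 2 ^ m)))"
      by (simp only: m powr_power power_add add_divide_distrib of_nat_add powr_add) (simp add: field_simps)
    also have "\<dots> \<le> 2 powr (real i / p) * (C * (1/2) ^ m)" by (intro mult_left_mono C) auto
    also have "\<dots> \<le> 2 powr (real i / p) * ((C + 1) * b ^ m)"
      using C by (intro mult_left_mono mult_mono power_mono) (auto simp: b_def)
    finally show ?thesis using m by (simp add: mult_ac)
  qed
  with b C(1) show thesis by (intro that[of b "C + 1"]) auto
qed

text \<open>The lacunary series is the common majorant for power series with block sums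
  \<open>2 powr (j / p) * h j\<close>: \<open>2 ^ j - 1\<close> is the first index of block
  \<open>j\<close>, so its power of \<open>r\<close> is the largest one in the block.\<close>

definition dyadic_series_bounded :: "real \<Rightarrow> real \<Rightarrow> bool" where
  "dyadic_series_bounded p C \<longleftrightarrow> (\<forall>h H. (\<forall>j. 0 \<le> h j) \<longrightarrow> 0 \<le> H \<longrightarrow> (\<Sum>j. ennreal (h j powr p)) \<le> ennreal H \<longrightarrow>
      (\<forall>r\<in>{0..<1}. summable (\<lambda>j. 2 powr (real j / p) * h j * r ^ (2 ^ j - 1))) \<and>
      (\<integral>\<^sup>+r. ennreal ((\<Sum>j. 2 powr (real j / p) * h j * r ^ (2 ^ j - 1)) powr p) * indicator {0..<1} r \<partial>lborel) \<le> ennreal (C * H))"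

lemma dyadic_series_boundedD:
  assumes "dyadic_series_bounded p C" "\<And>j. 0 \<le> h j" "0 \<le> H" "(\<Sum>j. ennreal (h j powr p)) \<le> ennreal H"
  shows "(\<forall>r\<in>{0..<1}. summable (\<lambda>j. 2 powr (real j / p) * h j * r ^ (2 ^ j - 1))) \<and>
      (\<integral>\<^sup>+r. ennreal ((\<Sum>j. 2 powr (real j / p) * h j * r ^ (2 ^ j - 1)) powr p) * indicator {0..<1} r \<partial>lborel) \<le> ennreal (C * H)"
  using assms unfolding dyadic_series_bounded_def by blast

text \<open>On the dyadic interval \<open>i\<close> the series is at most a constant times
  \<open>2 powr (i / p) * x i\<close>, where \<open>x\<close> is a geometric convolution of
  \<open>h\<close>. The p-th power of \<open>2 powr (i / p)\<close> cancels the length of the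
  interval, which leaves the sum of \<open>x i powr p\<close>.\<close>

lemma dyadic_series_Lp:
  fixes p :: real
  assumes p: "1 < p"
  shows "\<exists>C>0. dyadic_series_bounded p C"
proof -
  obtain b K where b: "0 < b" "b < 1" and K: "K > 0"
    and bK: "\<And>i j. 2 powr (real j / p) * exp (- (2 ^ j / 2 ^ Suc i)) \<le> K * 2 powr (real i / p) * b ^ ((i - j) + (j - i))"
    using dyadic_kernel_bound[of p] p by auto
  obtain C where C: "C > 0" and conv: "geometric_convolution_bounded b p C"
    using geometric_convolution_bound[OF b p] by blast
  define L where "L = exp 1 * K"
  have L: "L > 0" using K by (simp add: L_def)
  show ?thesis
    unfolding dyadic_series_bounded_def
  proof (intro exI[of _ "L powr p * C"] conjI allI impI)
    show "L powr p * C > 0" using C L by simp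
    fix h :: "nat \<Rightarrow> real" and H :: real
    assume h': "\<forall>j. 0 \<le> h j" and H: "0 \<le> H" and hH: "(\<Sum>j. ennreal (h j powr p)) \<le> ennreal H"
    have h: "\<And>j. 0 \<le> h j" using h' by simp
    define x where "x i = (\<Sum>j. b ^ ((i - j) + (j - i)) * h j)" for i
    note cv = geometric_convolution_boundedD[OF conv, OF h H hH]
    have x0: "x i \<ge> 0" for i unfolding x_def using b h cv by (intro suminf_nonneg) auto
    have t: "2 powr (real j / p) * h j * r ^ (2 ^ j - 1) \<le> L * 2 powr (real i / p) * (b ^ ((i - j) + (j - i)) * h j)"
      if "r \<in> dyad_interval i" for i j r
    proof -
      have "r ^ (2 ^ j - 1) \<le> exp 1 * exp (- (2 ^ j / 2 ^ Suc i))"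
        using that dyad_interval_subset[of i] by (intro power_le_exp_dyad) (auto simp: dyad_interval_def)
      then have "2 powr (real j / p) * h j * r ^ (2 ^ j - 1) \<le> 2 powr (real j / p) * h j * (exp 1 * exp (- (2 ^ j / 2 ^ Suc i)))"
        using h by (intro mult_left_mono) auto
      also have "\<dots> = exp 1 * h j * (2 powr (real j / p) * exp (- (2 ^ j / 2 ^ Suc i)))" by (simp add: mult_ac)
      also have "\<dots> \<le> exp 1 * h j * (K * 2 powr (real i / p) * b ^ ((i - j) + (j - i)))"
        using h by (intro mult_left_mono bK) auto
      finally show ?thesis by (simp add: L_def mult_ac)
    qed
    have summ: "summable (\<lambda>j. 2 powr (real j / p) * h j * r ^ (2 ^ j - 1))"
      and le: "(\<Sum>j. 2 powr (real j / p) * h j * r ^ (2 ^ j - 1)) \<le> L * 2 powr (real i / p) * x i"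
      and ge: "0 \<le> (\<Sum>j. 2 powr (real j / p) * h j * r ^ (2 ^ j - 1))"
      if r: "r \<in> dyad_interval i" for r i
    proof -
      have r0: "r \<ge> 0" using r dyad_interval_subset[of i] by auto
      have s: "summable (\<lambda>j. L * 2 powr (real i / p) * (b ^ ((i - j) + (j - i)) * h j))"
        using cv by (intro summable_mult) auto
      show *: "summable (\<lambda>j. 2 powr (real j / p) * h j * r ^ (2 ^ j - 1))"
        using t[OF r] h r0 by (intro summable_comparison_test'[OF s]) auto
      show "(\<Sum>j. 2 powr (real j / p) * h j * r ^ (2 ^ j - 1)) \<le> L * 2 powr (real i / p) * x i"
      proof -
        have "(\<Sum>j. 2 powr (real j / p) * h j * r ^ (2 ^ j - 1)) \<le> (\<Sum>j. L * 2 powr (real i / p) * (b ^ ((i - j) + (j - i)) * h j))"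
          by (intro suminf_le t[OF r] * s)
        also have "\<dots> = L * 2 powr (real i / p) * x i"
          unfolding x_def using cv by (intro suminf_mult) auto
        finally show ?thesis .
      qed
      show "0 \<le> (\<Sum>j. 2 powr (real j / p) * h j * r ^ (2 ^ j - 1))"
        using h r0 by (intro suminf_nonneg *) auto
    qed
    have "(\<integral>\<^sup>+r. ennreal ((\<Sum>j. 2 powr (real j / p) * h j * r ^ (2 ^ j - 1)) powr p) * indicator {0..<1} r \<partial>lborel)
      \<le> (\<Sum>i. ennreal ((1/2) ^ Suc i) * ennreal ((L * 2 powr (real i / p) * x i) powr p))"
      using p le ge by (intro nn_integral_dyad_le ennreal_leI powr_mono2) auto
    also have "\<dots> \<le> (\<Sum>i. ennreal (L powr p) * ennreal (x i powr p))"
    proof (intro suminf_le)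
      fix i
      have "(1/2) ^ Suc i * (L * 2 powr (real i / p) * x i) powr p = (1/2) * (L powr p * x i powr p)"
        using L x0[of i] p by (simp add: powr_mult powr_powr powr_realpow power_divide)
      also have "\<dots> \<le> L powr p * x i powr p" by simp
      finally show "ennreal ((1/2) ^ Suc i) * ennreal ((L * 2 powr (real i / p) * x i) powr p) \<le> ennreal (L powr p) * ennreal (x i powr p)"
        by (simp flip: ennreal_mult'')
    qed auto
    also have "\<dots> \<le> ennreal (L powr p) * ennreal (C * H)"
      using cv by (simp add: mult_left_mono x_def)
    finally have "(\<integral>\<^sup>+r. ennreal ((\<Sum>j. 2 powr (real j / p) * h j * r ^ (2 ^ j - 1)) powr p) * indicator {0..<1} r \<partial>lborel) \<le> ennreal (L powr p * C * H)"
      using H C by (simp add: mult.assoc flip: ennreal_mult'')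
    then show "(\<integral>\<^sup>+r. ennreal ((\<Sum>j. 2 powr (real j / p) * h j * r ^ (2 ^ j - 1)) powr p) * indicator {0..<1} r \<partial>lborel) \<le> ennreal (L powr p * C * H)" .
    show "\<forall>r\<in>{0..<1}. summable (\<lambda>j. 2 powr (real j / p) * h j * r ^ (2 ^ j - 1))"
      using summ dyad_interval_exists by (metis atLeastLessThan_iff)
  qed
qed

section \<open>Integrals over circles\<close>

abbreviation circle_integral :: "(real \<Rightarrow> ennreal) \<Rightarrow> ennreal" where
  "circle_integral F \<equiv> (\<integral>\<^sup>+t. F t * indicator {0..2*pi} t \<partial>lborel)"

text \<open>Distance from the angle \<open>\<theta> \<in> [0, 2 * pi]\<close> to the direction of \<open>1\<close>, scaled to \<open>[0, 1]\<close>.\<close>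

definition angle_dist :: "real \<Rightarrow> real" where
  "angle_dist \<theta> = min \<theta> (2 * pi - \<theta>) / pi"

text \<open>\<open>1 - angle_dist \<theta>\<close> runs through [0,1) twice at speed
  \<open>1 / pi\<close>, once on each half of the circle. The angles 0 and \<open>2 * pi\<close> are
  sent to 1, outside the half-open interval, and are discarded as a null set.\<close>

lemma nn_integral_angle_dist_le:
  fixes F :: "real \<Rightarrow> ennreal"
  assumes [measurable]: "F \<in> borel_measurable borel"
  shows "(circle_integral (\<lambda>\<theta>. F (1 - angle_dist \<theta>))) \<le> ennreal (2 * pi) * (\<integral>\<^sup>+u. F u * indicator {0..<1} u \<partial>lborel)"
proof -
  have AE: "AE \<theta> in lborel. \<theta> \<noteq> 0 \<and> \<theta> \<noteq> 2 * pi" 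
    using AE_lborel_singleton[of "0::real"] AE_lborel_singleton[of "2*pi"] by eventually_elim simp
  have "(circle_integral (\<lambda>\<theta>. F (1 - angle_dist \<theta>)))
     \<le> (\<integral>\<^sup>+\<theta>. (F (1 + (-1/pi) * \<theta>) * indicator {0..<1} (1 + (-1/pi) * \<theta>) + F (-1 + (1/pi) * \<theta>) * indicator {0..<1} (-1 + (1/pi) * \<theta>)) \<partial>lborel)"
  proof (rule nn_integral_mono_AE, use AE in eventually_elim)
    case (elim t)
    show ?case
    proof (cases "t \<in> {0..2*pi}")
      case True
      then have t: "0 < t" "t < 2 * pi" using elim by auto
      show ?thesis
      proof (cases "t \<le> pi")
        case True
        then have "angle_dist t = t / pi" "1 + (-1/pi) * t \<in> {0..<1}" using t by (auto simp: angle_dist_def field_simps)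
        then show ?thesis by (simp add: indicator_def)
      next
        case False
        then have "angle_dist t = 2 - t / pi" "-1 + (1/pi) * t \<in> {0..<1}" using t by (auto simp: angle_dist_def field_simps)
        then show ?thesis by (simp add: indicator_def)
      qed
    qed auto
  qed
  also have "\<dots> = (\<integral>\<^sup>+\<theta>. F (1 + (-1/pi) * \<theta>) * indicator {0..<1} (1 + (-1/pi) * \<theta>) \<partial>lborel)
      + (\<integral>\<^sup>+\<theta>. F (-1 + (1/pi) * \<theta>) * indicator {0..<1} (-1 + (1/pi) * \<theta>) \<partial>lborel)"
    by (intro nn_integral_add) measurable
  also have "(\<integral>\<^sup>+\<theta>. F (1 + (-1/pi) * \<theta>) * indicator {0..<1} (1 + (-1/pi) * \<theta>) \<partial>lborel) = ennreal pi * (\<integral>\<^sup>+u. F u * indicator {0..<1} u \<partial>lborel)"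
    by (subst nn_integral_real_affine[of "\<lambda>u. F u * indicator {0..<1} u" "-1/pi" 1])
       (simp_all flip: mult.assoc ennreal_mult')
  also have "(\<integral>\<^sup>+\<theta>. F (-1 + (1/pi) * \<theta>) * indicator {0..<1} (-1 + (1/pi) * \<theta>) \<partial>lborel) = ennreal pi * (\<integral>\<^sup>+u. F u * indicator {0..<1} u \<partial>lborel)"
    by (subst nn_integral_real_affine[of "\<lambda>u. F u * indicator {0..<1} u" "1/pi" "-1"])
       (simp_all flip: mult.assoc ennreal_mult')
  finally show ?thesis by (simp flip: distrib_right ennreal_plus)
qed

text \<open>The circle is cut into dyadic arcs according to the distance from the direction of 1.
  The bound \<open>B i\<close> is required at all angles beyond \<open>2 ^ (- (i + 1))\<close>,
  which is how the estimates in terms of \<open>norm (1 - z)\<close> deliver it.\<close>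

lemma nn_integral_angle_dyad_le:
  fixes F :: "real \<Rightarrow> ennreal"
  assumes "\<And>i \<theta>. \<theta> \<in> {0..2*pi} \<Longrightarrow> (1/2) ^ Suc i < angle_dist \<theta> \<Longrightarrow> F \<theta> \<le> B i"
  shows "(circle_integral (\<lambda>\<theta>. F \<theta>)) \<le> ennreal (2 * pi) * (\<Sum>i. ennreal ((1/2) ^ Suc i) * B i)"
proof -
  define G where "G u = (\<Sum>i. B i * indicator (dyad_interval i) u)" for u
  have AE: "AE \<theta> in lborel. \<theta> \<noteq> 0 \<and> \<theta> \<noteq> 2 * pi" 
    using AE_lborel_singleton[of "0::real"] AE_lborel_singleton[of "2*pi"] by eventually_elim simp
  have "(circle_integral (\<lambda>\<theta>. F \<theta>)) \<le> (circle_integral (\<lambda>\<theta>. G (1 - angle_dist \<theta>)))"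
  proof (rule nn_integral_mono_AE, use AE in eventually_elim)
    case (elim t)
    show ?case
    proof (cases "t \<in> {0..2*pi}")
      case True
      then have "0 < t" "t < 2 * pi" using elim by auto
      then have u: "0 < angle_dist t" "angle_dist t \<le> 1" by (auto simp: angle_dist_def min_def field_simps)
      then obtain i where i: "1 - angle_dist t \<in> dyad_interval i" using dyad_interval_exists[of "1 - angle_dist t"] by auto
      then have "F t \<le> B i" by (intro assms True) (auto simp: dyad_interval_def dyad_def)
      also have "\<dots> = (\<Sum>k\<in>{i}. B k * indicator (dyad_interval k) (1 - angle_dist t))" using i by simp
      also have "\<dots> \<le> G (1 - angle_dist t)" unfolding G_def by (intro sum_le_suminf) auto
      finally show ?thesis using True by simp
    qed auto
  qed
  also have "\<dots> \<le> ennreal (2 * pi) * (\<integral>\<^sup>+u. G u * indicator {0..<1} u \<partial>lborel)"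
    unfolding G_def by (intro nn_integral_angle_dist_le) measurable
  also have "(\<integral>\<^sup>+u. G u * indicator {0..<1} u \<partial>lborel) \<le> (\<integral>\<^sup>+u. G u \<partial>lborel)"
    by (intro nn_integral_mono) (auto simp: indicator_def)
  also have "(\<integral>\<^sup>+u. G u \<partial>lborel) = (\<Sum>i. ennreal ((1/2) ^ Suc i) * B i)"
    unfolding G_def by (simp add: nn_integral_suminf nn_integral_cmult_indicator emeasure_dyad_interval mult.commute)
  finally show ?thesis by (simp add: mult_left_mono)
qed

text \<open>On the unit circle the distance to 1 is \<open>2 * sin (\<theta> / 2)\<close>, at least
  \<open>2 * angle_dist \<theta>\<close> by Jordan's inequality. Moving inwards to radius
  \<open>r\<close> costs at most \<open>1 - r\<close>, which is itself at most the distance in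
  question; so half of the bound survives.\<close>

lemma norm_one_minus_rcis_ge:
  assumes "0 \<le> r" "r \<le> 1" "0 \<le> \<theta>" "\<theta> \<le> 2 * pi"
  shows "angle_dist \<theta> \<le> norm (1 - of_real r * cis \<theta>)" "1 - r \<le> norm (1 - of_real r * cis \<theta>)"
proof -
  show 1: "1 - r \<le> norm (1 - of_real r * cis \<theta>)"
    using norm_triangle_ineq2[of 1 "of_real r * cis \<theta>"] assms by (simp add: norm_mult)
  have s: "angle_dist \<theta> \<le> sin (\<theta> / 2)"
  proof -
    have jordan: "2 * x / pi \<le> sin x" if "0 \<le> x" "x \<le> pi / 2" for x
    proof -
      \<comment> \<open>Jordan's inequality: the concave sine lies above its chord from 0 to
        \<open>pi / 2\<close>.\<close>
      have "concave_on {0..pi/2} sin"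
        by (rule f''_le0_imp_concave[where f' = cos and f'' = "\<lambda>x. - sin x"]) (auto intro!: derivative_eq_intros sin_ge_zero)
      then have "sin ((1 - 2 * x / pi) *\<^sub>R 0 + (2 * x / pi) *\<^sub>R (pi / 2)) \<ge> (1 - 2 * x / pi) * sin 0 + (2 * x / pi) * sin (pi / 2)"
        using that by (intro concave_onD) (auto simp: field_simps)
      then show ?thesis by simp
    qed
    show ?thesis
    proof (cases "\<theta> \<le> pi")
      case True
      then show ?thesis using jordan[of "\<theta> / 2"] assms by (simp add: angle_dist_def)
    next
      case False
      have "2 * (pi - \<theta> / 2) / pi \<le> sin (pi - \<theta> / 2)" using False assms by (intro jordan) auto
      then show ?thesis using False assms by (simp add: angle_dist_def)
    qed
  qed
  have "norm (1 - cis \<theta>) = 2 * sin (\<theta> / 2)"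
  proof -
    have "(norm (1 - cis \<theta>))\<^sup>2 = (1 - cos \<theta>)\<^sup>2 + (sin \<theta>)\<^sup>2" by (simp add: cmod_power2)
    also have "\<dots> = 2 - 2 * cos \<theta>" using sin_cos_squared_add2[of \<theta>] by (simp add: power2_eq_square algebra_simps)
    also have "cos \<theta> = 1 - 2 * (sin (\<theta> / 2))\<^sup>2" using cos_double_sin[of "\<theta> / 2"] by simp
    finally have "(norm (1 - cis \<theta>))\<^sup>2 = (2 * sin (\<theta> / 2))\<^sup>2" by (simp add: power2_eq_square)
    then have "norm (1 - cis \<theta>) = 2 * sin (\<theta> / 2)"
      using assms sin_ge_zero[of "\<theta> / 2"] by (subst (asm) power2_eq_iff_nonneg) auto
    then show ?thesis .
  qed
  moreover have "norm (1 - cis \<theta>) \<le> norm (1 - of_real r * cis \<theta>) + (1 - r)"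
  proof -
    have "1 - cis \<theta> = (1 - of_real r * cis \<theta>) - of_real (1 - r) * cis \<theta>" by (simp add: algebra_simps)
    then have "norm (1 - cis \<theta>) = norm ((1 - of_real r * cis \<theta>) - of_real (1 - r) * cis \<theta>)" by (rule arg_cong)
    also have "\<dots> \<le> norm (1 - of_real r * cis \<theta>) + norm (of_real (1 - r) * cis \<theta>)" by (rule norm_triangle_ineq4)
    also have "norm (of_real (1 - r) * cis \<theta>) = 1 - r" using assms by (simp add: norm_mult del: of_real_diff)
    finally show ?thesis .
  qed
  ultimately show "angle_dist \<theta> \<le> norm (1 - of_real r * cis \<theta>)" using s 1 by linarith
qed

text \<open>Let \<open>x = 1 - r\<close> be about \<open>2 ^ (-k)\<close>. On the arc at distance
  about \<open>y = 2 ^ (- (i + 1))\<close> the integrand is at most \<open>max x y powr - s\<close>,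
  so the arc contributes \<open>y * max x y powr - s\<close>. This is largest near
  \<open>i = k\<close>, where it is about \<open>x powr (1 - s)\<close>, and decays geometrically in
  both directions.\<close>

lemma angle_integral_bound:
  fixes s :: real
  assumes "1 < s"
  obtains C where "C > 0" "\<And>r. 0 \<le> r \<Longrightarrow> r < 1 \<Longrightarrow>
    (circle_integral (\<lambda>\<theta>. ennreal (norm (1 - of_real r * cis \<theta>) powr - s))) \<le> ennreal (C * (1 - r) powr (1 - s))"
proof -
  \<comment> \<open>Ratio 1/2 for arcs closer to 1 than \<open>x\<close>, where only their length
    shrinks; ratio \<open>2 powr (1 - s)\<close> for arcs farther away.\<close>
  define b where "b = max (1/2) (2 powr (1 - s))"
  have b: "0 < b" "b < 1" using assms by (auto simp: b_def powr_less_one)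
  define C where "C = 2 * pi * (2 powr (s - 1) * (2 / (1 - b)))"
  have "(circle_integral (\<lambda>\<theta>. ennreal (norm (1 - of_real r * cis \<theta>) powr - s))) \<le> ennreal (C * (1 - r) powr (1 - s))"
    if r: "0 \<le> r" "r < 1" for r
  proof -
    define x where "x = 1 - r"
    obtain k where "r \<in> dyad_interval k" using dyad_interval_exists r by blast
    then have k: "(1/2) ^ Suc k < x" "x \<le> (1/2) ^ k" by (auto simp: dyad_interval_def dyad_def x_def)
    have x: "x > 0" using r by (simp add: x_def)
    have "(circle_integral (\<lambda>\<theta>. ennreal (norm (1 - of_real r * cis \<theta>) powr - s)))
       \<le> ennreal (2 * pi) * (\<Sum>i. ennreal ((1/2) ^ Suc i) * ennreal (max x ((1/2) ^ Suc i) powr - s))"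
    proof (intro nn_integral_angle_dyad_le ennreal_leI)
      fix i \<theta> assume t: "\<theta> \<in> {0..2*pi}" "(1/2) ^ Suc i < angle_dist \<theta>"
      then have "max x ((1/2) ^ Suc i) \<le> norm (1 - of_real r * cis \<theta>)"
        using norm_one_minus_rcis_ge[of r \<theta>] r by (auto simp: x_def)
      then show "norm (1 - of_real r * cis \<theta>) powr - s \<le> max x ((1/2) ^ Suc i) powr - s"
        using x assms by (intro powr_mono2') auto
    qed
    also have "\<dots> \<le> ennreal (2 * pi) * (\<Sum>i. ennreal (2 powr (s - 1) * x powr (1 - s)) * ennreal (b ^ ((k - i) + (i - k))))"
    proof (intro mult_left_mono suminf_le)
      fix i
      define y where "y = (1/2::real) ^ Suc i"
      have y: "y > 0" by (simp add: y_def)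
      have "y * max x y powr - s \<le> 2 powr (s - 1) * x powr (1 - s) * b ^ ((k - i) + (i - k))"
      proof (cases "k \<le> i")
        case True
        have "y * max x y powr - s \<le> y * x powr - s" using x y assms by (intro mult_left_mono powr_mono2') auto
        also have "\<dots> = x powr (1 - s) * (y / x)" using x by (simp add: powr_diff powr_minus field_simps)
        finally have *: "y * max x y powr - s \<le> x powr (1 - s) * (y / x)" .
        have "y / x \<le> (1/2) ^ (i - k)"
        proof -
          have "y = (1/2) ^ Suc k * (1/2) ^ (i - k)" using True by (simp add: y_def flip: power_add)
          also have "\<dots> \<le> x * (1/2) ^ (i - k)" using k by (intro mult_right_mono) auto
          finally show ?thesis using x by (simp add: field_simps)
        qed
        also have "(1/2) ^ (i - k) \<le> b ^ (i - k)" by (intro power_mono) (auto simp: b_def)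
        also have "b ^ (i - k) \<le> 2 powr (s - 1) * b ^ (i - k)"
          using b assms ge_one_powr_ge_zero[of 2 "s - 1"] mult_right_mono[of 1 "2 powr (s - 1)" "b ^ (i - k)"] by simp
        finally have "x powr (1 - s) * (y / x) \<le> x powr (1 - s) * (2 powr (s - 1) * b ^ (i - k))" by (intro mult_left_mono) auto
        with * have "y * max x y powr - s \<le> x powr (1 - s) * (2 powr (s - 1) * b ^ (i - k))" by (rule order_trans)
        then show ?thesis using True by (simp add: mult_ac)
      next
        case False
        have "y * max x y powr - s \<le> y * y powr - s" using x y assms by (intro mult_left_mono powr_mono2') auto
        also have "\<dots> = x powr (1 - s) * (y / x) powr (1 - s)" using x y by (simp add: powr_diff powr_minus powr_divide field_simps)
        finally have *: "y * max x y powr - s \<le> x powr (1 - s) * (y / x) powr (1 - s)" .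
        \<comment> \<open>The exponent \<open>1 - s\<close> is negative, so a lower bound for
          \<open>y / x\<close> is needed; it comes from \<open>x \<le> 2 ^ (-k)\<close>.\<close>
        have "(y / x) powr (1 - s) \<le> (1/2 * 2 ^ (k - i)) powr (1 - s)"
        proof (intro powr_mono2')
          have "1/2 * 2 ^ (k - i) * x \<le> 1/2 * 2 ^ (k - i) * (1/2) ^ k" using k by (intro mult_left_mono) auto
          also have "\<dots> = y" using False by (simp add: y_def power_diff field_simps power_divide)
          finally show "1/2 * 2 ^ (k - i) \<le> y / x" using x by (simp add: field_simps)
        qed (use assms in auto)
        also have "\<dots> = 2 powr (s - 1) * (2 powr (1 - s)) ^ (k - i)"
          by (simp add: powr_mult powr_power powr_divide powr_diff powr_minus field_simps flip: powr_realpow powr_powr powr_add)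
             (simp add: powr_powr mult.commute powr_diff field_simps)
        also have "\<dots> \<le> 2 powr (s - 1) * b ^ (k - i)"
          by (intro mult_left_mono power_mono) (auto simp: b_def)
        finally have "x powr (1 - s) * (y / x) powr (1 - s) \<le> x powr (1 - s) * (2 powr (s - 1) * b ^ (k - i))" by (intro mult_left_mono) auto
        with * have "y * max x y powr - s \<le> x powr (1 - s) * (2 powr (s - 1) * b ^ (k - i))" by (rule order_trans)
        then show ?thesis using False by (simp add: mult_ac)
      qed
      then show "ennreal ((1/2) ^ Suc i) * ennreal (max x ((1/2) ^ Suc i) powr - s) \<le> ennreal (2 powr (s - 1) * x powr (1 - s)) * ennreal (b ^ ((k - i) + (i - k)))"
        unfolding y_def[symmetric] using b y by (simp flip: ennreal_mult add: ennreal_leI)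
    qed auto
    also have "\<dots> = ennreal (2 * pi * (2 powr (s - 1) * x powr (1 - s))) * (\<Sum>i. ennreal (b ^ ((k - i) + (i - k))))"
      by (simp add: ennreal_mult' mult.assoc)
    also have "\<dots> \<le> ennreal (2 * pi * (2 powr (s - 1) * x powr (1 - s))) * ennreal (2 / (1 - b))"
      by (intro mult_left_mono sum_geometric_kernel b) auto
    also have "\<dots> = ennreal (C * x powr (1 - s))"
      using b by (simp add: C_def mult_ac flip: ennreal_mult)
    finally show ?thesis by (simp add: x_def)
  qed
  moreover have "C > 0" using b by (simp add: C_def)
  ultimately show thesis using that by blast
qed

section \<open>Polar coordinates\<close>

lemma measurable_Complex [measurable]:
  "case_prod Complex \<in> borel_measurable (lborel \<Otimes>\<^sub>M lborel)"
proof -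
  have "continuous_on UNIV (\<lambda>x::real\<times>real. Complex (fst x) (snd x))"
    by (simp add: Complex_eq continuous_intros)
  then have "(\<lambda>x::real\<times>real. Complex (fst x) (snd x)) \<in> borel_measurable borel"
    by (rule borel_measurable_continuous_onI)
  then show ?thesis by (simp add: case_prod_beta' lborel_prod)
qed

lemma lborel_complex_eq: "(lborel :: complex measure) = distr (lborel \<Otimes>\<^sub>M lborel) borel (case_prod Complex)"
proof (rule lborel_eqI)
  fix l u :: complex assume le: "\<And>b. b \<in> Basis \<Longrightarrow> l \<bullet> b \<le> u \<bullet> b"
  have l: "Re l \<le> Re u" "Im l \<le> Im u" using le[of 1] le[of \<i>] by (auto simp: Basis_complex_def)
  have "case_prod Complex -` box l u \<inter> space (lborel \<Otimes>\<^sub>M lborel) = box (Re l) (Re u) \<times> box (Im l) (Im u)"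
    by (auto simp: in_box_complex_iff space_pair_measure)
  then have "emeasure (distr (lborel \<Otimes>\<^sub>M lborel) borel (case_prod Complex)) (box l u) = ennreal (Re u - Re l) * ennreal (Im u - Im l)"
    using l by (simp add: emeasure_distr lborel.emeasure_pair_measure_Times)
  also have "\<dots> = ennreal (\<Prod>b\<in>Basis. (u - l) \<bullet> b)"
    using l by (simp add: Basis_complex_def ennreal_mult)
  finally show "emeasure (distr (lborel \<Otimes>\<^sub>M lborel) borel (case_prod Complex)) (box l u) = ennreal (\<Prod>b\<in>Basis. (u - l) \<bullet> b)" .
qed simp

text \<open>The substitution rule is used on compact intervals. The line is exhausted by the
  intervals from \<open>- Suc n\<close> to \<open>Suc n\<close>, whose preimages end at
  \<open>arctan (Suc n)\<close> and exhaust the open interval of angles; monotone convergence does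
  the rest.\<close>

lemma nn_integral_tan_substitution:
  fixes G :: "real \<Rightarrow> ennreal"
  assumes [measurable]: "G \<in> borel_measurable borel"
  shows "(\<integral>\<^sup>+u. G u \<partial>lborel) = (\<integral>\<^sup>+t. G (tan t) * ennreal (1 + (tan t)\<^sup>2) * indicator {- (pi/2)<..<pi/2} t \<partial>lborel)"
proof -
  define a :: "nat \<Rightarrow> real" where "a n = arctan (real (Suc n))" for n
  have a: "0 < a n" "a n < pi/2" for n by (simp add: a_def) (simp only: a_def arctan_ubound)
  have ta: "tan (a n) = Suc n" for n by (simp add: a_def tan_arctan)
  have inc: "a m \<le> a n" if "m \<le> n" for m n using that by (simp add: a_def arctan_le_iff)
  have c: "cos x \<noteq> 0" if "- (pi/2) < x" "x < pi/2" for x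
    using cos_gt_zero_pi[of x] that by auto
  have [measurable]: "(\<lambda>t. tan t :: real) \<in> borel_measurable borel"
    unfolding tan_def by measurable
  have eq: "(\<integral>\<^sup>+x. G x * indicator {- real (Suc n)..real (Suc n)} x \<partial>lborel) =
     (\<integral>\<^sup>+t. G (tan t) * ennreal (1 + (tan t)\<^sup>2) * indicator {- a n..a n} t \<partial>lborel)" for n
  proof -
    have "(\<integral>\<^sup>+x. G x * indicator {tan (- a n)..tan (a n)} x \<partial>lborel) =
      (\<integral>\<^sup>+t. G (tan t) * ennreal (1 + (tan t)\<^sup>2) * indicator {- a n..a n} t \<partial>lborel)"
    proof (rule nn_integral_substitution_aux)
      fix x assume x: "x \<in> {- a n..a n}"
      then have "cos x \<noteq> 0" using a[of n] by (intro c) auto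
      then show "(tan has_real_derivative 1 + (tan x)\<^sup>2) (at x)"
        by (auto intro!: derivative_eq_intros simp: tan_sec power_inverse)
    next
      have "cos x \<noteq> 0" if "x \<in> {- a n..a n}" for x using a[of n] that by (intro c) auto
      then show "continuous_on {- a n..a n} (\<lambda>t. 1 + (tan t)\<^sup>2)"
        by (intro continuous_intros) auto
    qed (use a[of n] in auto)
    then show ?thesis by (simp only: tan_minus ta)
  qed
  have 1: "(SUP n. G x * indicator {- real (Suc n)..real (Suc n)} x) = G x" for x
  proof -
    obtain n where n: "\<bar>x\<bar> \<le> real n" using real_arch_simple by blast
    show ?thesis
    proof (rule antisym)
      show "G x \<le> (SUP n. G x * indicator {- real (Suc n)..real (Suc n)} x)"
        using n by (intro SUP_upper2[of n]) (auto simp: indicator_def)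
    qed (auto intro!: SUP_least simp: indicator_def)
  qed
  have 2: "(SUP n. G (tan t) * ennreal (1 + (tan t)\<^sup>2) * indicator {- a n..a n} t) = G (tan t) * ennreal (1 + (tan t)\<^sup>2) * indicator {- (pi/2)<..<pi/2} t" for t
  proof (rule antisym)
    show "(SUP n. G (tan t) * ennreal (1 + (tan t)\<^sup>2) * indicator {- a n..a n} t) \<le> G (tan t) * ennreal (1 + (tan t)\<^sup>2) * indicator {- (pi/2)<..<pi/2} t"
    proof (intro SUP_least mult_left_mono)
      fix n show "indicator {- a n..a n} t \<le> (indicator {- (pi/2)<..<pi/2} t :: ennreal)"
        using a[of n] by (auto simp: indicator_def)
    qed auto
    show "G (tan t) * ennreal (1 + (tan t)\<^sup>2) * indicator {- (pi/2)<..<pi/2} t \<le> (SUP n. G (tan t) * ennreal (1 + (tan t)\<^sup>2) * indicator {- a n..a n} t)"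
    proof (cases "t \<in> {- (pi/2)<..<pi/2}")
      case True
      obtain n where n: "\<bar>tan t\<bar> \<le> real n" using real_arch_simple by blast
      then have "\<bar>arctan (tan t)\<bar> \<le> a n"
        using arctan_monotone'[of "tan t" "real (Suc n)"] arctan_monotone'[of "- tan t" "real (Suc n)"]
        by (auto simp: a_def abs_le_iff arctan_minus)
      then have "t \<in> {- a n..a n}" using True arctan_tan[of t] by (auto simp: abs_le_iff)
      then show ?thesis using True by (intro SUP_upper2[of n]) auto
    qed auto
  qed
  have "(\<integral>\<^sup>+u. G u \<partial>lborel) = (\<integral>\<^sup>+u. (SUP n. G u * indicator {- real (Suc n)..real (Suc n)} u) \<partial>lborel)"
    by (simp only: 1)
  also have "\<dots> = (SUP n. \<integral>\<^sup>+u. G u * indicator {- real (Suc n)..real (Suc n)} u \<partial>lborel)"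
    by (intro nn_integral_monotone_convergence_SUP) (auto simp: incseq_def le_fun_def indicator_def)
  also have "\<dots> = (SUP n. \<integral>\<^sup>+t. G (tan t) * ennreal (1 + (tan t)\<^sup>2) * indicator {- a n..a n} t \<partial>lborel)"
    by (simp only: eq)
  also have "\<dots> = (\<integral>\<^sup>+t. (SUP n. G (tan t) * ennreal (1 + (tan t)\<^sup>2) * indicator {- a n..a n} t) \<partial>lborel)"
  proof (intro nn_integral_monotone_convergence_SUP[symmetric])
    show "incseq (\<lambda>n t. G (tan t) * ennreal (1 + (tan t)\<^sup>2) * indicator {- a n..a n} t)"
      unfolding incseq_def le_fun_def
    proof (intro allI impI mult_left_mono)
      fix m n t assume "m \<le> (n::nat)"
      then show "indicator {- a m..a m} t \<le> (indicator {- a n..a n} t :: ennreal)"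
        using inc[of m n] by (auto simp: indicator_def)
    qed auto
  qed measurable
  finally show ?thesis by (simp only: 2)
qed

lemma borel_measurable_cis [measurable]: "cis \<in> borel_measurable borel"
  by (intro borel_measurable_continuous_onI continuous_on_cis continuous_on_id)

text \<open>
  Only one-dimensional substitutions are needed: \<open>y = x * u\<close>, then \<open>x = r / sqrt (1 + u\<^sup>2)\<close>, then \<open>u = tan t\<close>.
  The radius \<open>r\<close> runs over the whole line, and the angle over half a turn.
\<close>

lemma nn_integral_polar_signed:
  fixes F :: "complex \<Rightarrow> ennreal"
  assumes [measurable]: "F \<in> borel_measurable borel"
  shows "(\<integral>\<^sup>+z. F z \<partial>lborel) =
     (\<integral>\<^sup>+t. (\<integral>\<^sup>+r. F (of_real r * cis t) * ennreal \<bar>r\<bar> \<partial>lborel) * indicator {- (pi/2)<..<pi/2} t \<partial>lborel)"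
proof -
  have [measurable]: "(\<lambda>x. Complex (f x) (g x)) \<in> borel_measurable M" if "f \<in> borel_measurable M" "g \<in> borel_measurable M" 
    for f g and M :: "'z measure"
  proof -
    have "(\<lambda>x. of_real (f x) + \<i> * of_real (g x) :: complex) \<in> borel_measurable M" using that by measurable
    then show ?thesis by (simp add: Complex_eq)
  qed
  \<comment> \<open>For \<open>u = tan t\<close> this is \<open>cos t\<close>, so
    \<open>(c u * r, c u * r * u)\<close> is the point with signed radius \<open>r\<close> and angle
    \<open>t\<close>.\<close>
  define c :: "real \<Rightarrow> real" where "c u = 1 / sqrt (1 + u\<^sup>2)" for u
  have c0: "c u > 0" for u by (simp add: c_def add_pos_nonneg)
  have c2: "c u * c u = 1 / (1 + u\<^sup>2)" for u by (simp add: c_def add_pos_nonneg)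
  have [measurable]: "c \<in> borel_measurable borel" unfolding c_def by measurable
  define K where "K u = (\<integral>\<^sup>+r. F (Complex (c u * r) (c u * r * u)) * ennreal \<bar>r\<bar> \<partial>lborel)" for u
  have [measurable]: "K \<in> borel_measurable borel" unfolding K_def by measurable
  have "(\<integral>\<^sup>+z. F z \<partial>lborel) = (\<integral>\<^sup>+z. F (case_prod Complex z) \<partial>(lborel \<Otimes>\<^sub>M lborel))"
    by (subst lborel_complex_eq) (simp add: nn_integral_distr)
  also have "\<dots> = (\<integral>\<^sup>+x. \<integral>\<^sup>+y. F (Complex x y) \<partial>lborel \<partial>lborel)"
    by (subst lborel.nn_integral_fst[symmetric]) auto
  also have "\<dots> = (\<integral>\<^sup>+x. \<integral>\<^sup>+u. F (Complex x (x * u)) * ennreal \<bar>x\<bar> \<partial>lborel \<partial>lborel)"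
  proof (rule nn_integral_cong_AE, use AE_lborel_singleton[of "0::real"] in eventually_elim)
    case (elim x)
    have "(\<integral>\<^sup>+y. F (Complex x y) \<partial>lborel) = ennreal \<bar>x\<bar> * (\<integral>\<^sup>+u. F (Complex x (0 + x * u)) \<partial>lborel)"
      using elim by (intro nn_integral_real_affine) auto
    also have "\<dots> = (\<integral>\<^sup>+u. F (Complex x (0 + x * u)) \<partial>lborel) * ennreal \<bar>x\<bar>" by (rule mult.commute)
    also have "\<dots> = (\<integral>\<^sup>+u. F (Complex x (0 + x * u)) * ennreal \<bar>x\<bar> \<partial>lborel)"
      by (intro nn_integral_multc[symmetric]) measurable
    finally show ?case by simp
  qed
  also have "\<dots> = (\<integral>\<^sup>+u. \<integral>\<^sup>+x. F (Complex x (x * u)) * ennreal \<bar>x\<bar> \<partial>lborel \<partial>lborel)"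
    by (rule lborel_pair.Fubini') measurable
  also have "\<dots> = (\<integral>\<^sup>+u. ennreal (1 / (1 + u\<^sup>2)) * K u \<partial>lborel)"
  proof (intro nn_integral_cong)
    fix u :: real
    have "(\<integral>\<^sup>+x. F (Complex x (x * u)) * ennreal \<bar>x\<bar> \<partial>lborel)
        = ennreal \<bar>c u\<bar> * (\<integral>\<^sup>+r. F (Complex (0 + c u * r) ((0 + c u * r) * u)) * ennreal \<bar>0 + c u * r\<bar> \<partial>lborel)"
      using c0[of u] by (intro nn_integral_real_affine) auto
    also have "(\<integral>\<^sup>+r. F (Complex (0 + c u * r) ((0 + c u * r) * u)) * ennreal \<bar>0 + c u * r\<bar> \<partial>lborel) = ennreal (c u) * K u"
      unfolding K_def using c0[of u]
      by (subst nn_integral_cmult[symmetric]) (auto simp: abs_mult ennreal_mult mult_ac)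
    also have "ennreal \<bar>c u\<bar> * (ennreal (c u) * K u) = ennreal (1 / (1 + u\<^sup>2)) * K u"
      using c0[of u] by (simp add: c2 flip: mult.assoc ennreal_mult)
    finally show "(\<integral>\<^sup>+x. F (Complex x (x * u)) * ennreal \<bar>x\<bar> \<partial>lborel) = ennreal (1 / (1 + u\<^sup>2)) * K u" .
  qed
  also have "\<dots> = (\<integral>\<^sup>+t. ennreal (1 / (1 + (tan t)\<^sup>2)) * K (tan t) * ennreal (1 + (tan t)\<^sup>2) * indicator {- (pi/2)<..<pi/2} t \<partial>lborel)"
    by (rule nn_integral_tan_substitution) measurable
  also have "\<dots> = (\<integral>\<^sup>+t. (\<integral>\<^sup>+r. F (of_real r * cis t) * ennreal \<bar>r\<bar> \<partial>lborel) * indicator {- (pi/2)<..<pi/2} t \<partial>lborel)"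
  proof (intro nn_integral_cong)
    fix t :: real
    show "ennreal (1 / (1 + (tan t)\<^sup>2)) * K (tan t) * ennreal (1 + (tan t)\<^sup>2) * indicator {- (pi/2)<..<pi/2} t
      = (\<integral>\<^sup>+r. F (of_real r * cis t) * ennreal \<bar>r\<bar> \<partial>lborel) * indicator {- (pi/2)<..<pi/2} t"
    proof (cases "t \<in> {- (pi/2)<..<pi/2}")
      case True
      then have cos: "cos t > 0" by (intro cos_gt_zero_pi) auto
      have "1 + (tan t)\<^sup>2 = (inverse (cos t))\<^sup>2" using cos tan_sec[of t] by (simp add: power_inverse)
      then have "sqrt (1 + (tan t)\<^sup>2) = inverse (cos t)" using cos by (simp only: real_sqrt_abs) simp
      then have ct: "c (tan t) = cos t" using cos by (simp add: c_def inverse_eq_divide)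
      have "cos t * tan t = sin t" using cos by (simp add: tan_def)
      then have "Complex (c (tan t) * r) (c (tan t) * r * tan t) = of_real r * cis t" for r
        by (simp add: ct complex_eq_iff mult_ac)
      then have "K (tan t) = (\<integral>\<^sup>+r. F (of_real r * cis t) * ennreal \<bar>r\<bar> \<partial>lborel)" by (simp add: K_def)
      moreover have "ennreal (1 / (1 + (tan t)\<^sup>2)) * ennreal (1 + (tan t)\<^sup>2) = 1"
        by (subst ennreal_mult[symmetric]) (auto simp: add_pos_nonneg add_nonneg_eq_0_iff)
      ultimately show ?thesis using True by (simp add: mult.assoc mult.left_commute[of "ennreal (1 / _)"])
    qed auto
  qed
  finally show ?thesis .
qed

lemma nn_integral_reflect: 
  fixes f :: "real \<Rightarrow> ennreal"
  assumes "f \<in> borel_measurable borel"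
  shows "(\<integral>\<^sup>+x. f x \<partial>lborel) = (\<integral>\<^sup>+x. f (- x) \<partial>lborel)"
  using nn_integral_real_affine[OF assms, of "-1" 0] by simp

lemma nn_integral_shift: 
  fixes f :: "real \<Rightarrow> ennreal"
  assumes "f \<in> borel_measurable borel"
  shows "(\<integral>\<^sup>+x. f x \<partial>lborel) = (\<integral>\<^sup>+x. f (x + a) \<partial>lborel)"
  using nn_integral_real_affine[OF assms, of 1 a] by (simp add: add.commute)

text \<open>A negative radius is a positive one with the angle advanced by \<open>pi\<close>. So the
  signed formula over half a turn sums the values at \<open>t\<close> and \<open>t + pi\<close>, and
  periodicity reassembles the full circle.\<close>

lemma nn_integral_polar:
  fixes F :: "complex \<Rightarrow> ennreal"
  assumes [measurable]: "F \<in> borel_measurable borel"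
  shows "(\<integral>\<^sup>+z. F z \<partial>lborel) =
     (\<integral>\<^sup>+r. (circle_integral (\<lambda>t. F (of_real r * cis t))) * ennreal r * indicator {0<..} r \<partial>lborel)"
proof -
  define P where "P r t = F (of_real r * cis t)" for r t
  have [measurable]: "case_prod P \<in> borel_measurable (borel \<Otimes>\<^sub>M borel)" unfolding P_def by measurable
  have Pm: "P (- r) t = P r (t + pi)" and P2: "P r (t + 2 * pi) = P r t" for r t
    by (simp_all add: P_def cis_mult[symmetric])
  have sgn: "(\<integral>\<^sup>+r. P r t * ennreal \<bar>r\<bar> \<partial>lborel) = (\<integral>\<^sup>+r. (P r t + P r (t + pi)) * (ennreal r * indicator {0<..} r) \<partial>lborel)" for t
  proof -
    have "(\<integral>\<^sup>+r. P r t * ennreal \<bar>r\<bar> \<partial>lborel) = (\<integral>\<^sup>+r. P r t * ennreal \<bar>r\<bar> * indicator {0<..} r + P r t * ennreal \<bar>r\<bar> * indicator {..<0} r \<partial>lborel)"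
      by (intro nn_integral_cong_AE, use AE_lborel_singleton[of "0::real"] in eventually_elim) (auto simp: indicator_def)
    also have "\<dots> = (\<integral>\<^sup>+r. P r t * ennreal \<bar>r\<bar> * indicator {0<..} r \<partial>lborel) + (\<integral>\<^sup>+r. P r t * ennreal \<bar>r\<bar> * indicator {..<0} r \<partial>lborel)"
      by (intro nn_integral_add) measurable
    also have "(\<integral>\<^sup>+r. P r t * ennreal \<bar>r\<bar> * indicator {..<0} r \<partial>lborel) = (\<integral>\<^sup>+r. P r (t + pi) * ennreal \<bar>r\<bar> * indicator {0<..} r \<partial>lborel)"
      by (subst nn_integral_reflect) (auto simp: Pm intro!: nn_integral_cong simp: indicator_def)
    also have "(\<integral>\<^sup>+r. P r t * ennreal \<bar>r\<bar> * indicator {0<..} r \<partial>lborel) + (\<integral>\<^sup>+r. P r (t + pi) * ennreal \<bar>r\<bar> * indicator {0<..} r \<partial>lborel)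
      = (\<integral>\<^sup>+r. (P r t + P r (t + pi)) * (ennreal r * indicator {0<..} r) \<partial>lborel)"
      by (subst nn_integral_add[symmetric]) (auto intro!: nn_integral_cong simp: indicator_def distrib_right)
    finally show ?thesis .
  qed
  have rot: "(\<integral>\<^sup>+t. (P r t + P r (t + pi)) * indicator {- (pi/2)<..<pi/2} t \<partial>lborel) = (\<integral>\<^sup>+t. P r t * indicator {0..2*pi} t \<partial>lborel)" for r
  proof -
    \<comment> \<open>The part on negative angles moves by \<open>2 * pi\<close> to the fourth
      quadrant, and the values at \<open>t + pi\<close> fill the second and third. What is missing
      from [0, 2 pi] are the points \<open>pi / 2\<close>, \<open>3 * pi / 2\<close> and
      \<open>2 * pi\<close>.\<close>
    have "(\<integral>\<^sup>+t. (P r t + P r (t + pi)) * indicator {- (pi/2)<..<pi/2} t \<partial>lborel)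
      = (\<integral>\<^sup>+t. P r t * indicator {- (pi/2)<..<0} t + P r t * indicator {0..<pi/2} t + P r (t + pi) * indicator {pi/2<..<3*pi/2} (t + pi) \<partial>lborel)"
      by (intro nn_integral_cong) (auto simp: indicator_def)
    also have "\<dots> = (\<integral>\<^sup>+t. P r t * indicator {- (pi/2)<..<0} t \<partial>lborel) + (\<integral>\<^sup>+t. P r t * indicator {0..<pi/2} t \<partial>lborel)
        + (\<integral>\<^sup>+t. P r (t + pi) * indicator {pi/2<..<3*pi/2} (t + pi) \<partial>lborel)"
      by (subst nn_integral_add; measurable) (subst nn_integral_add; measurable)
    also have "(\<integral>\<^sup>+t. P r (t + pi) * indicator {pi/2<..<3*pi/2} (t + pi) \<partial>lborel) = (\<integral>\<^sup>+t. P r t * indicator {pi/2<..<3*pi/2} t \<partial>lborel)"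
      by (rule nn_integral_shift[symmetric]) measurable
    also have "(\<integral>\<^sup>+t. P r t * indicator {- (pi/2)<..<0} t \<partial>lborel) = (\<integral>\<^sup>+t. P r (t + 2 * pi) * indicator {3*pi/2<..<2*pi} (t + 2 * pi) \<partial>lborel)"
      unfolding P2 by (intro nn_integral_cong) (auto simp: indicator_def)
    also have "\<dots> = (\<integral>\<^sup>+t. P r t * indicator {3*pi/2<..<2*pi} t \<partial>lborel)"
      by (rule nn_integral_shift[symmetric]) measurable
    also have "(\<integral>\<^sup>+t. P r t * indicator {3*pi/2<..<2*pi} t \<partial>lborel) + (\<integral>\<^sup>+t. P r t * indicator {0..<pi/2} t \<partial>lborel) + (\<integral>\<^sup>+t. P r t * indicator {pi/2<..<3*pi/2} t \<partial>lborel)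
       = (\<integral>\<^sup>+t. P r t * indicator {3*pi/2<..<2*pi} t + P r t * indicator {0..<pi/2} t + P r t * indicator {pi/2<..<3*pi/2} t \<partial>lborel)"
      by (subst nn_integral_add; measurable) (subst nn_integral_add; measurable)
    also have "\<dots> = (circle_integral (\<lambda>t. P r t))"
      by (intro nn_integral_cong_AE, use AE_lborel_singleton[of "pi/2"] AE_lborel_singleton[of "3*pi/2"] AE_lborel_singleton[of "2*pi"] in eventually_elim)
         (auto simp: indicator_def)
    finally show ?thesis .
  qed
  have "(\<integral>\<^sup>+z. F z \<partial>lborel) = (\<integral>\<^sup>+t. \<integral>\<^sup>+r. (P r t + P r (t + pi)) * (ennreal r * indicator {0<..} r) * indicator {- (pi/2)<..<pi/2} t \<partial>lborel \<partial>lborel)"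
    unfolding nn_integral_polar_signed[OF assms] P_def[symmetric] sgn by (simp add: nn_integral_multc)
  also have "\<dots> = (\<integral>\<^sup>+r. \<integral>\<^sup>+t. (P r t + P r (t + pi)) * (ennreal r * indicator {0<..} r) * indicator {- (pi/2)<..<pi/2} t \<partial>lborel \<partial>lborel)"
    by (rule lborel_pair.Fubini') measurable
  also have "\<dots> = (\<integral>\<^sup>+r. (\<integral>\<^sup>+t. (P r t + P r (t + pi)) * indicator {- (pi/2)<..<pi/2} t \<partial>lborel) * (ennreal r * indicator {0<..} r) \<partial>lborel)"
  proof (intro nn_integral_cong)
    fix r :: real
    have "(\<integral>\<^sup>+t. (P r t + P r (t + pi)) * indicator {- (pi/2)<..<pi/2} t * (ennreal r * indicator {0<..} r) \<partial>lborel)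
      = (\<integral>\<^sup>+t. (P r t + P r (t + pi)) * indicator {- (pi/2)<..<pi/2} t \<partial>lborel) * (ennreal r * indicator {0<..} r)"
      by (intro nn_integral_multc) measurable
    then show "(\<integral>\<^sup>+t. (P r t + P r (t + pi)) * (ennreal r * indicator {0<..} r) * indicator {- (pi/2)<..<pi/2} t \<partial>lborel)
      = (\<integral>\<^sup>+t. (P r t + P r (t + pi)) * indicator {- (pi/2)<..<pi/2} t \<partial>lborel) * (ennreal r * indicator {0<..} r)"
      by (simp add: mult_ac)
  qed
  finally show ?thesis unfolding rot by (simp add: P_def mult_ac)
qed


section \<open>Point evaluation\<close>

lemma ball_rcis: "0 \<le> r \<Longrightarrow> r < 1 \<Longrightarrow> of_real r * cis t \<in> ball 0 1"
  by (simp add: norm_mult)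

lemma continuous_on_circle:
  assumes "h holomorphic_on ball 0 1" "0 \<le> r" "r < 1"
  shows "continuous_on UNIV (\<lambda>t. h (of_real r * cis t))"
proof (rule continuous_on_compose2[OF holomorphic_on_imp_continuous_on[OF assms(1)]])
  show "continuous_on UNIV (\<lambda>t. of_real r * cis t)" by (intro continuous_intros continuous_on_cis)
qed (use ball_rcis assms in auto)

text \<open>Cauchy's formula at the point \<open>r * s\<close>. On the circle of radius
  \<open>r\<close>, \<open>z - r * s\<close> is \<open>z\<close> times the conjugate of
  \<open>1 - s * cis t\<close>, so the radius cancels against \<open>dz\<close> and exactly the
  kernel of \<open>angle_integral_bound\<close> remains.\<close>

lemma Cauchy_circle_bound:
  assumes h: "h holomorphic_on ball 0 1" and r: "0 < r" "r < 1" and s: "0 \<le> s" "s < 1"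
  shows "ennreal (2 * pi * norm (h (of_real (r * s)))) \<le>
    (circle_integral (\<lambda>t. ennreal (norm (h (of_real r * cis t)) * norm (1 - of_real s * cis t) powr - 1)))"
proof -
  define w where "w = complex_of_real (r * s)"
  have w: "norm (w - 0) < r" using r s by (simp add: w_def norm_mult)
  have "((\<lambda>u. h u / (u - w)) has_contour_integral (2 * of_real pi * \<i> * h w)) (circlepath 0 r)"
    by (rule Cauchy_integral_circlepath_simple[OF _ w]) (rule holomorphic_on_subset[OF h], use r in auto)
  then have I: "((\<lambda>t. h (of_real r * cis t) / (of_real r * cis t - w) * r * \<i> * cis t) has_integral (2 * of_real pi * \<i> * h w)) {0..2*pi}"
    unfolding circlepath_def by (subst (asm) has_contour_integral_part_circlepath_iff) auto
  have nz: "of_real r * cis t - w \<noteq> 0" for t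
  proof
    assume "of_real r * cis t - w = 0"
    then have "norm w = norm (of_real r * cis t)" by simp
    then show False using w r by (simp add: norm_mult)
  qed
  define \<phi> where "\<phi> t = h (of_real r * cis t) / (of_real r * cis t - w) * r * \<i> * cis t" for t
  have "continuous_on {0..2*pi} \<phi>"
    unfolding \<phi>_def using r nz
    by (intro continuous_intros continuous_on_subset[OF continuous_on_circle[OF h]] continuous_on_cis) auto
  then have int: "set_integrable lborel {0..2*pi} \<phi>"
    unfolding set_integrable_def by (intro borel_integrable_compact) auto
  have "norm (\<phi> t) = norm (h (of_real r * cis t)) * norm (1 - of_real s * cis t) powr - 1" for t
  proof -
    have "of_real r * cis t - w = of_real r * cis t * cnj (1 - of_real s * cis t)"
      by (simp add: w_def algebra_simps cis_cnj cis_mult)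
    then have "norm (of_real r * cis t - w) = r * norm (1 - of_real s * cis t)"
      using r by (simp add: norm_mult del: complex_cnj_diff)
    moreover have "norm (1 - of_real s * cis t) > 0"
    proof -
      have "1 - s \<le> norm (1 - of_real s * cis t)"
        using norm_triangle_ineq2[of 1 "of_real s * cis t"] s by (simp add: norm_mult)
      then show ?thesis using s by linarith
    qed
    ultimately show ?thesis using r by (simp add: \<phi>_def norm_mult norm_divide powr_minus field_simps)
  qed
  then have n: "ennreal (norm (indicator {0..2*pi} t *\<^sub>R \<phi> t)) = ennreal (norm (h (of_real r * cis t)) * norm (1 - of_real s * cis t) powr - 1) * indicator {0..2*pi} t" for t
    by (simp add: indicator_def)
  have "(LINT t:{0..2*pi}|lborel. \<phi> t) = 2 * of_real pi * \<i> * h w"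
    using set_borel_integral_eq_integral(2)[OF int] I[folded \<phi>_def] by (simp only: integral_unique)
  then have "ennreal (2 * pi * norm (h w)) = norm (LINT t:{0..2*pi}|lborel. \<phi> t)"
    by (simp add: norm_mult)
  also have "\<dots> \<le> (\<integral>\<^sup>+t. ennreal (norm (indicator {0..2*pi} t *\<^sub>R \<phi> t)) \<partial>lborel)"
    unfolding set_lebesgue_integral_def by (rule integral_norm_bound_ennreal) (use int in \<open>simp add: set_integrable_def\<close>)
  finally show ?thesis by (simp only: n w_def)
qed

text \<open>The growth estimate of Hardy spaces, localised to one circle: it is used for single
  integral means of \<open>g\<close> and of its derivative. \<open>A\<close> absorbs the factor
  \<open>2 * pi\<close> of the mean.\<close>

definition point_evaluation_bounded :: "real \<Rightarrow> real \<Rightarrow> bool" where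
  "point_evaluation_bounded p C \<longleftrightarrow> (\<forall>h r s A. h holomorphic_on ball 0 1 \<longrightarrow> 0 < r \<longrightarrow> r < 1 \<longrightarrow> 0 \<le> s \<longrightarrow> s < 1 \<longrightarrow> 0 \<le> A \<longrightarrow>
     (circle_integral (\<lambda>t. ennreal (norm (h (of_real r * cis t)) powr p))) \<le> ennreal (A powr p) \<longrightarrow>
     norm (h (of_real (r * s))) \<le> C * A * (1 - s) powr - (1 / p))"

text \<open>Hoelder against the Cauchy kernel, whose q-th power integrates to order
  \<open>(1 - s) powr (1 - q)\<close>; the q-th root of this is
  \<open>(1 - s) powr - (1 / p)\<close>.\<close>

lemma point_evaluation_bound:
  fixes p :: real
  assumes p: "1 < p"
  shows "\<exists>C>0. point_evaluation_bounded p C"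
proof -
  define q where "q = p / (p - 1)"
  have pq: "1 / p + 1 / q = 1" and q: "q > 1" using p by (auto simp: q_def field_simps)
  obtain K where K: "K > 0" "\<And>r. 0 \<le> r \<Longrightarrow> r < 1 \<Longrightarrow>
    (circle_integral (\<lambda>\<theta>. ennreal (norm (1 - of_real r * cis \<theta>) powr - q))) \<le> ennreal (K * (1 - r) powr (1 - q))"
    using angle_integral_bound[OF q] by blast
  have "norm (h (of_real (r * s))) \<le> K powr (1/q) * A * (1 - s) powr - (1 / p)"
    if h: "h holomorphic_on ball 0 1" and r: "0 < r" "r < 1" and s: "0 \<le> s" "s < 1" and A: "0 \<le> A"
     and hA: "(circle_integral (\<lambda>t. ennreal (norm (h (of_real r * cis t)) powr p))) \<le> ennreal (A powr p)"
    for h r s A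
  proof -
    define B where "B = (K * (1 - s) powr (1 - q)) powr (1 / q)"
    define f where "f t = norm (h (of_real r * cis t)) * indicator {0..2*pi} t" for t
    define g where "g t = norm (1 - of_real s * cis t) powr - 1 * indicator {0..2*pi} t" for t
    have [measurable]: "(\<lambda>t. h (of_real r * cis t)) \<in> borel_measurable borel"
      by (intro borel_measurable_continuous_onI continuous_on_circle h) (use r in auto)
    have "(\<integral>\<^sup>+t. ennreal (f t * g t) \<partial>lborel) \<le> ennreal (A * B)"
    proof (rule nn_integral_Holder[OF p pq])
      show "(\<integral>\<^sup>+t. ennreal (f t powr p) \<partial>lborel) \<le> ennreal (A powr p)"
      proof -
        have "ennreal (f t powr p) = ennreal (norm (h (of_real r * cis t)) powr p) * indicator {0..2*pi} t" for t
          by (simp add: f_def indicator_def)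
        then show ?thesis using hA by simp
      qed
      show "(\<integral>\<^sup>+t. ennreal (g t powr q) \<partial>lborel) \<le> ennreal (B powr q)"
      proof -
        have "ennreal (g t powr q) = ennreal (norm (1 - of_real s * cis t) powr - q) * indicator {0..2*pi} t" for t
        proof (cases "t \<in> {0..2*pi}")
          case True
          have "(norm (1 - of_real s * cis t) powr - 1) powr q = norm (1 - of_real s * cis t) powr - q"
            by (subst powr_powr) simp
          then show ?thesis using True by (simp only: g_def indicator_simps mult_1_right)
        qed (simp add: g_def)
        moreover have "B powr q = K * (1 - s) powr (1 - q)" using K q by (simp add: B_def powr_powr)
        ultimately show ?thesis using K(2)[OF s] by simp
      qed
      show "f \<in> borel_measurable lborel" unfolding f_def by measurable
      show "g \<in> borel_measurable lborel" unfolding g_def by measurable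
    qed (use A in \<open>auto simp: f_def g_def B_def\<close>)
    moreover have "ennreal (f t * g t) = ennreal (norm (h (of_real r * cis t)) * norm (1 - of_real s * cis t) powr - 1) * indicator {0..2*pi} t" for t
      by (simp add: f_def g_def indicator_def)
    ultimately have "ennreal (2 * pi * norm (h (of_real (r * s)))) \<le> ennreal (A * B)"
      using Cauchy_circle_bound[OF h r s] by simp
    then have "2 * pi * norm (h (of_real (r * s))) \<le> A * B" using A by (subst (asm) ennreal_le_iff) (auto simp: B_def)
    moreover have "norm (h (of_real (r * s))) \<le> 2 * pi * norm (h (of_real (r * s)))"
      using pi_ge_two mult_right_mono[of 1 "2 * pi" "norm (h (of_real (r * s)))"] by simp
    moreover have "B = K powr (1/q) * (1 - s) powr - (1 / p)"
    proof -
      have "(1 - q) * (1 / q) = - (1 / p)" using pq q by (simp add: field_simps)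
      then have "((1 - s) powr (1 - q)) powr (1 / q) = (1 - s) powr - (1 / p)" by (simp only: powr_powr)
      then show ?thesis using K s by (simp add: B_def powr_mult)
    qed
    ultimately show ?thesis by (simp add: mult_ac)
  qed
  then show ?thesis using K(1) unfolding point_evaluation_bounded_def by (intro exI[of _ "K powr (1/q)"]) auto
qed

section \<open>Power series on the unit disc\<close>

definition disc_series :: "(nat \<Rightarrow> complex) \<Rightarrow> (complex \<Rightarrow> complex) \<Rightarrow> bool" where
  "disc_series c g \<longleftrightarrow> (\<forall>z\<in>ball 0 1. (\<lambda>n. c n * z ^ n) sums g z)"

lemma disc_seriesD: "disc_series c g \<Longrightarrow> norm z < 1 \<Longrightarrow> (\<lambda>n. c n * z ^ n) sums g z"
  by (simp add: disc_series_def)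

lemma disc_series_holomorphic: "disc_series c g \<Longrightarrow> g holomorphic_on ball 0 1"
  by (rule power_series_holomorphic[of 0 1 c]) (simp add: disc_series_def)

lemma disc_series_summable_norm:
  assumes "disc_series c g" "0 \<le> r" "r < 1"
  shows "summable (\<lambda>n. norm (c n) * r ^ n)"
proof -
  obtain s where s: "r < s" "s < 1" using assms dense by blast
  have "summable (\<lambda>n. c n * of_real s ^ n)"
    using disc_seriesD[OF assms(1), of "of_real s"] s assms by (simp add: sums_iff)
  then have "summable (\<lambda>n. norm (c n * of_real r ^ n))"
    by (rule powser_insidea) (use assms s in simp)
  then show ?thesis using assms by (simp add: norm_mult norm_power)
qed

lemma disc_series_taylor_coeff:
  assumes g: "disc_series c g"
  shows "taylor_coeff g n = c n"
proof -
  have "summable (\<lambda>n. c n * (1/2) ^ n)" using disc_seriesD[OF g, of "1/2"] by (simp add: sums_iff norm_divide)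
  then have r: "conv_radius c \<ge> norm (1/2::complex)" by (rule conv_radius_geI)
  have "g has_fps_expansion Abs_fps c"
    unfolding has_fps_expansion_def
  proof
    show "0 < fps_conv_radius (Abs_fps c)"
      using r by (auto simp: fps_conv_radius_def norm_divide intro: less_le_trans[of _ "ereal (1/2)"])
    have "eventually (\<lambda>z. z \<in> ball (0::complex) 1) (nhds 0)" by (rule eventually_nhds_in_open) auto
    then show "eventually (\<lambda>z. eval_fps (Abs_fps c) z = g z) (nhds 0)"
      by eventually_elim (use disc_seriesD[OF g] in \<open>auto simp: eval_fps_def sums_iff\<close>)
  qed
  then show ?thesis using fps_nth_fps_expansion[of g "Abs_fps c" n] by (simp add: taylor_coeff_def)
qed

lemma disc_series_0: "disc_series c g \<Longrightarrow> g 0 = c 0"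
  using disc_seriesD[of c g 0] by (simp add: sums_iff powser_zero)

lemma disc_series_deriv:
  assumes g: "disc_series c g"
  shows "disc_series (\<lambda>n. of_nat (Suc n) * c (Suc n)) (deriv g)"
  unfolding disc_series_def
proof
  fix z :: complex assume z: "z \<in> ball 0 1"
  have s: "summable (\<lambda>n. c n * x ^ n)" if "norm x < 1" for x using disc_seriesD[OF g that] by (simp add: sums_iff)
  have "((\<lambda>z. \<Sum>n. c n * z ^ n) has_field_derivative (\<Sum>n. diffs c n * z ^ n)) (at z)"
    using z by (intro termdiffs_strong'[of 1] s) auto
  then have "(g has_field_derivative (\<Sum>n. diffs c n * z ^ n)) (at z)"
    by (rule has_field_derivative_transform_within_open[where S = "ball 0 1"])
       (use z disc_seriesD[OF g] in \<open>auto simp: sums_iff\<close>)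
  then have "deriv g z = (\<Sum>n. diffs c n * z ^ n)" by (rule DERIV_imp_deriv)
  moreover have "summable (\<lambda>n. diffs c n * z ^ n)"
    using z by (intro termdiff_converges[of z 1] s) auto
  ultimately show "(\<lambda>n. of_nat (Suc n) * c (Suc n) * z ^ n) sums deriv g z"
    by (simp add: diffs_def sums_iff)
qed

section \<open>The norms\<close>

lemma enn_powr_le:
  assumes "X \<le> ennreal K" "0 \<le> K" "0 < a"
  shows "enn_powr X a \<le> ennreal (K powr a)"
proof -
  have "X \<noteq> top" using assms by (auto simp: top_unique)
  moreover have "enn2real X \<le> K" using assms by (intro enn2real_leI) auto
  ultimately show ?thesis using assms by (auto simp: enn_powr_def intro!: ennreal_leI powr_mono2)
qed

lemma le_of_enn_powr_le:
  assumes "enn_powr X (1 / p) \<le> ennreal B" "0 \<le> B" "0 < p"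
  shows "X \<le> ennreal (B powr p)"
proof -
  have X: "X \<noteq> top" using assms by (auto simp: enn_powr_def top_unique)
  then have "enn2real X powr (1/p) \<le> B" using assms by (auto simp: enn_powr_def)
  then have "(enn2real X powr (1/p)) powr p \<le> B powr p" using assms by (intro powr_mono2) auto
  then have "enn2real X \<le> B powr p" using assms by (simp add: powr_powr)
  then have "ennreal (enn2real X) \<le> ennreal (B powr p)" by (rule ennreal_leI)
  then show ?thesis using X by (simp only: ennreal_enn2real less_top)
qed

lemma enn_powr_mono: "x \<le> y \<Longrightarrow> 0 < a \<Longrightarrow> enn_powr x a \<le> enn_powr y a"
  by (auto simp: enn_powr_def top_unique less_top intro!: ennreal_leI powr_mono2 enn2real_mono)

lemma enn_powr_ennreal: "0 \<le> x \<Longrightarrow> enn_powr (ennreal x) a = ennreal (x powr a)"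
  by (simp add: enn_powr_def)

lemma finite_of_enn_powr: "enn_powr X a < top \<Longrightarrow> X < top"
  by (auto simp: enn_powr_def less_top split: if_splits)

lemma nn_integral_lebesgue_on_eq:
  fixes S :: "'a::euclidean_space set"
  assumes "S \<in> sets borel"
  shows "(\<integral>\<^sup>+x. f x \<partial>lebesgue_on S) = (\<integral>\<^sup>+x. f x * indicator S x \<partial>lborel)"
  using assms by (simp add: nn_integral_restrict_space nn_integral_completion)

lemma norm_HL_disc_series:
  assumes "disc_series c g"
  shows "norm_HL p g = enn_powr (\<Sum>n. ennreal (norm (c n) powr p * (real n + 1) powr (p - 2))) (1 / p)"
  by (simp add: norm_HL_def disc_series_taylor_coeff[OF assms])

lemma norm_H_infty_alt:
  "norm_H_infty p f = enn_powr (\<integral>\<^sup>+r. ennreal (mean_infty r f powr p) * indicator {0..<1} r \<partial>lborel) (1 / p)"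
  by (simp add: norm_H_infty_def nn_integral_lebesgue_on_eq)

lemma mean_p_powr:
  assumes h: "h holomorphic_on ball 0 1" and r: "0 \<le> r" "r < 1" and p: "0 < p"
  shows "(circle_integral (\<lambda>t. ennreal (norm (h (of_real r * cis t)) powr p))) = ennreal (2 * pi * mean_p p r h powr p)"
proof -
  define \<phi> where "\<phi> t = norm (h (of_real r * cis t)) powr p" for t
  have cont: "continuous_on {0..2*pi} \<phi>" unfolding \<phi>_def using p
    by (intro continuous_intros continuous_on_subset[OF continuous_on_circle[OF h r]] continuous_on_powr') auto
  have int: "integrable (lebesgue_on {0..2*pi}) \<phi>"
  proof (subst integrable_restrict_space)
    have "integrable lborel (\<lambda>t. indicator {0..2*pi} t *\<^sub>R \<phi> t)"
      by (rule borel_integrable_compact[OF _ cont]) auto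
    then show "integrable lebesgue (\<lambda>t. indicator {0..2*pi} t *\<^sub>R \<phi> t)"
      by (subst integrable_completion) auto
  qed auto
  have "(\<integral>\<^sup>+t. ennreal (\<phi> t) \<partial>lebesgue_on {0..2*pi}) = ennreal (\<integral>t. \<phi> t \<partial>lebesgue_on {0..2*pi})"
    by (rule nn_integral_eq_integral[OF int]) (auto simp: \<phi>_def)
  moreover have "2 * pi * mean_p p r h powr p = (\<integral>t. \<phi> t \<partial>lebesgue_on {0..2*pi})"
    using p by (simp add: mean_p_def \<phi>_def powr_powr)
  ultimately show ?thesis by (simp add: nn_integral_lebesgue_on_eq \<phi>_def)
qed

lemma norm_Dirichlet_polar:
  assumes g: "g holomorphic_on ball 0 1"
  shows "norm_Dirichlet p g = enn_powr (ennreal (norm (g 0) powr p) +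
    (\<integral>\<^sup>+r. (circle_integral (\<lambda>t. ennreal (norm (deriv g (of_real r * cis t)) powr p)))
       * ennreal (r * (1 - r) powr (p - 1) / pi) * indicator {0..<1} r \<partial>lborel)) (1 / p)"
proof -
  define \<Phi> where "\<Phi> z = ennreal (norm (deriv g z) powr p * (1 - norm z) powr (p - 1) / pi) * indicator (ball 0 1) z" for z
  have "continuous_on (ball 0 1) (deriv g)"
    using g by (intro holomorphic_on_imp_continuous_on holomorphic_deriv) auto
  \<comment> \<open>Nothing is known about \<open>deriv g\<close> outside the disc, so it is cut off
    there in order to have a Borel function on the plane, as polar coordinates require.\<close>
  then have "(\<lambda>z. indicator (ball 0 1) z *\<^sub>R deriv g z) \<in> borel_measurable borel"
    by (intro borel_measurable_continuous_on_indicator) auto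
  moreover define D where "D z = indicator (ball 0 1) z *\<^sub>R deriv g z" for z
  ultimately have [measurable]: "D \<in> borel_measurable borel" by (simp add: D_def[abs_def])
  have [measurable]: "ball (0::complex) 1 \<in> sets borel" by simp
  have "(\<lambda>z. ennreal (norm (D z) powr p * (1 - norm z) powr (p - 1) / pi) * indicator (ball 0 1) z) \<in> borel_measurable borel"
    by measurable
  also have "(\<lambda>z. ennreal (norm (D z) powr p * (1 - norm z) powr (p - 1) / pi) * indicator (ball 0 1) z) = \<Phi>"
    by (auto simp: \<Phi>_def D_def indicator_def fun_eq_iff)
  finally have m: "\<Phi> \<in> borel_measurable borel" .
  have "(\<integral>\<^sup>+z. ennreal (norm (deriv g z) powr p * (1 - norm z) powr (p - 1) / pi) \<partial>lebesgue_on (ball 0 1)) = (\<integral>\<^sup>+z. \<Phi> z \<partial>lborel)"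
    by (simp add: nn_integral_lebesgue_on_eq \<Phi>_def)
  also have "\<dots> = (\<integral>\<^sup>+r. (circle_integral (\<lambda>t. \<Phi> (of_real r * cis t))) * ennreal r * indicator {0<..} r \<partial>lborel)"
    by (rule nn_integral_polar[OF m])
  also have "\<dots> = (\<integral>\<^sup>+r. (circle_integral (\<lambda>t. ennreal (norm (deriv g (of_real r * cis t)) powr p)))
       * ennreal (r * (1 - r) powr (p - 1) / pi) * indicator {0..<1} r \<partial>lborel)"
  proof (intro nn_integral_cong)
    fix r :: real
    consider "r \<le> 0" | "r \<ge> 1" | "0 < r" "r < 1" by linarith
    then show "(circle_integral (\<lambda>t. \<Phi> (of_real r * cis t))) * ennreal r * indicator {0<..} r =
      (circle_integral (\<lambda>t. ennreal (norm (deriv g (of_real r * cis t)) powr p)))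
       * ennreal (r * (1 - r) powr (p - 1) / pi) * indicator {0..<1} r"
    proof cases
      case 1
      then show ?thesis by (cases "r = 0") (auto simp: indicator_def)
    next
      case 2
      then have "\<Phi> (of_real r * cis t) = 0" for t by (simp add: \<Phi>_def norm_mult)
      then show ?thesis using 2 by simp
    next
      case 3
      have [measurable]: "(\<lambda>t. deriv g (of_real r * cis t)) \<in> borel_measurable borel"
        using 3 g by (intro borel_measurable_continuous_onI continuous_on_circle holomorphic_deriv) auto
      have "\<Phi> (of_real r * cis t) * indicator {0..2*pi} t =
        (ennreal (norm (deriv g (of_real r * cis t)) powr p) * indicator {0..2*pi} t) * ennreal ((1 - r) powr (p - 1) / pi)" for t
        using 3 by (simp add: \<Phi>_def norm_mult mult_ac flip: ennreal_mult')
      then have "(circle_integral (\<lambda>t. \<Phi> (of_real r * cis t)))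
        = (circle_integral (\<lambda>t. ennreal (norm (deriv g (of_real r * cis t)) powr p))) * ennreal ((1 - r) powr (p - 1) / pi)"
        by (simp only:) (rule nn_integral_multc, measurable)
      moreover have "ennreal ((1 - r) powr (p - 1) / pi) * ennreal r = ennreal (r * (1 - r) powr (p - 1) / pi)"
        using 3 by (simp flip: ennreal_mult' add: mult_ac)
      ultimately show ?thesis using 3 by (simp add: mult.assoc)
    qed
  qed
  finally show ?thesis by (simp add: norm_Dirichlet_def)
qed

text \<open>\<open>mean_infty\<close> is a real supremum, meaningful only for a bounded set; the
  bound \<open>B\<close> supplies the boundedness also for the second and third claims.\<close>

lemma mean_infty_le:
  assumes "\<And>t. norm (f (of_real r * cis t)) \<le> B"
  shows "mean_infty r f \<le> B" "0 \<le> mean_infty r f" "norm (f (of_real r * cis t)) \<le> mean_infty r f"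
proof -
  show "mean_infty r f \<le> B" unfolding mean_infty_def by (rule cSUP_least) (use assms in auto)
  have "bdd_above (range (\<lambda>t. norm (f (of_real r * cis t))))"
    by (rule bdd_aboveI2[of _ _ B]) (use assms in auto)
  then show *: "norm (f (of_real r * cis t)) \<le> mean_infty r f" for t
    unfolding mean_infty_def by (rule cSUP_upper[rotated]) auto
  show "0 \<le> mean_infty r f" by (rule order_trans[OF norm_ge_zero *[of 0]])
qed

lemma disc_series_norm_le:
  assumes "disc_series c g" "0 \<le> r" "r < 1"
  shows "norm (g (of_real r * cis t)) \<le> (\<Sum>n. norm (c n) * r ^ n)"
proof -
  have "(\<lambda>n. c n * (of_real r * cis t) ^ n) sums g (of_real r * cis t)"
    using assms by (intro disc_seriesD) (auto simp: norm_mult)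
  moreover have n: "norm (c n * (of_real r * cis t) ^ n) = norm (c n) * r ^ n" for n
    using assms by (simp add: norm_mult norm_power)
  moreover have "summable (\<lambda>n. norm (c n) * r ^ n)" by (rule disc_series_summable_norm[OF assms])
  ultimately show ?thesis using summable_norm[of "\<lambda>n. c n * (of_real r * cis t) ^ n"] by (simp add: sums_iff)
qed

section \<open>Lower bounds for series with nonnegative coefficients\<close>

text \<open>The counterpart of \<open>1 - x \<le> exp (- x)\<close>: for \<open>x\<close> comparable
  to \<open>1 / n\<close> the power stays above a fixed constant. It follows from
  \<open>ln (1 - x) \<ge> - x - 2 * x\<^sup>2\<close>.\<close>

lemma one_minus_power_ge:
  assumes "0 \<le> x" "x \<le> 1/2"
  shows "exp (- (2 * x * real n)) \<le> (1 - x :: real) ^ n"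
proof -
  have "2 * x * x \<le> 2 * x * (1/2)" using assms by (intro mult_left_mono) auto
  then have "- 2 * x \<le> ln (1 - x)" using ln_one_minus_pos_lower_bound[of x] assms by (simp add: power2_eq_square)
  then have "exp (- 2 * x) \<le> exp (ln (1 - x))" by (simp only: exp_le_cancel_iff)
  then have "exp (- 2 * x) \<le> 1 - x" using assms by simp
  then have "exp (- 2 * x) ^ n \<le> (1 - x) ^ n" by (intro power_mono) auto
  then show ?thesis by (simp flip: exp_of_nat_mult add: mult_ac)
qed

lemma disc_series_of_real_sum_le:
  assumes g: "disc_series (\<lambda>n. of_real (c n)) g" and c: "\<And>n. 0 \<le> c n"
    and r: "0 \<le> r" "r < 1" and A: "finite A"
  shows "(\<Sum>n\<in>A. c n * r ^ n) \<le> norm (g (of_real r))"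
proof -
  have "(\<lambda>n. of_real (c n) * of_real r ^ n) sums g (of_real r)"
    using g r by (intro disc_seriesD) auto
  then have s: "(\<lambda>n. of_real (c n * r ^ n)) sums g (of_real r)" by simp
  have sm: "summable (\<lambda>n. c n * r ^ n)" using disc_series_summable_norm[OF g r] c by simp
  have "g (of_real r) = of_real (\<Sum>n. c n * r ^ n)"
    using s sums_of_real[OF summable_sums[OF sm]] sums_unique2 by blast
  then have "norm (g (of_real r)) = (\<Sum>n. c n * r ^ n)"
    using c r by (simp add: suminf_nonneg[OF sm])
  also have "\<dots> \<ge> (\<Sum>n\<in>A. c n * r ^ n)" using c r by (intro sum_le_suminf sm A) auto
  finally show ?thesis .
qed

lemma le_powr_rootI:
  fixes S K B p :: real
  assumes "S powr p \<le> K * B powr p" "0 \<le> S" "0 \<le> K" "0 \<le> B" "0 < p"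
  shows "S \<le> K powr (1 / p) * B"
proof -
  have "(S powr p) powr (1 / p) \<le> (K * B powr p) powr (1 / p)" using assms by (intro powr_mono2) auto
  then show ?thesis using assms by (simp add: powr_powr powr_mult)
qed

text \<open>For \<open>n \<le> 2 * N\<close> and such \<open>r\<close> the power
  \<open>r ^ n\<close> is at least \<open>exp (- 4)\<close>. The square in the lower bound for
  \<open>r\<close> leaves room for evaluation at a product of two radii, as the point evaluation
  estimate produces it.\<close>

lemma sum_le_disc_series:
  assumes g: "disc_series (\<lambda>n. of_real (c n)) g" and c: "\<And>n. 0 \<le> c n" and N: "0 < N"
    and I: "I \<subseteq> {..2 * N}" and r: "(1 - 1 / (2 * real N))\<^sup>2 \<le> r" "r < 1"
  shows "(\<Sum>n\<in>I. c n) \<le> exp 4 * norm (g (of_real r))"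
proof -
  define x where "x = 1 / (2 * real N)"
  have x: "0 \<le> x" "x \<le> 1/2" using N by (auto simp: x_def field_simps)
  have r0: "0 \<le> r" using r(1) by (rule order_trans[rotated]) simp
  have "(\<Sum>n\<in>I. c n) \<le> (\<Sum>n\<in>I. exp 4 * (c n * r ^ n))"
  proof (rule sum_mono)
    fix n assume "n \<in> I"
    then have "n \<le> 2 * N" using I by auto
    then have n: "real n \<le> 2 * real N" by linarith
    have "2 * x * real (2 * n) \<le> 4" using n N by (simp add: x_def field_simps)
    then have "exp (- 4) \<le> exp (- (2 * x * real (2 * n)))" by simp
    also have "\<dots> \<le> (1 - x) ^ (2 * n)" by (rule one_minus_power_ge[OF x])
    also have "\<dots> \<le> r ^ n" unfolding power_mult using r(1) by (intro power_mono) (auto simp: x_def)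
    finally have "1 \<le> exp 4 * r ^ n" by (simp add: exp_minus field_simps)
    then show "c n \<le> exp 4 * (c n * r ^ n)" using mult_left_mono[OF _ c[of n], of 1 "exp 4 * r ^ n"] by (simp add: mult_ac)
  qed
  also have "\<dots> = exp 4 * (\<Sum>n\<in>I. c n * r ^ n)" by (simp add: sum_distrib_left)
  also have "\<dots> \<le> exp 4 * norm (g (of_real r))"
    using r finite_subset[OF I] by (intro mult_left_mono disc_series_of_real_sum_le[OF g c r0]) auto
  finally show ?thesis .
qed

text \<open>The index range is shifted by one as in \<open>block\<close>: \<open>N = 2 ^ k\<close>
  gives block \<open>k\<close>, and \<open>N = 1\<close> gives the constant term. \<open>N\<close>
  ranges over all positive integers because the moment comparison in the necessity part needs ranges
  that are not dyadic.\<close>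

definition block_growth :: "real \<Rightarrow> ((complex \<Rightarrow> complex) \<Rightarrow> ennreal) \<Rightarrow> bool" where
  "block_growth p Y \<longleftrightarrow> (\<exists>C>0. \<forall>c g B N. (\<forall>n. 0 \<le> c n) \<longrightarrow> disc_series (\<lambda>n. of_real (c n)) g \<longrightarrow> 0 \<le> B \<longrightarrow>
     Y g \<le> ennreal B \<longrightarrow> 0 < N \<longrightarrow> (\<Sum>n\<in>{N - 1..<2 * N - 1}. c n) \<le> C * real N powr (1 / p) * B)"

text \<open>The maximum modulus dominates the value on the positive axis, which by nonnegativity
  dominates the block sum for every radius in \<open>[r0, 1)\<close>. This interval has length
  \<open>1 / (2 * N)\<close>, whence the factor \<open>N powr (1 / p)\<close>.\<close>

lemma block_growth_H_infty:
  assumes p: "1 < p"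
  shows "block_growth p (norm_H_infty p)"
proof -
  have "(\<Sum>n\<in>{N - 1..<2 * N - 1}. c n) \<le> (exp 4 * 2 powr (1 / p)) * real N powr (1 / p) * B"
    if c: "\<forall>n. 0 \<le> c n" and g: "disc_series (\<lambda>n. of_real (c n)) g" and B: "0 \<le> B" "norm_H_infty p g \<le> ennreal B" and N: "0 < N"
    for c g B and N :: nat
  proof -
    define r0 where "r0 = 1 - 1 / (2 * real N)"
    have r0: "0 \<le> r0" "r0 < 1" "r0\<^sup>2 \<le> r0" using N by (auto simp: r0_def field_simps power2_eq_square)
    define S where "S = (\<Sum>n\<in>{N - 1..<2 * N - 1}. c n) / exp 4"
    have S: "S \<ge> 0" using c by (simp add: S_def sum_nonneg)
    have I: "{N - 1..<2 * N - 1} \<subseteq> {..2 * N}" by auto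
    have le: "S \<le> mean_infty r g" if r: "r0 \<le> r" "r < 1" for r
    proof -
      have "S \<le> norm (g (of_real r))"
        using sum_le_disc_series[OF g _ N I order_trans[OF r0(3) r(1), unfolded r0_def] r(2)] c
        by (simp add: S_def divide_le_eq mult.commute)
      also have "\<dots> = norm (g (of_real r * cis 0))" by simp
      also have "\<dots> \<le> mean_infty r g"
        by (rule mean_infty_le(3)) (rule disc_series_norm_le[OF g], use r r0 in auto)
      finally show ?thesis .
    qed
    have "ennreal (S powr p) * ennreal (1 - r0) = (\<integral>\<^sup>+r. ennreal (S powr p) * indicator {r0..<1} r \<partial>lborel)"
      using r0 by (simp add: nn_integral_cmult_indicator)
    also have "\<dots> \<le> (\<integral>\<^sup>+r. ennreal (mean_infty r g powr p) * indicator {0..<1} r \<partial>lborel)"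
      using le S p r0 by (intro nn_integral_mono) (auto simp: indicator_def intro!: ennreal_leI powr_mono2)
    also have "\<dots> \<le> ennreal (B powr p)"
      using B p by (intro le_of_enn_powr_le) (auto simp: norm_H_infty_alt)
    finally have "S powr p * (1 - r0) \<le> B powr p"
      using r0 by (simp flip: ennreal_mult'')
    then have "S powr p \<le> (2 * real N) * B powr p" using N by (simp add: r0_def field_simps)
    then have "S \<le> (2 * real N) powr (1 / p) * B" using S B p by (intro le_powr_rootI) auto
    then show ?thesis by (simp add: S_def field_simps powr_mult)
  qed
  then show ?thesis unfolding block_growth_def by (intro exI[of _ "exp 4 * 2 powr (1 / p)"]) auto
qed

text \<open>Point evaluation at \<open>r0 * r0\<close> from the circle of radius \<open>r0\<close>,
  where \<open>1 - r0\<close> is \<open>1 / (2 * N)\<close>.\<close>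

lemma block_growth_Hardy:
  assumes p: "1 < p"
  shows "block_growth p (norm_Hardy p)"
proof -
  obtain C where C: "C > 0" and pe: "point_evaluation_bounded p C"
    using point_evaluation_bound[OF p] by blast
  define K where "K = exp 4 * C * (2 * pi) powr (1 / p) * 2 powr (1 / p)"
  have "(\<Sum>n\<in>{N - 1..<2 * N - 1}. c n) \<le> K * real N powr (1 / p) * B"
    if c: "\<forall>n. 0 \<le> c n" and g: "disc_series (\<lambda>n. of_real (c n)) g" and B: "0 \<le> B" "norm_Hardy p g \<le> ennreal B" and N: "0 < N"
    for c g B and N :: nat
  proof -
    define r0 where "r0 = 1 - 1 / (2 * real N)"
    have r0: "0 < r0" "r0 < 1" using N by (auto simp: r0_def field_simps)
    have hol: "g holomorphic_on ball 0 1" by (rule disc_series_holomorphic[OF g])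
    have "ennreal (mean_p p r0 g) \<le> norm_Hardy p g" unfolding norm_Hardy_def by (rule SUP_upper) (use r0 in auto)
    then have mB: "mean_p p r0 g \<le> B" using B ennreal_le_iff[OF B(1)] order_trans by blast
    have m0: "0 \<le> mean_p p r0 g" by (simp add: mean_p_def)
    define A where "A = (2 * pi) powr (1 / p) * B"
    have "(circle_integral (\<lambda>t. ennreal (norm (g (of_real r0 * cis t)) powr p))) = ennreal (2 * pi * mean_p p r0 g powr p)"
      using p r0 by (intro mean_p_powr hol) auto
    also have "\<dots> \<le> ennreal (2 * pi * B powr p)"
      using mB m0 p by (intro ennreal_leI mult_left_mono powr_mono2) auto
    also have "2 * pi * B powr p = A powr p" using p B by (simp add: A_def powr_mult powr_powr)
    finally have "norm (g (of_real (r0 * r0))) \<le> C * A * (1 - r0) powr - (1 / p)"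
      using pe hol r0 B by (auto simp: A_def point_evaluation_bounded_def)
    moreover have "(1 - r0) powr - (1 / p) = 2 powr (1 / p) * real N powr (1 / p)"
      using N by (simp add: r0_def powr_minus powr_divide powr_mult)
    moreover have "(\<Sum>n\<in>{N - 1..<2 * N - 1}. c n) \<le> exp 4 * norm (g (of_real (r0 * r0)))"
      using c N r0 mult_strict_mono[of r0 1 r0 1] by (intro sum_le_disc_series[OF g, of N]) (auto simp: r0_def power2_eq_square)
    ultimately have "(\<Sum>n\<in>{N - 1..<2 * N - 1}. c n) \<le> exp 4 * (C * A * (2 powr (1 / p) * real N powr (1 / p)))"
      by (smt (verit) exp_gt_zero mult_left_mono)
    then show ?thesis by (simp add: K_def A_def mult_ac)
  qed
  moreover have "K > 0" using C by (simp add: K_def)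
  ultimately show ?thesis unfolding block_growth_def by (intro exI[of _ K]) auto
qed

text \<open>Hoelder on the \<open>N\<close> indices. There \<open>n + 1\<close> lies between
  \<open>N\<close> and \<open>2 * N\<close>, so the weight is a constant up to the factor
  \<open>2 powr \<bar>p - 2\<bar>\<close>, and the powers of \<open>N\<close> combine to
  \<open>(2 - p) / p + 1 / q = 1 / p\<close>.\<close>

lemma block_growth_HL:
  assumes p: "1 < p"
  shows "block_growth p (norm_HL p)"
proof -
  define q where "q = p / (p - 1)"
  have pq: "1 / p + 1 / q = 1" and q: "q > 1" using p by (auto simp: q_def field_simps)
  define K where "K = (2 powr \<bar>p - 2\<bar>) powr (1 / p)"
  have "(\<Sum>n\<in>{N - 1..<2 * N - 1}. c n) \<le> K * real N powr (1 / p) * B"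
    if c: "\<forall>n. 0 \<le> c n" and g: "disc_series (\<lambda>n. of_real (c n)) g" and B: "0 \<le> B" "norm_HL p g \<le> ennreal B" and N: "0 < N"
    for c g B and N :: nat
  proof -
    define I where "I = {N - 1..<2 * N - 1}"
    have I: "finite I" "card I = N" using N by (auto simp: I_def)
    have "(\<Sum>n. ennreal (norm (of_real (c n) :: complex) powr p * (real n + 1) powr (p - 2))) \<le> ennreal (B powr p)"
      using B p by (intro le_of_enn_powr_le) (auto simp: norm_HL_disc_series[OF g])
    then have "(\<Sum>n\<in>I. ennreal (c n powr p * (real n + 1) powr (p - 2))) \<le> ennreal (B powr p)"
      using c by (intro order_trans[OF sum_le_suminf[of _ I]]) (auto simp: I)
    then have s: "(\<Sum>n\<in>I. c n powr p * (real n + 1) powr (p - 2)) \<le> B powr p"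
      by (simp add: sum_ennreal)
    have w: "1 \<le> 2 powr \<bar>p - 2\<bar> * real N powr (2 - p) * (real n + 1) powr (p - 2)" if "n \<in> I" for n
    proof -
      define x where "x = (real n + 1) / real N"
      have "real N \<le> real n + 1" "real n + 1 \<le> 2 * real N" using that N by (auto simp: I_def)
      then have x: "1 \<le> x" "x \<le> 2" using N by (auto simp: x_def field_simps)
      have "1 \<le> 2 powr \<bar>p - 2\<bar> * x powr (p - 2)"
      proof (cases "p \<ge> 2")
        case True
        then have "1 \<le> 2 powr \<bar>p - 2\<bar>" "1 \<le> x powr (p - 2)" using x by (auto intro!: ge_one_powr_ge_zero)
        then show ?thesis using mult_mono[of 1 "2 powr \<bar>p - 2\<bar>" 1 "x powr (p - 2)"] by simp
      next
        case False
        have "1 = 2 powr (2 - p) * 2 powr (p - 2)" by (simp flip: powr_add)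
        also have "\<dots> \<le> 2 powr (2 - p) * x powr (p - 2)" using False x by (intro mult_left_mono powr_mono2') auto
        finally show ?thesis using False by simp
      qed
      also have "x powr (p - 2) = real N powr (2 - p) * (real n + 1) powr (p - 2)"
        using N powr_minus[of "real N" "p - 2"] by (simp add: x_def powr_divide field_simps)
      finally show ?thesis by (simp add: mult_ac)
    qed
    have "(\<Sum>n\<in>I. c n powr p) \<le> (\<Sum>n\<in>I. 2 powr \<bar>p - 2\<bar> * real N powr (2 - p) * (c n powr p * (real n + 1) powr (p - 2)))"
    proof (rule sum_mono)
      fix n assume "n \<in> I"
      from mult_left_mono[OF w[OF this], of "c n powr p"]
      show "c n powr p \<le> 2 powr \<bar>p - 2\<bar> * real N powr (2 - p) * (c n powr p * (real n + 1) powr (p - 2))"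
        by (simp add: mult_ac)
    qed
    also have "\<dots> = 2 powr \<bar>p - 2\<bar> * real N powr (2 - p) * (\<Sum>n\<in>I. c n powr p * (real n + 1) powr (p - 2))"
      by (simp add: sum_distrib_left)
    also have "\<dots> \<le> 2 powr \<bar>p - 2\<bar> * real N powr (2 - p) * B powr p"
      by (intro mult_left_mono s) auto
    finally have A: "(\<Sum>n\<in>I. c n powr p) \<le> 2 powr \<bar>p - 2\<bar> * real N powr (2 - p) * B powr p" .
    define A where "A = K * (real N powr (2 - p)) powr (1 / p) * B"
    have Ap: "A powr p = 2 powr \<bar>p - 2\<bar> * real N powr (2 - p) * B powr p"
      using p B by (simp add: A_def K_def powr_mult powr_powr)
    have "(\<integral>\<^sup>+n. ennreal (c n * 1) \<partial>count_space I) \<le> ennreal (A * real N powr (1 / q))"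
    proof (rule nn_integral_Holder[OF p pq])
      show "(\<integral>\<^sup>+n. ennreal (c n powr p) \<partial>count_space I) \<le> ennreal (A powr p)"
        using A I by (simp add: nn_integral_count_space_finite Ap sum_ennreal ennreal_leI)
      show "(\<integral>\<^sup>+n. ennreal (1 powr q) \<partial>count_space I) \<le> ennreal ((real N powr (1 / q)) powr q)"
        using I q by (simp add: nn_integral_count_space_finite powr_powr ennreal_of_nat_eq_real_of_nat)
    qed (use c B in \<open>auto simp: A_def K_def\<close>)
    then have "ennreal (\<Sum>n\<in>I. c n) \<le> ennreal (A * real N powr (1 / q))"
      using I c by (simp add: nn_integral_count_space_finite sum_ennreal)
    then have "(\<Sum>n\<in>I. c n) \<le> A * real N powr (1 / q)"
      using B by (subst (asm) ennreal_le_iff) (auto simp: A_def K_def)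
    also have "\<dots> = K * real N powr ((2 - p) * (1 / p) + 1 / q) * B"
      by (simp add: A_def powr_powr powr_add)
    also have "(2 - p) * (1 / p) + 1 / q = 1 / p" using pq p by (simp add: field_simps)
    finally show ?thesis by (simp add: I_def)
  qed
  then show ?thesis unfolding block_growth_def by (intro exI[of _ K]) (auto simp: K_def)
qed

text \<open>Differentiation multiplies the coefficients by at least \<open>N / 2\<close>. Point
  evaluation of the derivative bounds the integral over each circle from below, and an interval of
  radii of length comparable to \<open>1 / N\<close> gives the area integral. The case
  \<open>N = 1\<close> concerns the constant coefficient, which the derivative does not see.\<close>

lemma block_growth_Dirichlet:
  assumes p: "1 < p"
  shows "block_growth p (norm_Dirichlet p)"
proof -
  obtain C where C: "C > 0" and pe: "point_evaluation_bounded p C"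
    using point_evaluation_bound[OF p] by blast
  define K where "K = 1 + 8 * exp 4 * C * (4 * pi) powr (1 / p)"
  have K1: "1 \<le> K" using C by (simp add: K_def)
  have "(\<Sum>n\<in>{N - 1..<2 * N - 1}. c n) \<le> K * real N powr (1 / p) * B"
    if c: "\<forall>n. 0 \<le> c n" and g: "disc_series (\<lambda>n. of_real (c n)) g" and B: "0 \<le> B" "norm_Dirichlet p g \<le> ennreal B" and N: "0 < N"
    for c g B and N :: nat
  proof -
    define J where "J r = (circle_integral (\<lambda>t. ennreal (norm (deriv g (of_real r * cis t)) powr p)))" for r
    have hol: "g holomorphic_on ball 0 1" by (rule disc_series_holomorphic[OF g])
    have "ennreal (norm (g 0) powr p) + (\<integral>\<^sup>+r. J r * ennreal (r * (1 - r) powr (p - 1) / pi) * indicator {0..<1} r \<partial>lborel) \<le> ennreal (B powr p)"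
      using B p by (intro le_of_enn_powr_le) (auto simp: norm_Dirichlet_polar[OF hol] J_def)
    then have b1: "ennreal (norm (g 0) powr p) \<le> ennreal (B powr p)"
      and b2: "(\<integral>\<^sup>+r. J r * ennreal (r * (1 - r) powr (p - 1) / pi) * indicator {0..<1} r \<partial>lborel) \<le> ennreal (B powr p)"
      by (rule order_trans[rotated], simp add: add_increasing2 add_increasing)+
    show ?thesis
    proof (cases "N = 1")
      case True
      have "norm (g 0) powr p \<le> 1 * B powr p" using b1 by simp
      then have "norm (g 0) \<le> 1 powr (1 / p) * B" using B p by (intro le_powr_rootI) auto
      then have "c 0 \<le> B" using disc_series_0[OF g] c by simp
      also have "\<dots> \<le> K * B" using K1 B mult_right_mono[of 1 K B] by simp
      finally show ?thesis using True by simp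
    next
      case False
      define r0 where "r0 = 1 - 1 / (2 * real N)"
      have r0: "1/2 \<le> r0" "r0 < 1" using N by (auto simp: r0_def field_simps)
      define d where "d n = real (Suc n) * c (Suc n)" for n
      have d: "\<forall>n. 0 \<le> d n" using c by (simp add: d_def)
      have dg: "disc_series (\<lambda>n. of_real (d n)) (deriv g)"
        using disc_series_deriv[OF g] by (simp add: d_def)
      have hol': "deriv g holomorphic_on ball 0 1" by (rule disc_series_holomorphic[OF dg])
      define S where "S = (\<Sum>n\<in>{N - 1..<2 * N - 1}. c n)"
      define D where "D = real N / 2 * S / exp 4"
      have D0: "D \<ge> 0" using c by (simp add: D_def S_def sum_nonneg)
      have D: "D \<le> norm (deriv g (of_real r))" if r: "r0\<^sup>2 \<le> r" "r < 1" for r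
      proof -
        \<comment> \<open>Since \<open>N \<ge> 2\<close>, every index \<open>n \<ge> N - 1\<close>
          is at least \<open>N / 2\<close>; the shift from \<open>n\<close> to \<open>n - 1\<close>
          is the one made by differentiation.\<close>
        have "real N / 2 * S = (\<Sum>n\<in>{N - 1..<2 * N - 1}. real N / 2 * c n)" by (simp add: S_def sum_distrib_left)
        also have "\<dots> \<le> (\<Sum>n\<in>{N - 1..<2 * N - 1}. d (n - 1))"
        proof (rule sum_mono)
          fix n assume n: "n \<in> {N - 1..<2 * N - 1}"
          then have "n \<ge> 1" "real N / 2 \<le> real n" using False N by auto
          then show "real N / 2 * c n \<le> d (n - 1)" using c mult_right_mono[of "real N / 2" "real n" "c n"] by (simp add: d_def)
        qed
        also have "\<dots> = (\<Sum>n\<in>{N - 2..<2 * N - 2}. d n)"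
          by (rule sum.reindex_bij_witness[of _ Suc "\<lambda>n. n - 1"]) (use False N in auto)
        also have "\<dots> \<le> exp 4 * norm (deriv g (of_real r))"
          using r d N by (intro sum_le_disc_series[OF dg, of N]) (auto simp: r0_def)
        finally show ?thesis by (simp add: D_def field_simps)
      qed
      \<comment> \<open>The derivative is evaluated at \<open>r * r0\<close>, which is still at
        least \<open>r0\<^sup>2\<close>, from the circle of radius \<open>r\<close>.\<close>
      have J: "ennreal ((D / C) powr p * (1 - r0)) \<le> J r" if r: "r0 \<le> r" "r < 1" for r
      proof (cases "J r = top")
        case False
        define A where "A = enn2real (J r) powr (1 / p)"
        have JA: "J r = ennreal (A powr p)" using False p by (simp add: A_def powr_powr less_top)
        have "r0\<^sup>2 \<le> r * r0" using r r0 by (simp add: power2_eq_square mult_right_mono)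
        moreover have "r * r0 < 1" using r r0 mult_strict_mono[of r 1 r0 1] by simp
        ultimately have "D \<le> norm (deriv g (of_real (r * r0)))" by (rule D)
        also have "\<dots> \<le> C * A * (1 - r0) powr - (1 / p)"
          using pe[unfolded point_evaluation_bounded_def, rule_format, of "deriv g" r r0 A] hol' r r0 JA by (simp add: J_def A_def)
        finally have "D / C * (1 - r0) powr (1 / p) \<le> A"
          using C r0 by (simp add: powr_minus field_simps)
        then have "(D / C * (1 - r0) powr (1 / p)) powr p \<le> A powr p"
          using p C D0 by (intro powr_mono2) auto
        also have "(D / C * (1 - r0) powr (1 / p)) powr p = (D / C) powr p * (1 - r0)"
        proof -
          have "((1 - r0) powr (1 / p)) powr p = 1 - r0" using p r0 by (simp add: powr_powr)
          then show ?thesis using C D0 by (subst powr_mult) auto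
        qed
        finally show ?thesis unfolding JA by (rule ennreal_leI)
      qed simp
      \<comment> \<open>Half of the distance to the boundary: for radii in
        \<open>[r0, r0 + x)\<close> the weight \<open>(1 - r) powr (p - 1)\<close> is at least
        \<open>x powr (p - 1)\<close>, and the radius itself is at least 1/2.\<close>
      define x where "x = (1 - r0) / 2"
      have x: "x > 0" "x = 1 / (4 * real N)" using r0 by (auto simp: x_def r0_def)
      define V where "V = (D / C) powr p * (1 - r0) * (x powr (p - 1) / (2 * pi))"
      have V0: "V \<ge> 0" using r0 by (simp add: V_def)
      have "ennreal V * ennreal x = (\<integral>\<^sup>+r. ennreal V * indicator {r0..<r0 + x} r \<partial>lborel)"
        using x by (simp add: nn_integral_cmult_indicator)
      also have "\<dots> \<le> (\<integral>\<^sup>+r. J r * ennreal (r * (1 - r) powr (p - 1) / pi) * indicator {0..<1} r \<partial>lborel)"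
      proof (rule nn_integral_mono)
        fix r :: real
        show "ennreal V * indicator {r0..<r0 + x} r \<le> J r * ennreal (r * (1 - r) powr (p - 1) / pi) * indicator {0..<1} r"
        proof (cases "r \<in> {r0..<r0 + x}")
          case True
          then have r: "r0 \<le> r" "r < 1" "x \<le> 1 - r" using r0 by (auto simp: x_def field_simps)
          have "ennreal V = ennreal ((D / C) powr p * (1 - r0)) * ennreal (x powr (p - 1) / (2 * pi))"
            unfolding V_def using r0 by (intro ennreal_mult) auto
          also have "\<dots> \<le> J r * ennreal (r * (1 - r) powr (p - 1) / pi)"
          proof (intro mult_mono J r ennreal_leI)
            have "1 / 2 * x powr (p - 1) \<le> r * (1 - r) powr (p - 1)"
              using r r0 x p by (intro mult_mono powr_mono2) auto
            then show "x powr (p - 1) / (2 * pi) \<le> r * (1 - r) powr (p - 1) / pi" by (simp add: field_simps)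
          qed auto
          finally show ?thesis using True r r0 by simp
        qed auto
      qed
      also have "\<dots> \<le> ennreal (B powr p)" by (rule b2)
      finally have "V * x \<le> B powr p" using V0 x by (simp flip: ennreal_mult)
      moreover have "V * x = (D / C) powr p * (x powr p * x / pi)"
        using x by (simp add: V_def x_def powr_diff field_simps)
      ultimately have "(D / C) powr p * (x powr p * x) \<le> pi * B powr p" by (simp add: field_simps)
      then have "(D / C * x) powr p * x \<le> pi * B powr p" by (simp only: powr_mult mult.assoc)
      then have "(D / C * x) powr p \<le> pi * B powr p / x" using x(1) by (simp only: pos_le_divide_eq)
      also have "pi * B powr p / x = (pi * (4 * real N)) * B powr p" by (simp add: x(2))
      finally have "(D / C * x) powr p \<le> (pi * (4 * real N)) * B powr p" .
      then have "D / C * x \<le> (pi * (4 * real N)) powr (1 / p) * B"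
        using x C D0 B p by (intro le_powr_rootI) auto
      then have "D \<le> C * (4 * real N) * ((pi * (4 * real N)) powr (1 / p) * B)"
        using x C N by (simp add: field_simps)
      then have "S \<le> 8 * exp 4 * C * (4 * pi) powr (1 / p) * real N powr (1 / p) * B"
        using N by (simp add: D_def field_simps powr_mult)
      also have "\<dots> \<le> K * real N powr (1 / p) * B"
        using B by (intro mult_right_mono) (auto simp: K_def)
      finally show ?thesis by (simp add: S_def)
    qed
  qed
  then show ?thesis unfolding block_growth_def using K1 by (intro exI[of _ K]) auto
qed

section \<open>Upper bounds for series with dyadically controlled coefficients\<close>

text \<open>The last condition, on the variation over a block, stands in for monotone coefficients.
  For monotone coefficients the variation would be controlled by their size.\<close>

definition dyadic_bound :: "real \<Rightarrow> (nat \<Rightarrow> complex) \<Rightarrow> (nat \<Rightarrow> real) \<Rightarrow> bool" where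
  "dyadic_bound p c h \<longleftrightarrow> (\<forall>j. 0 \<le> h j \<and> (\<forall>n\<in>block j. 2 ^ j * norm (c n) \<le> 2 powr (real j / p) * h j) \<and>
     2 ^ j * (\<Sum>n\<in>block j. norm (c (Suc n) - c n)) \<le> 2 powr (real j / p) * h j)"

definition dyadic_sufficient :: "real \<Rightarrow> ((complex \<Rightarrow> complex) \<Rightarrow> ennreal) \<Rightarrow> bool" where
  "dyadic_sufficient p Y \<longleftrightarrow> (\<exists>C>0. \<forall>c h H g. dyadic_bound p c h \<longrightarrow> disc_series c g \<longrightarrow> 0 \<le> H \<longrightarrow>
     (\<Sum>j. ennreal (h j powr p)) \<le> ennreal H \<longrightarrow> Y g \<le> ennreal ((C * H) powr (1 / p)))"

lemma dyadic_boundD: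
  assumes "dyadic_bound p c h"
  shows "0 \<le> h j" "n \<in> block j \<Longrightarrow> 2 ^ j * norm (c n) \<le> 2 powr (real j / p) * h j"
    "2 ^ j * (\<Sum>n\<in>block j. norm (c (Suc n) - c n)) \<le> 2 powr (real j / p) * h j"
  using assms by (auto simp: dyadic_bound_def)

lemma dyadic_bound_sum_norm:
  assumes "dyadic_bound p c h"
  shows "(\<Sum>n\<in>block j. norm (c n)) \<le> 2 powr (real j / p) * h j"
proof -
  have "(\<Sum>n\<in>block j. norm (c n)) \<le> (\<Sum>n\<in>block j. 2 powr (real j / p) * h j / 2 ^ j)"
    using dyadic_boundD(2)[OF assms] by (intro sum_mono) (simp add: field_simps)
  then show ?thesis by simp
qed

text \<open>Only the sizes matter here. Each of the \<open>2 ^ j\<close> indices of block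
  \<open>j\<close> contributes at most \<open>h j powr p / 2 ^ j\<close>, up to the factor
  \<open>2 powr \<bar>p - 2\<bar>\<close> for replacing \<open>n + 1\<close> by
  \<open>2 ^ j\<close>, in either sign of \<open>p - 2\<close>.\<close>

lemma dyadic_sufficient_HL:
  assumes p: "1 < p"
  shows "dyadic_sufficient p (norm_HL p)"
proof -
  have "norm_HL p g \<le> ennreal ((2 powr \<bar>p - 2\<bar> * H) powr (1 / p))"
    if c: "dyadic_bound p c h" and g: "disc_series c g" and H: "0 \<le> H" and hH: "(\<Sum>j. ennreal (h j powr p)) \<le> ennreal H"
    for c h H g
  proof -
    note h = dyadic_boundD(1)[OF c]
    have t: "2 ^ j * (norm (c n) powr p * (real n + 1) powr (p - 2)) \<le> 2 powr \<bar>p - 2\<bar> * h j powr p" if n: "n \<in> block j" for j n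
    proof -
      define X where "X = (2::real) ^ j"
      have X: "X > 0" by (simp add: X_def)
      have "Suc n \<ge> 2 ^ j" "Suc n < 2 * 2 ^ j" using blockD[OF n] by auto
      then have "real (Suc n) \<ge> real (2 ^ j)" "real (Suc n) \<le> real (2 * 2 ^ j)" by (simp_all only: of_nat_le_iff less_imp_le)
      then have x: "X \<le> real n + 1" "real n + 1 \<le> 2 * X" by (simp_all add: X_def)
      have w: "(real n + 1) powr (p - 2) \<le> 2 powr \<bar>p - 2\<bar> * X powr (p - 2)"
      proof (cases "p \<ge> 2")
        case True
        then have "(real n + 1) powr (p - 2) \<le> (2 * X) powr (p - 2)" using x by (intro powr_mono2) auto
        then show ?thesis using True by (simp add: powr_mult)
      next
        case False
        then have "(real n + 1) powr (p - 2) \<le> 1 * X powr (p - 2)" using x X by (simp add: powr_mono2')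
        also have "\<dots> \<le> 2 powr \<bar>p - 2\<bar> * X powr (p - 2)" by (intro mult_right_mono ge_one_powr_ge_zero) auto
        finally show ?thesis .
      qed
      have "norm (c n) \<le> 2 powr (real j / p) * h j / X"
        using dyadic_boundD(2)[OF c n] X by (simp add: X_def field_simps)
      then have "norm (c n) powr p \<le> (2 powr (real j / p) * h j / X) powr p" using p by (intro powr_mono2) auto
      also have "\<dots> = X * h j powr p * X powr - p"
        using p X by (simp add: powr_divide powr_mult powr_powr powr_realpow powr_minus X_def field_simps)
      finally have "norm (c n) powr p * (real n + 1) powr (p - 2) \<le> (X * h j powr p * X powr - p) * (2 powr \<bar>p - 2\<bar> * X powr (p - 2))"
        using w X by (intro mult_mono) auto
      then have "X * (norm (c n) powr p * (real n + 1) powr (p - 2)) \<le> X * ((X * h j powr p * X powr - p) * (2 powr \<bar>p - 2\<bar> * X powr (p - 2)))"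
        using X by (intro mult_left_mono) auto
      also have "\<dots> = 2 powr \<bar>p - 2\<bar> * h j powr p"
        using X by (simp add: powr_diff powr_minus field_simps power2_eq_square powr_numeral)
      finally show ?thesis by (simp add: X_def)
    qed
    have "(\<Sum>n. ennreal (norm (c n) powr p * (real n + 1) powr (p - 2))) = (\<Sum>j. \<Sum>n\<in>block j. ennreal (norm (c n) powr p * (real n + 1) powr (p - 2)))"
      by (rule suminf_block)
    also have "\<dots> \<le> (\<Sum>j. ennreal (2 powr \<bar>p - 2\<bar>) * ennreal (h j powr p))"
    proof (intro suminf_le)
      fix j
      have "(\<Sum>n\<in>block j. ennreal (norm (c n) powr p * (real n + 1) powr (p - 2))) \<le> (\<Sum>n\<in>block j. ennreal (2 powr \<bar>p - 2\<bar> * h j powr p / 2 ^ j))"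
        using t by (intro sum_mono ennreal_leI) (simp add: field_simps)
      also have "\<dots> = ennreal (\<Sum>n\<in>block j. 2 powr \<bar>p - 2\<bar> * h j powr p / 2 ^ j)" by (rule sum_ennreal) simp
      also have "(\<Sum>n\<in>block j. 2 powr \<bar>p - 2\<bar> * h j powr p / 2 ^ j) = 2 powr \<bar>p - 2\<bar> * h j powr p" by simp
      finally show "(\<Sum>n\<in>block j. ennreal (norm (c n) powr p * (real n + 1) powr (p - 2))) \<le> ennreal (2 powr \<bar>p - 2\<bar>) * ennreal (h j powr p)"
        by (simp add: ennreal_mult)
    qed auto
    also have "\<dots> \<le> ennreal (2 powr \<bar>p - 2\<bar>) * ennreal H" using hH by (simp add: mult_left_mono)
    also have "\<dots> = ennreal (2 powr \<bar>p - 2\<bar> * H)" using H by (simp add: ennreal_mult)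
    finally show ?thesis unfolding norm_HL_disc_series[OF g] using p H by (intro enn_powr_le) auto
  qed
  then show ?thesis unfolding dyadic_sufficient_def by (intro exI[of _ "2 powr \<bar>p - 2\<bar>"]) auto
qed

text \<open>Reduction to the lacunary series: \<open>r ^ n\<close> is largest at the first index of
  a block. It serves for the coefficients themselves and, in the Dirichlet case, for differences of
  coefficients.\<close>

lemma dyadic_majorant:
  fixes a V :: "nat \<Rightarrow> real"
  assumes r: "0 \<le> r" "r \<le> 1" and a: "\<And>n. 0 \<le> a n" and aV: "\<And>j. (\<Sum>n\<in>block j. a n) \<le> V j"
    and V: "summable (\<lambda>j. V j * r ^ (2 ^ j - 1))"
  shows "summable (\<lambda>n. a n * r ^ n)" "(\<Sum>n. a n * r ^ n) \<le> (\<Sum>j. V j * r ^ (2 ^ j - 1))"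
proof -
  have V0: "0 \<le> V j" for j using a by (intro order_trans[OF sum_nonneg aV]) auto
  have "(\<Sum>n. ennreal (a n * r ^ n)) = (\<Sum>j. \<Sum>n\<in>block j. ennreal (a n * r ^ n))" by (rule suminf_block)
  also have "\<dots> \<le> (\<Sum>j. ennreal (V j * r ^ (2 ^ j - 1)))"
  proof (intro suminf_le)
    fix j
    have "(\<Sum>n\<in>block j. a n * r ^ n) \<le> (\<Sum>n\<in>block j. a n * r ^ (2 ^ j - 1))"
      using a r by (intro sum_mono mult_left_mono power_decreasing) (auto simp: block_def)
    also have "\<dots> = (\<Sum>n\<in>block j. a n) * r ^ (2 ^ j - 1)" by (simp add: sum_distrib_right)
    also have "\<dots> \<le> V j * r ^ (2 ^ j - 1)" using r by (intro mult_right_mono aV) auto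
    finally show "(\<Sum>n\<in>block j. ennreal (a n * r ^ n)) \<le> ennreal (V j * r ^ (2 ^ j - 1))"
      using a r by (subst sum_ennreal) (auto intro: ennreal_leI)
  qed auto
  also have "\<dots> = ennreal (\<Sum>j. V j * r ^ (2 ^ j - 1))"
    using V0 r by (intro suminf_ennreal2 V) auto
  finally have le: "(\<Sum>n. ennreal (a n * r ^ n)) \<le> ennreal (\<Sum>j. V j * r ^ (2 ^ j - 1))" .
  then have "(\<Sum>n. ennreal (a n * r ^ n)) \<noteq> top" by (auto simp: top_unique)
  then show s: "summable (\<lambda>n. a n * r ^ n)" using a r by (intro summable_suminf_not_top) auto
  have "0 \<le> (\<Sum>j. V j * r ^ (2 ^ j - 1))" using V0 r by (intro suminf_nonneg V) auto
  then show "(\<Sum>n. a n * r ^ n) \<le> (\<Sum>j. V j * r ^ (2 ^ j - 1))"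
    using le a r s by (subst (asm) suminf_ennreal2) (auto simp: ennreal_le_iff)
qed

lemma dyadic_sufficient_H_infty:
  assumes p: "1 < p"
  shows "dyadic_sufficient p (norm_H_infty p)"
proof -
  obtain C where C: "C > 0" and L: "dyadic_series_bounded p C"
    using dyadic_series_Lp[OF p] by blast
  have "norm_H_infty p g \<le> ennreal ((C * H) powr (1 / p))"
    if c: "dyadic_bound p c h" and g: "disc_series c g" and H: "0 \<le> H" and hH: "(\<Sum>j. ennreal (h j powr p)) \<le> ennreal H"
    for c h H g
  proof -
    note h = dyadic_boundD(1)[OF c]
    note Lh = dyadic_series_boundedD[OF L h H hH]
    have "(\<integral>\<^sup>+r. ennreal (mean_infty r g powr p) * indicator {0..<1} r \<partial>lborel) \<le>
      (\<integral>\<^sup>+r. ennreal ((\<Sum>j. 2 powr (real j / p) * h j * r ^ (2 ^ j - 1)) powr p) * indicator {0..<1} r \<partial>lborel)"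
    proof (rule nn_integral_mono)
      fix r :: real
      show "ennreal (mean_infty r g powr p) * indicator {0..<1} r \<le> ennreal ((\<Sum>j. 2 powr (real j / p) * h j * r ^ (2 ^ j - 1)) powr p) * indicator {0..<1} r"
      proof (cases "r \<in> {0..<1}")
        case True
        then have r: "0 \<le> r" "r < 1" by auto
        have "(\<Sum>n. norm (c n) * r ^ n) \<le> (\<Sum>j. 2 powr (real j / p) * h j * r ^ (2 ^ j - 1))"
          using r Lh by (intro dyadic_majorant(2) dyadic_bound_sum_norm[OF c]) auto
        then have b: "norm (g (of_real r * cis t)) \<le> (\<Sum>j. 2 powr (real j / p) * h j * r ^ (2 ^ j - 1))" for t
          using disc_series_norm_le[OF g r] order_trans by blast
        have "mean_infty r g powr p \<le> (\<Sum>j. 2 powr (real j / p) * h j * r ^ (2 ^ j - 1)) powr p"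
          using mean_infty_le(1,2)[of g r, OF b] p by (intro powr_mono2) auto
        then show ?thesis using True by (simp add: ennreal_leI)
      qed simp
    qed
    also have "\<dots> \<le> ennreal (C * H)" using Lh by blast
    finally show ?thesis unfolding norm_H_infty_alt using p H C by (intro enn_powr_le) auto
  qed
  then show ?thesis unfolding dyadic_sufficient_def using C by blast
qed

text \<open>Multiplication by \<open>1 - z\<close> turns the coefficients into their differences.
  The gain over the trivial estimate is the factor \<open>1 / norm (1 - z)\<close>, small away from
  1, without which the integrals over circles would be too large.\<close>

lemma abel_summation_norm_le:
  assumes g: "disc_series c g" and z: "norm z < 1"
    and e: "e 0 = c 0" "\<And>n. e (Suc n) = c (Suc n) - c n"
    and d: "summable (\<lambda>n. norm (e n) * norm z ^ n)"
  shows "norm (1 - z) * norm (g z) \<le> (\<Sum>n. norm (e n) * norm z ^ n)"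
proof -
  have s: "(\<lambda>n. c n * z ^ n) sums g z" by (rule disc_seriesD[OF g z])
  have "(\<lambda>n. c (Suc n) * z ^ Suc n) sums (g z - c 0)" using s by (subst sums_Suc_iff) simp
  moreover have "(\<lambda>n. c n * z ^ n * z) sums (g z * z)" using s by (rule sums_mult2)
  ultimately have "(\<lambda>n. c (Suc n) * z ^ Suc n - c n * z ^ n * z) sums (g z - c 0 - g z * z)" by (rule sums_diff)
  moreover have "(\<lambda>n. c (Suc n) * z ^ Suc n - c n * z ^ n * z) = (\<lambda>n. e (Suc n) * z ^ Suc n)"
    by (simp add: e algebra_simps)
  ultimately have "(\<lambda>n. e (Suc n) * z ^ Suc n) sums ((1 - z) * g z - e 0 * z ^ 0)" by (simp add: algebra_simps e)
  then have "(\<lambda>n. e n * z ^ n) sums ((1 - z) * g z)" by (subst (asm) sums_Suc_iff) simp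
  moreover have "norm (e n * z ^ n) = norm (e n) * norm z ^ n" for n by (simp add: norm_mult norm_power)
  then have n: "(\<lambda>n. norm (e n * z ^ n)) = (\<lambda>n. norm (e n) * norm z ^ n)" by (rule ext)
  ultimately show ?thesis using summable_norm[of "\<lambda>n. e n * z ^ n", unfolded n, OF d]
    by (simp only: sums_iff norm_mult)
qed

text \<open>Abel summation for the derivative gives
  \<open>norm (deriv g z) \<le> 3 * S (norm z) / norm (1 - z)\<close>, where \<open>S\<close> is the
  lacunary majorant. The p-th power of \<open>1 / norm (1 - z)\<close> integrates over the circle to
  order \<open>(1 - r) powr (1 - p)\<close>, which cancels the weight, and the integral of
  \<open>S r powr p\<close> remains.\<close>

lemma dyadic_sufficient_Dirichlet:
  assumes p: "1 < p"
  shows "dyadic_sufficient p (norm_Dirichlet p)"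
proof -
  obtain C where C: "C > 0" and L: "dyadic_series_bounded p C"
    using dyadic_series_Lp[OF p] by blast
  obtain K where K: "K > 0" "\<And>r. 0 \<le> r \<Longrightarrow> r < 1 \<Longrightarrow>
    (circle_integral (\<lambda>\<theta>. ennreal (norm (1 - of_real r * cis \<theta>) powr - p))) \<le> ennreal (K * (1 - r) powr (1 - p))"
    using angle_integral_bound[OF p] by blast
  define M where "M = 1 + 3 powr p * K * C"
  have "norm_Dirichlet p g \<le> ennreal ((M * H) powr (1 / p))"
    if c: "dyadic_bound p c h" and g: "disc_series c g" and H: "0 \<le> H" and hH: "(\<Sum>j. ennreal (h j powr p)) \<le> ennreal H"
    for c h H g
  proof -
    note h = dyadic_boundD(1)[OF c]
    note Lh = dyadic_series_boundedD[OF L h H hH]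
    define S where "S r = (\<Sum>j. 2 powr (real j / p) * h j * r ^ (2 ^ j - 1))" for r :: real
    have sm: "summable (\<lambda>j. 2 powr (real j / p) * h j * r ^ (2 ^ j - 1))" if "0 \<le> r" "r < 1" for r using Lh that by auto
    \<comment> \<open>Differences of the coefficients of the derivative, with
      \<open>e 0 = c 1\<close>. They equal \<open>(n + 1) * (c (n + 1) - c n) + c n\<close>: over a
      block the first part sums to twice the unit \<open>2 powr (j / p) * h j\<close>, the second to
      once.\<close>
    define e where "e n = of_nat (Suc n) * c (Suc n) - of_nat n * c n" for n
    have V: "(\<Sum>n\<in>block j. norm (e n)) \<le> 3 * (2 powr (real j / p) * h j)" for j
    proof -
      have "(\<Sum>n\<in>block j. norm (e n)) \<le> (\<Sum>n\<in>block j. 2 * 2 ^ j * norm (c (Suc n) - c n) + norm (c n))"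
      proof (rule sum_mono)
        fix n assume "n \<in> block j"
        then have "Suc n \<le> 2 * 2 ^ j" using blockD(2)[of n j] by simp
        then have n: "real (Suc n) \<le> 2 * 2 ^ j" by (simp only: of_nat_le_iff[symmetric, where 'a=real]) simp
        have "e n = of_nat (Suc n) * (c (Suc n) - c n) + c n" by (simp add: e_def algebra_simps)
        then have "norm (e n) \<le> real (Suc n) * norm (c (Suc n) - c n) + norm (c n)"
          by (metis norm_triangle_ineq norm_mult norm_of_nat)
        also have "\<dots> \<le> 2 * 2 ^ j * norm (c (Suc n) - c n) + norm (c n)"
          by (intro add_right_mono mult_right_mono n) auto
        finally show "norm (e n) \<le> 2 * 2 ^ j * norm (c (Suc n) - c n) + norm (c n)" .
      qed
      also have "\<dots> = 2 * (2 ^ j * (\<Sum>n\<in>block j. norm (c (Suc n) - c n))) + (\<Sum>n\<in>block j. norm (c n))"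
        by (simp add: sum.distrib sum_distrib_left mult.assoc)
      also have "\<dots> \<le> 2 * (2 powr (real j / p) * h j) + 2 powr (real j / p) * h j"
        by (intro add_mono mult_left_mono dyadic_boundD(3)[OF c] dyadic_bound_sum_norm[OF c]) auto
      finally show ?thesis by linarith
    qed
    have bound: "norm (deriv g z) \<le> 3 * S (norm z) / norm (1 - z)" if z: "norm z < 1" for z
    proof -
      have sm': "summable (\<lambda>j. 3 * (2 powr (real j / p) * h j) * norm z ^ (2 ^ j - 1))"
        using summable_mult[OF sm[of "norm z"], of 3] z by (simp add: mult_ac)
      note mj = dyadic_majorant[of "norm z" "\<lambda>n. norm (e n)", OF _ _ _ V sm']
      have "norm (1 - z) * norm (deriv g z) \<le> (\<Sum>n. norm (e n) * norm z ^ n)"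
        using z mj(1) by (intro abel_summation_norm_le[OF disc_series_deriv[OF g] z]) (auto simp: e_def)
      also have "\<dots> \<le> 3 * S (norm z)"
      proof -
        have "(\<Sum>j. 3 * (2 powr (real j / p) * h j) * norm z ^ (2 ^ j - 1)) = (\<Sum>j. 3 * (2 powr (real j / p) * h j * norm z ^ (2 ^ j - 1)))"
          by (simp only: mult_ac)
        also have "\<dots> = 3 * S (norm z)"
          unfolding S_def using z by (intro suminf_mult sm) auto
        finally show ?thesis using mj(2) z by simp
      qed
      finally have "norm (1 - z) * norm (deriv g z) \<le> 3 * S (norm z)" .
      moreover have "norm (1 - z) > 0" using z by auto
      ultimately show ?thesis by (simp add: field_simps)
    qed
    have S0: "0 \<le> S r" if "0 \<le> r" "r < 1" for r
      unfolding S_def using h that by (intro suminf_nonneg sm) auto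
    have inner: "(circle_integral (\<lambda>t. ennreal (norm (deriv g (of_real r * cis t)) powr p)))
       * ennreal (r * (1 - r) powr (p - 1) / pi) \<le> ennreal (3 powr p * K) * ennreal (S r powr p)" if r: "0 \<le> r" "r < 1" for r
    proof -
      have "(circle_integral (\<lambda>t. ennreal (norm (deriv g (of_real r * cis t)) powr p)))
        \<le> (\<integral>\<^sup>+t. ennreal ((3 * S r) powr p) * (ennreal (norm (1 - of_real r * cis t) powr - p) * indicator {0..2*pi} t) \<partial>lborel)"
      proof (intro nn_integral_mono)
        fix t
        have "norm (deriv g (of_real r * cis t)) \<le> 3 * S r / norm (1 - of_real r * cis t)"
          using bound[of "of_real r * cis t"] r by (simp add: norm_mult)
        then have "norm (deriv g (of_real r * cis t)) powr p \<le> (3 * S r / norm (1 - of_real r * cis t)) powr p"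
          using p by (intro powr_mono2) auto
        also have "\<dots> = (3 * S r) powr p * norm (1 - of_real r * cis t) powr - p"
          using S0[OF r] by (simp add: powr_divide powr_minus field_simps)
        finally show "ennreal (norm (deriv g (of_real r * cis t)) powr p) * indicator {0..2*pi} t
          \<le> ennreal ((3 * S r) powr p) * (ennreal (norm (1 - of_real r * cis t) powr - p) * indicator {0..2*pi} t)"
          by (auto simp: indicator_def ennreal_leI simp flip: ennreal_mult)
      qed
      also have "\<dots> = ennreal ((3 * S r) powr p) * (circle_integral (\<lambda>t. ennreal (norm (1 - of_real r * cis t) powr - p)))"
        by (rule nn_integral_cmult) measurable
      also have "\<dots> \<le> ennreal ((3 * S r) powr p) * ennreal (K * (1 - r) powr (1 - p))"
        by (intro mult_left_mono K r) auto
      finally have "(circle_integral (\<lambda>t. ennreal (norm (deriv g (of_real r * cis t)) powr p)))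
         * ennreal (r * (1 - r) powr (p - 1) / pi) \<le> ennreal ((3 * S r) powr p) * ennreal (K * (1 - r) powr (1 - p)) * ennreal (r * (1 - r) powr (p - 1) / pi)"
        by (intro mult_right_mono) auto
      also have "\<dots> = ennreal (3 powr p * K * S r powr p * (r / pi))"
      proof -
        have "(1 - r) powr (1 - p) * (1 - r) powr (p - 1) = 1" using r by (simp flip: powr_add)
        then have "(3 * S r) powr p * (K * (1 - r) powr (1 - p)) * (r * (1 - r) powr (p - 1) / pi) = 3 powr p * K * S r powr p * (r / pi)"
          by (simp add: powr_mult mult_ac)
        then show ?thesis using K r by (simp flip: ennreal_mult)
      qed
      also have "\<dots> \<le> ennreal (3 powr p * K * S r powr p)"
        using r K pi_gt3 by (intro ennreal_leI mult_right_le_one_le) (auto simp: field_simps)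
      finally show ?thesis using K by (simp add: ennreal_mult)
    qed
    have "(\<integral>\<^sup>+r. (circle_integral (\<lambda>t. ennreal (norm (deriv g (of_real r * cis t)) powr p)))
       * ennreal (r * (1 - r) powr (p - 1) / pi) * indicator {0..<1} r \<partial>lborel)
       \<le> (\<integral>\<^sup>+r. ennreal (3 powr p * K) * (ennreal (S r powr p) * indicator {0..<1} r) \<partial>lborel)"
      using inner by (intro nn_integral_mono) (auto simp: indicator_def)
    also have "\<dots> = ennreal (3 powr p * K) * (\<integral>\<^sup>+r. ennreal (S r powr p) * indicator {0..<1} r \<partial>lborel)"
      unfolding S_def by (rule nn_integral_cmult) measurable
    also have "\<dots> \<le> ennreal (3 powr p * K) * ennreal (C * H)"
      using Lh by (intro mult_left_mono) (auto simp: S_def)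
    finally have I: "(\<integral>\<^sup>+r. (circle_integral (\<lambda>t. ennreal (norm (deriv g (of_real r * cis t)) powr p)))
       * ennreal (r * (1 - r) powr (p - 1) / pi) * indicator {0..<1} r \<partial>lborel) \<le> ennreal (3 powr p * K * C * H)"
      using K C H by (simp flip: ennreal_mult add: mult_ac)
    \<comment> \<open>Block 0 is the single index 0, so \<open>h 0\<close> bounds the constant term;
      this is the summand 1 in \<open>M\<close>.\<close>
    have "norm (g 0) powr p \<le> h 0 powr p"
      using dyadic_boundD(2)[OF c, of 0 0] p by (simp add: disc_series_0[OF g] block_def powr_mono2)
    then have "ennreal (norm (g 0) powr p) \<le> (\<Sum>j\<in>{0}. ennreal (h j powr p))" by (simp add: ennreal_leI)
    also have "\<dots> \<le> (\<Sum>j. ennreal (h j powr p))" by (intro sum_le_suminf) auto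
    also have "\<dots> \<le> ennreal H" by (rule hH)
    finally have "ennreal (norm (g 0) powr p) \<le> ennreal H" .
    from add_mono[OF this I]
    show ?thesis unfolding norm_Dirichlet_polar[OF disc_series_holomorphic[OF g]]
      using p H K C by (intro enn_powr_le) (auto simp: M_def distrib_right simp flip: ennreal_plus)
  qed
  moreover have "M > 0" using K C by (simp add: M_def add_pos_nonneg)
  ultimately show ?thesis unfolding dyadic_sufficient_def by blast
qed


section \<open>Remainders from a given block on, and the Hardy norm\<close>

lemma suminf_block_offset:
  "(\<Sum>n. f (n + (2 ^ i - 1))) = (\<Sum>j. \<Sum>n\<in>block (j + i). f n :: ennreal)"
proof -
  define f' where "f' n = (if 2 ^ i \<le> Suc n then f n else 0)" for n
  have "(\<Sum>n. f' n) = (\<Sum>n. f' (n + (2 ^ i - 1))) + (\<Sum>n<2 ^ i - 1. f' n)"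
    by (rule suminf_offset) auto
  also have "(\<Sum>n<2 ^ i - 1. f' n) = 0" by (intro sum.neutral) (auto simp: f'_def)
  also have "(\<Sum>n. f' (n + (2 ^ i - 1))) = (\<Sum>n. f (n + (2 ^ i - 1)))"
    by (simp add: f'_def)
  finally have 1: "(\<Sum>n. f' n) = (\<Sum>n. f (n + (2 ^ i - 1)))" by simp
  have "(\<Sum>n. f' n) = (\<Sum>j. \<Sum>n\<in>block j. f' n)" by (rule suminf_block)
  also have "\<dots> = (\<Sum>j. \<Sum>n\<in>block (j + i). f' n) + (\<Sum>j<i. \<Sum>n\<in>block j. f' n)"
    by (rule suminf_offset) auto
  also have "(\<Sum>j<i. \<Sum>n\<in>block j. f' n) = 0"
    unfolding sum_lessThan_block[symmetric] by (intro sum.neutral) (auto simp: f'_def)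
  also have "(\<Sum>j. \<Sum>n\<in>block (j + i). f' n) = (\<Sum>j. \<Sum>n\<in>block (j + i). f n)"
  proof (intro suminf_cong sum.cong refl)
    fix j n assume "n \<in> block (j + i)"
    then have "2 ^ (j + i) \<le> Suc n" by (rule blockD)
    then have "2 ^ i \<le> Suc n" using order_trans[of "2 ^ i" "2 ^ (j + i)" "Suc n"] by simp
    then show "f' n = f n" by (simp add: f'_def)
  qed
  finally show ?thesis using 1 by simp
qed

lemma norm_sums_le_ennreal:
  assumes "a sums s"
  shows "ennreal (norm s) \<le> (\<Sum>n. ennreal (norm (a n)))"
proof (rule Lim_bounded)
  show "(\<lambda>N. ennreal (norm (\<Sum>n<N. a n))) \<longlonglongrightarrow> ennreal (norm s)"
    using assms by (intro tendsto_ennrealI tendsto_norm) (simp add: sums_def)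
  show "\<forall>N\<ge>0. ennreal (norm (\<Sum>n<N. a n)) \<le> (\<Sum>n. ennreal (norm (a n)))"
  proof (intro allI impI)
    fix N
    have "ennreal (norm (\<Sum>n<N. a n)) \<le> ennreal (\<Sum>n<N. norm (a n))" by (intro ennreal_leI norm_sum)
    also have "\<dots> = (\<Sum>n<N. ennreal (norm (a n)))" by simp
    also have "\<dots> \<le> (\<Sum>n. ennreal (norm (a n)))" by (intro sum_le_suminf) auto
    finally show "ennreal (norm (\<Sum>n<N. a n)) \<le> (\<Sum>n. ennreal (norm (a n)))" .
  qed
qed

text \<open>Abel summation for the remainder that starts at the first index of block
  \<open>i\<close>. The boundary term and the total variation of the remaining coefficients are each
  bounded by the same series over the blocks from \<open>i\<close> on, hence the factor 2.\<close>

lemma disc_series_tail_bound: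
  assumes c: "dyadic_bound p c h" and g: "disc_series c g" and z: "norm z < 1"
  shows "ennreal (norm (1 - z)) * ennreal (norm (g z - (\<Sum>n<2 ^ i - 1. c n * z ^ n))) \<le>
    2 * (\<Sum>j. ennreal (2 powr (real (j + i) / p) * h (j + i) / 2 ^ (j + i)))"
proof -
  define N where "N = (2::nat) ^ i - 1"
  define V where "V j = 2 powr (real (j + i) / p) * h (j + i) / 2 ^ (j + i)" for j
  define G where "G = g z - (\<Sum>n<N. c n * z ^ n)"
  have G: "(\<lambda>n. c (n + N) * z ^ (n + N)) sums G"
    unfolding G_def using sums_split_initial_segment[OF disc_seriesD[OF g z]] .
  define t where "t n = (if n = 0 then c N * z ^ N else (c (n + N) - c (n + N - 1)) * z ^ (n + N))" for n
  have "(\<lambda>n. c (Suc n + N) * z ^ (Suc n + N)) sums (G - c N * z ^ N)" using G by (subst sums_Suc_iff) simp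
  moreover have "(\<lambda>n. c (n + N) * z ^ (n + N) * z) sums (G * z)" using G by (rule sums_mult2)
  ultimately have "(\<lambda>n. c (Suc n + N) * z ^ (Suc n + N) - c (n + N) * z ^ (n + N) * z) sums (G - c N * z ^ N - G * z)" by (rule sums_diff)
  moreover have "(\<lambda>n. c (Suc n + N) * z ^ (Suc n + N) - c (n + N) * z ^ (n + N) * z) = (\<lambda>n. t (Suc n))"
    by (simp add: t_def algebra_simps)
  moreover have "t 0 = c N * z ^ N" by (simp add: t_def)
  ultimately have "(\<lambda>n. t (Suc n)) sums ((1 - z) * G - t 0)" by (simp add: algebra_simps)
  then have t: "t sums ((1 - z) * G)" by (subst (asm) sums_Suc_iff) simp
  have "ennreal (norm ((1 - z) * G)) \<le> (\<Sum>n. ennreal (norm (t n)))" by (rule norm_sums_le_ennreal[OF t])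
  also have "\<dots> = (\<Sum>n. ennreal (norm (t (n + 1)))) + ennreal (norm (t 0))"
    by (rule trans[OF suminf_offset[of _ 1]]) auto
  finally have 1: "ennreal (norm ((1 - z) * G)) \<le> (\<Sum>n. ennreal (norm (t (n + 1)))) + ennreal (norm (t 0))" .
  have "ennreal (norm (t 0)) \<le> ennreal (V 0)"
  proof -
    have "N \<in> block i" unfolding block_def N_def by (auto intro!: diff_less_mono)
    then have "norm (c N) \<le> V 0" using dyadic_boundD(2)[OF c, of N i] by (simp add: V_def field_simps)
    moreover have "norm (t 0) \<le> norm (c N)" using z by (simp add: t_def norm_mult norm_power mult_left_le power_le_one)
    ultimately show ?thesis by (intro ennreal_leI) linarith
  qed
  also have "ennreal (V 0) \<le> (\<Sum>j. ennreal (V j))" using sum_le_suminf[of "\<lambda>j. ennreal (V j)" "{0}"] by simp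
  finally have 2: "ennreal (norm (t 0)) \<le> (\<Sum>j. ennreal (V j))" .
  have "(\<Sum>n. ennreal (norm (t (n + 1)))) \<le> (\<Sum>n. ennreal (norm (c (Suc (n + N)) - c (n + N))))"
  proof (intro suminf_le ennreal_leI)
    fix n
    have "norm (t (n + 1)) = norm (c (Suc (n + N)) - c (n + N)) * norm z ^ (n + 1 + N)" by (simp add: t_def norm_mult norm_power)
    also have "\<dots> \<le> norm (c (Suc (n + N)) - c (n + N))" using z by (intro mult_left_le power_le_one) auto
    finally show "norm (t (n + 1)) \<le> norm (c (Suc (n + N)) - c (n + N))" .
  qed auto
  also have "\<dots> = (\<Sum>j. \<Sum>n\<in>block (j + i). ennreal (norm (c (Suc n) - c n)))"
    unfolding N_def by (rule suminf_block_offset[of "\<lambda>n. ennreal (norm (c (Suc n) - c n))"])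
  also have "\<dots> \<le> (\<Sum>j. ennreal (V j))"
  proof (intro suminf_le)
    fix j
    have "(\<Sum>n\<in>block (j + i). norm (c (Suc n) - c n)) \<le> V j"
      using dyadic_boundD(3)[OF c, of "j + i"] by (simp add: V_def field_simps)
    then show "(\<Sum>n\<in>block (j + i). ennreal (norm (c (Suc n) - c n))) \<le> ennreal (V j)"
      by (simp add: sum_ennreal ennreal_leI)
  qed auto
  finally have "ennreal (norm ((1 - z) * G)) \<le> (\<Sum>j. ennreal (V j)) + (\<Sum>j. ennreal (V j))"
    using add_mono[OF _ 2] 1 order_trans by blast
  then have "ennreal (norm ((1 - z) * G)) \<le> 2 * (\<Sum>j. ennreal (V j))" by (simp only: mult_2)
  then show ?thesis by (simp add: norm_mult ennreal_mult G_def N_def V_def)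
qed


text \<open>At a point whose distance to 1 exceeds \<open>2 ^ (- (i + 1))\<close> the series is cut
  before block \<open>i\<close>. The head is estimated by absolute values, the remainder by Abel
  summation at the cost of \<open>2 ^ (i + 1)\<close>. Both give \<open>2 powr (i / p)\<close> times
  a geometric convolution of \<open>h\<close>, with factors 1 and 4, and the p-th power of
  \<open>2 powr (i / p)\<close> cancels the length of the arc.\<close>

lemma dyadic_sufficient_Hardy:
  assumes p: "1 < p"
  shows "dyadic_sufficient p (norm_Hardy p)"
proof -
  \<comment> \<open>The first ratio belongs to the blocks below \<open>i\<close>, where
    \<open>2 powr (j / p)\<close> grows; the second to the blocks above, where
    \<open>2 powr (j / p) / 2 ^ j\<close> decays.\<close>
  define b where "b = max (2 powr - (1 / p)) (2 powr - (1 - 1 / p))"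
  have b: "0 < b" "b < 1" using p by (auto simp: b_def powr_less_one less_max_iff_disj)
  obtain C where C: "C > 0" and conv: "geometric_convolution_bounded b p C"
    using geometric_convolution_bound[OF b p] by blast
  define M where "M = 5 powr p * C"
  have "norm_Hardy p g \<le> ennreal ((M * H) powr (1 / p))"
    if c: "dyadic_bound p c h" and g: "disc_series c g" and H: "0 \<le> H" and hH: "(\<Sum>j. ennreal (h j powr p)) \<le> ennreal H"
    for c h H g
  proof -
    note h = dyadic_boundD(1)[OF c]
    note cv = geometric_convolution_boundedD[OF conv, OF h H hH]
    define x where "x i = (\<Sum>j. b ^ ((i - j) + (j - i)) * h j)" for i
    have x0: "x i \<ge> 0" for i unfolding x_def using b h cv by (intro suminf_nonneg) auto
    have xe: "(\<Sum>j. ennreal (b ^ ((i - j) + (j - i)) * h j)) = ennreal (x i)" for i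
      unfolding x_def using b h cv by (intro suminf_ennreal2) auto
    have hol: "g holomorphic_on ball 0 1" by (rule disc_series_holomorphic[OF g])
    have bound: "norm (g z) \<le> 5 * 2 powr (real i / p) * x i" if z: "norm z < 1" "(1/2) ^ Suc i < norm (1 - z)" for z i
    proof -
      define G where "G = g z - (\<Sum>n<2 ^ i - 1. c n * z ^ n)"
      have 1: "ennreal (norm (\<Sum>n<2 ^ i - 1. c n * z ^ n)) \<le> ennreal (2 powr (real i / p) * x i)"
      proof (rule ennreal_leI)
        have "norm (\<Sum>n<2 ^ i - 1. c n * z ^ n) \<le> (\<Sum>n<2 ^ i - 1. norm (c n * z ^ n))" by (rule norm_sum)
        also have "\<dots> \<le> (\<Sum>n<2 ^ i - 1. norm (c n))"
          using z by (intro sum_mono) (auto simp: norm_mult norm_power intro!: mult_left_le power_le_one)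
        also have "\<dots> = (\<Sum>j<i. \<Sum>n\<in>block j. norm (c n))" by (rule sum_lessThan_block)
        also have "\<dots> \<le> (\<Sum>j<i. 2 powr (real i / p) * (b ^ ((i - j) + (j - i)) * h j))"
        proof (rule sum_mono)
          fix j assume "j \<in> {..<i}"
          then have "2 powr (real j / p) = 2 powr (real i / p) * (2 powr - (1 / p)) ^ (i - j)"
            by (simp add: powr_power of_nat_diff diff_divide_distrib flip: powr_add)
          also have "\<dots> \<le> 2 powr (real i / p) * b ^ (i - j)" by (intro mult_left_mono power_mono) (auto simp: b_def)
          finally have "2 powr (real j / p) * h j \<le> 2 powr (real i / p) * b ^ (i - j) * h j" using h by (intro mult_right_mono) auto
          with dyadic_bound_sum_norm[OF c, of j] show "(\<Sum>n\<in>block j. norm (c n)) \<le> 2 powr (real i / p) * (b ^ ((i - j) + (j - i)) * h j)"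
            using \<open>j \<in> {..<i}\<close> by (simp add: mult.assoc)
        qed
        also have "\<dots> = 2 powr (real i / p) * (\<Sum>j<i. b ^ ((i - j) + (j - i)) * h j)" by (simp only: sum_distrib_left)
        also have "\<dots> \<le> 2 powr (real i / p) * x i"
          unfolding x_def using cv b h by (intro mult_left_mono sum_le_suminf) auto
        finally show "norm (\<Sum>n<2 ^ i - 1. c n * z ^ n) \<le> 2 powr (real i / p) * x i" .
      qed
      have V: "ennreal (2 powr (real (j + i) / p) * h (j + i) / 2 ^ (j + i)) \<le> ennreal (2 powr (real i / p) / 2 ^ i) * ennreal (b ^ ((i - (j + i)) + ((j + i) - i)) * h (j + i))" for j
      proof -
        have "2 powr (real (j + i) / p) / 2 ^ (j + i) = 2 powr (real i / p) / 2 ^ i * (2 powr - (1 - 1 / p)) ^ j"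
          by (simp add: powr_power power_add add_divide_distrib powr_add powr_diff powr_minus field_simps powr_realpow algebra_simps)
        also have "\<dots> \<le> 2 powr (real i / p) / 2 ^ i * b ^ j" by (intro mult_left_mono power_mono) (auto simp: b_def)
        finally have "2 powr (real (j + i) / p) / 2 ^ (j + i) * h (j + i) \<le> 2 powr (real i / p) / 2 ^ i * b ^ j * h (j + i)"
          using h by (intro mult_right_mono) auto
        then show ?thesis using b h by (simp add: ennreal_leI mult.assoc flip: ennreal_mult)
      qed
      have "ennreal (norm (1 - z)) * ennreal (norm G) \<le> 2 * (\<Sum>j. ennreal (2 powr (real (j + i) / p) * h (j + i) / 2 ^ (j + i)))"
        unfolding G_def by (rule disc_series_tail_bound[OF c g z(1)])
      also have "\<dots> \<le> 2 * (\<Sum>j. ennreal (2 powr (real i / p) / 2 ^ i) * ennreal (b ^ ((i - (j + i)) + ((j + i) - i)) * h (j + i)))"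
        by (intro mult_left_mono suminf_le V) auto
      also have "\<dots> = 2 * (ennreal (2 powr (real i / p) / 2 ^ i) * (\<Sum>j. ennreal (b ^ ((i - (j + i)) + ((j + i) - i)) * h (j + i))))"
        by (subst ennreal_suminf_cmult) simp
      also have "\<dots> \<le> 2 * (ennreal (2 powr (real i / p) / 2 ^ i) * ennreal (x i))"
        unfolding xe[symmetric]
        by (intro mult_left_mono) (subst (2) suminf_offset[of _ i], auto simp: add_increasing2)
      also have "\<dots> = ennreal (2 * (2 powr (real i / p) / 2 ^ i * x i))"
        using x0[of i] by (simp flip: ennreal_mult ennreal_numeral)
      finally have "ennreal (norm (1 - z) * norm G) \<le> ennreal (2 * (2 powr (real i / p) / 2 ^ i * x i))"
        by (simp add: ennreal_mult)
      then have "norm (1 - z) * norm G \<le> 2 * (2 powr (real i / p) / 2 ^ i * x i)"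
        using x0[of i] by (subst (asm) ennreal_le_iff) auto
      moreover have "(1/2) ^ Suc i * norm G \<le> norm (1 - z) * norm G" using z by (intro mult_right_mono) auto
      ultimately have "(1/2) ^ Suc i * norm G \<le> 2 * (2 powr (real i / p) / 2 ^ i * x i)" by linarith
      then have "norm G \<le> 4 * (2 powr (real i / p) * x i)" by (simp add: power_divide field_simps)
      moreover have "norm (\<Sum>n<2 ^ i - 1. c n * z ^ n) \<le> 2 powr (real i / p) * x i"
        using 1 x0[of i] by (subst (asm) ennreal_le_iff) auto
      moreover have "norm (g z) \<le> norm G + norm (\<Sum>n<2 ^ i - 1. c n * z ^ n)"
        unfolding G_def using norm_triangle_ineq[of "g z - (\<Sum>n<2 ^ i - 1. c n * z ^ n)" "\<Sum>n<2 ^ i - 1. c n * z ^ n"] by simp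
      ultimately show ?thesis by linarith
    qed
    have "ennreal (mean_p p r g) \<le> ennreal ((M * H) powr (1 / p))" if r: "r \<in> {0<..<1}" for r
    proof (rule ennreal_leI)
      have "ennreal (2 * pi * mean_p p r g powr p) = (circle_integral (\<lambda>t. ennreal (norm (g (of_real r * cis t)) powr p)))"
        using p r by (intro mean_p_powr[symmetric] hol) auto
      also have "\<dots> \<le> ennreal (2 * pi) * (\<Sum>i. ennreal ((1/2) ^ Suc i) * ennreal ((5 * 2 powr (real i / p) * x i) powr p))"
      proof (intro nn_integral_angle_dyad_le ennreal_leI powr_mono2)
        fix i t assume t: "t \<in> {0..2*pi}" "(1/2) ^ Suc i < angle_dist t"
        then have "(1/2) ^ Suc i < norm (1 - of_real r * cis t)"
          using norm_one_minus_rcis_ge(1)[of r t] r by auto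
        then show "norm (g (of_real r * cis t)) \<le> 5 * 2 powr (real i / p) * x i"
          using r by (intro bound) (auto simp: norm_mult)
      qed (use p in auto)
      also have "(\<Sum>i. ennreal ((1/2) ^ Suc i) * ennreal ((5 * 2 powr (real i / p) * x i) powr p)) \<le> (\<Sum>i. ennreal (5 powr p) * ennreal (x i powr p))"
      proof (intro suminf_le)
        fix i
        have "(1/2) ^ Suc i * (5 * 2 powr (real i / p) * x i) powr p = (1/2) * (5 powr p * x i powr p)"
          using p by (simp add: powr_mult powr_powr powr_realpow power_divide)
        also have "\<dots> \<le> 5 powr p * x i powr p" by simp
        finally show "ennreal ((1/2) ^ Suc i) * ennreal ((5 * 2 powr (real i / p) * x i) powr p) \<le> ennreal (5 powr p) * ennreal (x i powr p)"
          by (simp flip: ennreal_mult'')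
      qed auto
      also have "\<dots> = ennreal (5 powr p) * (\<Sum>i. ennreal (x i powr p))" by (rule ennreal_suminf_cmult)
      also have "\<dots> \<le> ennreal (5 powr p) * ennreal (C * H)" using cv by (intro mult_left_mono) (auto simp: x_def)
      finally have "ennreal (2 * pi * mean_p p r g powr p) \<le> ennreal (2 * pi) * (ennreal (5 powr p) * ennreal (C * H))"
        by (simp add: mult_left_mono)
      also have "\<dots> = ennreal (2 * pi * (M * H))" using C H by (simp add: M_def mult_ac flip: ennreal_mult)
      finally have "mean_p p r g powr p \<le> M * H" using C H by (simp add: M_def ennreal_le_iff)
      then have "(mean_p p r g powr p) powr (1/p) \<le> (M * H) powr (1/p)" using p by (intro powr_mono2) auto
      then show "mean_p p r g \<le> (M * H) powr (1/p)" using p by (simp add: powr_powr mean_p_def)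
    qed
    then show ?thesis unfolding norm_Hardy_def by (intro SUP_least)
  qed
  moreover have "M > 0" using C by (simp add: M_def)
  ultimately show ?thesis unfolding dyadic_sufficient_def by blast
qed

section \<open>Tails and moments of a radial weight\<close>

locale radial =
  fixes \<omega> :: "real \<Rightarrow> real"
  assumes radial_weight: "radial_weight \<omega>"
begin

text \<open>Values of \<omega> outside [0,1) are arbitrary; extension by zero turns all integrals
  into integrals over the line.\<close>

definition wt :: "real \<Rightarrow> real" where "wt t = indicator {0..<1} t * \<omega> t"

lemma wt_eq: "t \<in> {0..<1} \<Longrightarrow> wt t = \<omega> t" and wt_outside: "t \<notin> {0..<1} \<Longrightarrow> wt t = 0"
  by (auto simp: wt_def)

lemma wt_nonneg: "0 \<le> wt t"
  using radial_weight by (auto simp: wt_def radial_weight_def indicator_def)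

lemma integrable_wt: "integrable lebesgue wt"
  using radial_weight unfolding radial_weight_def wt_def[abs_def] by (simp add: integrable_restrict_space)

lemma wt_measurable [measurable]: "wt \<in> borel_measurable lebesgue"
  using integrable_wt by (rule borel_measurable_integrable)

lemma power_measurable [measurable]: "(\<lambda>t::real. t ^ n) \<in> borel_measurable lebesgue"
  by (intro measurable_completion) measurable

lemma interval_measurable [measurable]: "{a..<b::real} \<in> sets lebesgue"
  by simp

lemma integrable_power_wt: "integrable lebesgue (\<lambda>t. t ^ n * wt t)"
proof (rule Bochner_Integration.integrable_bound[OF integrable_wt])
  show "AE t in lebesgue. norm (t ^ n * wt t) \<le> norm (wt t)"
  proof (rule AE_I2)
    fix t show "norm (t ^ n * wt t) \<le> norm (wt t)"
      by (cases "t \<in> {0..<1}") (auto simp: wt_outside abs_mult power_le_one intro!: mult_left_le_one_le)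
  qed
qed measurable

lemma integrable_wt_indicator: "integrable lebesgue (\<lambda>t. wt t * indicator {r..<s} t)"
  by (rule Bochner_Integration.integrable_bound[OF integrable_wt]) (measurable, auto simp: indicator_def)

lemma tail_eq:
  assumes "0 \<le> r"
  shows "tail \<omega> r = (\<integral>t. wt t * indicator {r..<1} t \<partial>lebesgue)"
proof -
  have "tail \<omega> r = (\<integral>t. indicator {r..<1} t *\<^sub>R \<omega> t \<partial>lebesgue)"
    unfolding tail_def by (subst integral_restrict_space) auto
  also have "(\<lambda>t. indicator {r..<1} t *\<^sub>R \<omega> t) = (\<lambda>t. wt t * indicator {r..<1} t)"
    using assms by (auto simp: wt_def indicator_def)
  finally show ?thesis .
qed

text \<open>The two integrands differ at \<open>t = 0\<close> if \<open>n = 0\<close>, as \<open>0 powr 0 = 0\<close>.\<close>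

lemma moment_eq: "moment \<omega> (real n) = (\<integral>t. t ^ n * wt t \<partial>lebesgue)"
proof -
  have "moment \<omega> (real n) = (\<integral>t. indicator {0..<1} t *\<^sub>R (t powr real n * \<omega> t) \<partial>lebesgue)"
    unfolding moment_def by (subst integral_restrict_space) auto
  also have "\<dots> = (\<integral>t. t ^ n * wt t \<partial>lebesgue)"
  proof (rule integral_cong_AE)
    have "AE t in lebesgue. (t::real) \<noteq> 0"
      by (rule AE_completion) (rule AE_lborel_singleton)
    then show "AE t in lebesgue. indicator {0..<1} t *\<^sub>R (t powr real n * \<omega> t) = t ^ n * wt t"
      by eventually_elim (auto simp: wt_def indicator_def powr_realpow)
    have "(\<lambda>t. t powr real n * wt t) \<in> borel_measurable lebesgue"
      by (intro borel_measurable_times wt_measurable measurable_completion) measurable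
    also have "(\<lambda>t. t powr real n * wt t) = (\<lambda>t. indicator {0..<1} t *\<^sub>R (t powr real n * \<omega> t))"
      by (auto simp: wt_def)
    finally show "(\<lambda>t. indicator {0..<1} t *\<^sub>R (t powr real n * \<omega> t)) \<in> borel_measurable lebesgue" .
  qed measurable
  finally show ?thesis .
qed

lemma tail_pos: "0 \<le> r \<Longrightarrow> r < 1 \<Longrightarrow> 0 < tail \<omega> r"
  using radial_weight by (auto simp: radial_weight_def)

lemma tail_antimono: "0 \<le> r \<Longrightarrow> r \<le> s \<Longrightarrow> tail \<omega> s \<le> tail \<omega> r"
  by (simp add: tail_eq) (intro integral_mono integrable_wt_indicator mult_left_mono wt_nonneg, auto simp: indicator_def)

lemma tail_diff:
  assumes "0 \<le> r" "r \<le> s" "s \<le> 1"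
  shows "tail \<omega> r - tail \<omega> s = (\<integral>t. wt t * indicator {r..<s} t \<partial>lebesgue)"
proof -
  have "tail \<omega> r - tail \<omega> s = (\<integral>t. wt t * indicator {r..<1} t - wt t * indicator {s..<1} t \<partial>lebesgue)"
    using assms by (simp add: tail_eq integrable_wt_indicator)
  also have "(\<lambda>t. wt t * indicator {r..<1} t - wt t * indicator {s..<1} t) = (\<lambda>t. wt t * indicator {r..<s} t)"
    using assms by (auto simp: indicator_def fun_eq_iff)
  finally show ?thesis .
qed

section \<open>Comparison of moments with tails\<close>

abbreviation mom :: "nat \<Rightarrow> real" where "mom n \<equiv> moment \<omega> (real n)"

lemma mom_antimono: "m \<le> n \<Longrightarrow> mom n \<le> mom m"
  unfolding moment_eq
proof (intro integral_mono integrable_power_wt)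
  fix t assume "m \<le> n"
  then show "t ^ n * wt t \<le> t ^ m * wt t"
    by (cases "t \<in> {0..<1}") (auto simp: wt_outside intro!: mult_right_mono power_decreasing wt_nonneg)
qed

lemma mom_ge: 
  assumes "0 \<le> r"
  shows "r ^ n * tail \<omega> r \<le> mom n"
proof -
  have "r ^ n * tail \<omega> r = (\<integral>t. r ^ n * (wt t * indicator {r..<1} t) \<partial>lebesgue)" using assms by (simp add: tail_eq)
  also have "\<dots> \<le> mom n"
    unfolding moment_eq
  proof (intro integral_mono integrable_power_wt integrable_mult_right integrable_wt_indicator)
    fix t show "r ^ n * (wt t * indicator {r..<1} t) \<le> t ^ n * wt t"
      using assms wt_nonneg[of t]
      by (cases "t \<in> {0..<1}") (auto simp: wt_outside indicator_def intro!: mult_right_mono power_mono)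
  qed
  finally show ?thesis .
qed

lemma mom_pos: "0 < mom n"
  using mom_ge[of "1/2" n] tail_pos[of "1/2"] by (auto intro: less_le_trans[of _ "(1/2) ^ n * tail \<omega> (1/2)"])

text \<open>Beyond \<open>r\<close> the power is at most 1, and before \<open>r\<close> the factor
  \<open>t ^ m\<close> is at most \<open>r ^ m\<close>. With \<open>m = n\<close> large this lets a
  tail dominate a moment.\<close>

lemma mom_add_le:
  assumes "0 \<le> r"
  shows "mom (m + n) \<le> tail \<omega> r + r ^ m * mom n"
proof -
  have "mom (m + n) \<le> (\<integral>t. wt t * indicator {r..<1} t + r ^ m * (t ^ n * wt t) \<partial>lebesgue)"
    unfolding moment_eq
  proof (intro integral_mono integrable_power_wt Bochner_Integration.integrable_add integrable_mult_right integrable_wt_indicator)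
    fix t show "t ^ (m + n) * wt t \<le> wt t * indicator {r..<1} t + r ^ m * (t ^ n * wt t)"
    proof (cases "t \<in> {0..<1}")
      case True
      show ?thesis
      proof (cases "r \<le> t")
        case r: True
        have "t ^ (m + n) * wt t \<le> 1 * wt t" using True by (intro mult_right_mono power_le_one wt_nonneg) auto
        also have "\<dots> \<le> wt t * indicator {r..<1} t + r ^ m * (t ^ n * wt t)"
          using True r assms wt_nonneg[of t] by simp
        finally show ?thesis .
      next
        case False
        have "t ^ m * (t ^ n * wt t) \<le> r ^ m * (t ^ n * wt t)"
          using True False wt_nonneg[of t] by (intro mult_right_mono power_mono) auto
        then show ?thesis using False by (simp add: power_add mult.assoc)
      qed
    qed (simp add: wt_outside)
  qed
  then show ?thesis
    using assms by (simp add: tail_eq moment_eq integrable_wt_indicator integrable_power_wt)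
qed

text \<open>The mass of a dyadic interval is bounded by the whole tail from its left end, so that
  the right-hand side involves tails only.\<close>

lemma mom_dyadic_le:
  "mom n \<le> tail \<omega> (dyad j) + (\<Sum>k<j. dyad (Suc k) ^ n * tail \<omega> (dyad k))"
proof -
  have "mom n \<le> (\<integral>t. wt t * indicator {dyad j..<1} t + (\<Sum>k<j. dyad (Suc k) ^ n * (wt t * indicator {dyad k..<1} t)) \<partial>lebesgue)"
    unfolding moment_eq
  proof (intro integral_mono integrable_power_wt Bochner_Integration.integrable_add Bochner_Integration.integrable_sum integrable_mult_right integrable_wt_indicator)
    fix t
    have nn: "0 \<le> (\<Sum>k<j. dyad (Suc k) ^ n * (wt t * indicator {dyad k..<1} t))"
      by (intro sum_nonneg mult_nonneg_nonneg wt_nonneg zero_le_power dyad_nonneg) auto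
    show "t ^ n * wt t \<le> wt t * indicator {dyad j..<1} t + (\<Sum>k<j. dyad (Suc k) ^ n * (wt t * indicator {dyad k..<1} t))"
    proof (cases "t \<in> {0..<1}")
      case True
      show ?thesis
      proof (cases "dyad j \<le> t")
        case False
        obtain k where k: "t \<in> dyad_interval k" using dyad_interval_exists True by auto
        have "k < j"
        proof (rule ccontr)
          assume "\<not> k < j"
          then have "dyad j \<le> dyad k" by (intro dyad_mono) auto
          then show False using k False by (auto simp: dyad_interval_def)
        qed
        have "t ^ n * wt t \<le> dyad (Suc k) ^ n * (wt t * indicator {dyad k..<1} t)"
          using k True by (auto simp: dyad_interval_def intro!: mult_right_mono power_mono wt_nonneg)
        also have "\<dots> = (\<Sum>k\<in>{k}. dyad (Suc k) ^ n * (wt t * indicator {dyad k..<1} t))" by simp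
        also have "\<dots> \<le> (\<Sum>k<j. dyad (Suc k) ^ n * (wt t * indicator {dyad k..<1} t))"
          using \<open>k < j\<close> by (intro sum_mono2) (auto intro!: mult_nonneg_nonneg wt_nonneg zero_le_power dyad_nonneg)
        finally show ?thesis using False by simp
      next
        case True': True
        have "t ^ n * wt t \<le> 1 * wt t" using True by (intro mult_right_mono power_le_one wt_nonneg) auto
        then show ?thesis using nn True True' by simp
      qed
    qed (use nn in \<open>simp add: wt_outside\<close>)
  qed
  also have "\<dots> = tail \<omega> (dyad j) + (\<Sum>k<j. dyad (Suc k) ^ n * tail \<omega> (dyad k))"
    by (subst Bochner_Integration.integral_add)
       (auto simp: tail_eq dyad_nonneg integrable_wt_indicator Bochner_Integration.integral_sum intro!: Bochner_Integration.integrable_sum integrable_mult_right integrable_wt_indicator)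
  finally show ?thesis .
qed

section \<open>Doubling at dyadic points\<close>

definition doubling :: "real \<Rightarrow> bool" where
  "doubling C \<longleftrightarrow> 1 \<le> C \<and> (\<forall>k. tail \<omega> (dyad k) \<le> C * tail \<omega> (dyad (Suc k)))"

lemma dyad_tail_pos: "0 < tail \<omega> (dyad k)"
  by (intro tail_pos dyad_nonneg dyad_less_1)

lemma D_hat_iff_doubling: "\<omega> \<in> D_hat \<longleftrightarrow> (\<exists>C. doubling C)"
proof
  assume "\<omega> \<in> D_hat"
  then obtain C where C: "C > 1" "\<forall>r\<in>{0..<1}. tail \<omega> r \<le> C * tail \<omega> ((1 + r) / 2)" by (auto simp: D_hat_def)
  have "(1 + dyad k) / 2 = dyad (Suc k)" for k by (simp add: dyad_def field_simps)
  then have "tail \<omega> (dyad k) \<le> C * tail \<omega> (dyad (Suc k))" for k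
    using C(2)[rule_format, of "dyad k"] dyad_nonneg[of k] dyad_less_1[of k] by simp
  then show "\<exists>C. doubling C" using C by (auto simp: doubling_def intro!: exI[of _ C])
next
  assume "\<exists>C. doubling C"
  then obtain C where C: "1 \<le> C" "\<And>k. tail \<omega> (dyad k) \<le> C * tail \<omega> (dyad (Suc k))" by (auto simp: doubling_def)
  \<comment> \<open>From \<open>r\<close> in dyadic interval \<open>k\<close>, the point
    \<open>(1 + r) / 2\<close> lies at most two dyadic steps beyond \<open>dyad k\<close>, which
    costs \<open>C * C\<close>; the added 1 makes the constant exceed 1, as \<open>D_hat\<close>
    requires.\<close>
  have "tail \<omega> r \<le> (C * C + 1) * tail \<omega> ((1 + r) / 2)" if r: "r \<in> {0..<1}" for r
  proof -
    obtain k where k: "r \<in> dyad_interval k" using dyad_interval_exists r by auto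
    have le: "(1 + r) / 2 \<le> dyad (Suc (Suc k))" using k by (auto simp: dyad_interval_def dyad_def)
    have "tail \<omega> r \<le> tail \<omega> (dyad k)" using k by (intro tail_antimono dyad_nonneg) (auto simp: dyad_interval_def)
    also have "\<dots> \<le> C * tail \<omega> (dyad (Suc k))" by (rule C)
    also have "\<dots> \<le> C * (C * tail \<omega> (dyad (Suc (Suc k))))" using C(1) by (intro mult_left_mono C(2)) auto
    also have "\<dots> \<le> C * (C * tail \<omega> ((1 + r) / 2))" using C(1) r le by (intro mult_left_mono tail_antimono) auto
    also have "\<dots> \<le> (C * C + 1) * tail \<omega> ((1 + r) / 2)"
      using tail_pos[of "(1 + r) / 2"] r by (simp add: algebra_simps)
    finally show ?thesis .
  qed
  moreover have "C * C + 1 > 1" using C(1) by simp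
  ultimately show "\<omega> \<in> D_hat" unfolding D_hat_def by blast
qed

lemma doubling_iterate:
  assumes "doubling C"
  shows "tail \<omega> (dyad k) \<le> C ^ m * tail \<omega> (dyad (k + m))"
proof (induction m)
  case (Suc m)
  have C: "1 \<le> C" using assms by (simp add: doubling_def)
  note Suc
  also have "C ^ m * tail \<omega> (dyad (k + m)) \<le> C ^ m * (C * tail \<omega> (dyad (Suc (k + m))))"
    using assms C by (intro mult_left_mono) (auto simp: doubling_def)
  finally show ?case by (simp add: mult_ac)
qed simp

text \<open>Interval \<open>k\<close> below \<open>j\<close> contributes at most
  \<open>C ^ (j - k) * exp (- (2 ^ (j - k)) / 2)\<close> times the tail at \<open>dyad j\<close>, up
  to the factor \<open>exp 1\<close>. The exponential beats the doubling constant, so the sum over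
  \<open>k\<close> stays bounded.\<close>

lemma mom_le_tail:
  assumes "doubling C"
  obtains K where "K > 0" "\<And>n j. 2 ^ j \<le> Suc n \<Longrightarrow> mom n \<le> K * tail \<omega> (dyad j)"
proof -
  have C: "1 \<le> C" using assms by (simp add: doubling_def)
  obtain D where D: "D > 0" "\<And>m::nat. C ^ m * exp (- ((1/2) * 2 ^ m)) \<le> D * (1/2) ^ m"
    using superexponential_decay[of C "1/2"] C by auto
  have "mom n \<le> (1 + exp 1 * D) * tail \<omega> (dyad j)" if n: "2 ^ j \<le> Suc n" for n j
  proof -
    have t: "dyad (Suc k) ^ n * tail \<omega> (dyad k) \<le> exp 1 * D * tail \<omega> (dyad j) * (1/2) ^ (j - k)" if k: "k < j" for k
    proof -
      have "dyad (Suc k) ^ n \<le> exp 1 * exp (- (2 ^ j / 2 ^ Suc k))"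
        by (rule power_le_exp_dyad[OF dyad_nonneg order_refl n])
      also have "(2::real) ^ j / 2 ^ Suc k = (1/2) * 2 ^ (j - k)" using k by (simp add: power_diff)
      finally have "dyad (Suc k) ^ n * tail \<omega> (dyad k) \<le> (exp 1 * exp (- ((1/2) * 2 ^ (j - k)))) * (C ^ (j - k) * tail \<omega> (dyad j))"
        using doubling_iterate[OF assms, of k "j - k"] k dyad_tail_pos[of k] by (intro mult_mono) auto
      also have "\<dots> = exp 1 * tail \<omega> (dyad j) * (C ^ (j - k) * exp (- ((1/2) * 2 ^ (j - k))))" by (simp add: mult_ac)
      also have "\<dots> \<le> exp 1 * tail \<omega> (dyad j) * (D * (1/2) ^ (j - k))"
        using dyad_tail_pos[of j] by (intro mult_left_mono D) auto
      finally show ?thesis by (simp add: mult_ac)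
    qed
    have "(\<Sum>k<j. dyad (Suc k) ^ n * tail \<omega> (dyad k)) \<le> (\<Sum>k<j. exp 1 * D * tail \<omega> (dyad j) * (1/2) ^ (j - k))"
      using t by (intro sum_mono) auto
    also have "\<dots> = exp 1 * D * tail \<omega> (dyad j) * (\<Sum>k<j. (1/2) ^ (j - k))" by (simp only: sum_distrib_left)
    also have "(\<Sum>k<j. (1/2::real) ^ (j - k)) = (\<Sum>k<j. (1/2) ^ Suc k)"
      using sum.nat_diff_reindex[of "\<lambda>j. (1/2::real) ^ Suc j" j] by (simp add: Suc_diff_Suc del: power_Suc)
    also have "\<dots> \<le> 1"
    proof -
      have "(\<Sum>k<j. (1/2::real) ^ Suc k) = 1 - (1/2) ^ j" by (induction j) auto
      then show ?thesis by simp
    qed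
    finally have "(\<Sum>k<j. dyad (Suc k) ^ n * tail \<omega> (dyad k)) \<le> exp 1 * D * tail \<omega> (dyad j)"
      using D(1) dyad_tail_pos[of j] by (simp add: mult_left_mono)
    then show ?thesis using mom_dyadic_le[of n j] by (simp add: algebra_simps)
  qed
  moreover have "1 + exp 1 * D > 0" using D by (simp add: add_pos_nonneg)
  ultimately show thesis using that by blast
qed

text \<open>At \<open>dyad (Suc j)\<close> the power \<open>n \<le> 4 * 2 ^ j\<close> is still at
  least \<open>exp (- 4)\<close>. One step beyond \<open>dyad j\<close> is taken so that
  \<open>x \<le> 1 / 2\<close> holds also for \<open>j = 0\<close>; doubling pays for it.\<close>

lemma tail_le_mom:
  assumes "doubling C" "n \<le> 4 * 2 ^ j"
  shows "tail \<omega> (dyad j) \<le> C * exp 4 * mom n"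
proof -
  have C: "1 \<le> C" using assms by (simp add: doubling_def)
  define x where "x = (1/2::real) ^ Suc j"
  have x: "0 \<le> x" "x \<le> 1/2" by (auto simp: x_def power_le_one)
  have n: "real n \<le> 4 * 2 ^ j" using assms(2) by (simp only: of_nat_le_iff[symmetric, where 'a=real]) simp
  have "2 * x * real n \<le> 2 * x * (4 * 2 ^ j)" using n x by (intro mult_left_mono) auto
  also have "\<dots> = 4" by (simp add: x_def power_divide)
  finally have "exp (- 4) \<le> exp (- (2 * x * real n))" by simp
  also have "\<dots> \<le> (1 - x) ^ n" by (rule one_minus_power_ge[OF x])
  finally have e: "1 \<le> exp 4 * dyad (Suc j) ^ n" by (simp add: dyad_def x_def exp_minus field_simps)
  have "tail \<omega> (dyad j) \<le> C * tail \<omega> (dyad (Suc j))" using assms by (simp add: doubling_def)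
  also have "\<dots> \<le> C * ((exp 4 * dyad (Suc j) ^ n) * tail \<omega> (dyad (Suc j)))"
    using C e dyad_tail_pos[of "Suc j"] mult_right_mono[OF e, of "tail \<omega> (dyad (Suc j))"] by (intro mult_left_mono) auto
  also have "\<dots> = C * exp 4 * (dyad (Suc j) ^ n * tail \<omega> (dyad (Suc j)))" by (simp add: mult_ac)
  also have "\<dots> \<le> C * exp 4 * mom n" using C by (intro mult_left_mono mom_ge dyad_nonneg) auto
  finally show ?thesis .
qed

text \<open>Doubling of the moments gives back doubling of the tails: a moment of high order is
  dominated by a tail, because the contribution from before the cut can be absorbed, while one of
  lower order dominates an earlier tail. The numbers 18 and 36 are those that testing with powers
  delivers.\<close>

lemma doubling_of_mom:
  assumes D: "0 < D" "\<And>m. 0 < m \<Longrightarrow> mom (18 * m) \<le> D * mom (36 * m)"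
  shows "\<exists>C. doubling C"
proof -
  obtain l :: nat where l: "2 * D < 2 ^ l" using real_arch_pow[of 2 "2 * D"] by auto
  have key: "tail \<omega> (dyad k) \<le> exp 36 * D ^ (l + 1) * 2 * tail \<omega> (dyad (Suc k))" if k: "0 < k" for k
  proof -
    have it: "mom (18 * 2 ^ k) \<le> D ^ m * mom (18 * 2 ^ (k + m))" for m
    proof (induction m)
      case (Suc m)
      note Suc
      also have "mom (18 * 2 ^ (k + m)) \<le> D * mom (18 * 2 ^ (k + Suc m))" using D(2)[of "2 ^ (k + m)"] by (simp add: mult_ac)
      finally show ?case using D by (simp add: mult_ac mult_left_mono)
    qed simp
    \<comment> \<open>The order is so large that \<open>dyad (Suc k) ^ n \<le> 1 / (2 * D)\<close>.
      Then the second summand of \<open>mom_add_le\<close> is at most half of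
      \<open>mom (n + n)\<close> and moves to the left.\<close>
    define n where "n = 18 * (2::nat) ^ (k + l)"
    have "mom (n + n) \<le> tail \<omega> (dyad (Suc k)) + dyad (Suc k) ^ n * mom n" by (intro mom_add_le dyad_nonneg)
    also have "dyad (Suc k) ^ n * mom n \<le> (1 / (2 * D)) * (D * mom (n + n))"
    proof (rule mult_mono)
      define y where "y = (1/2::real) ^ Suc k"
      have "dyad (Suc k) ^ n \<le> exp (- y) ^ n"
        using exp_ge_add_one_self[of "- y"] dyad_nonneg[of "Suc k"] by (intro power_mono) (auto simp: dyad_def y_def)
      also have "\<dots> = exp (- (9 * 2 ^ l))" by (simp add: n_def y_def power_add power_divide flip: exp_of_nat_mult)
      also have "\<dots> \<le> 1 / (2 * D)"
      proof -
        have "2 * D \<le> 9 * 2 ^ l" using l zero_less_power[of "2::real" l] by linarith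
        also have "\<dots> \<le> exp (9 * 2 ^ l)" using exp_ge_add_one_self[of "9 * 2 ^ l :: real"] by linarith
        finally show ?thesis using D by (simp add: exp_minus field_simps)
      qed
      finally show "dyad (Suc k) ^ n \<le> 1 / (2 * D)" .
      show "mom n \<le> D * mom (n + n)" using D(2)[of "2 ^ (k + l)"] by (simp add: n_def)
    qed (use D mom_pos in \<open>auto intro: less_imp_le\<close>)
    finally have "mom (n + n) \<le> 2 * tail \<omega> (dyad (Suc k))" using D by simp
    moreover have "n + n = 18 * 2 ^ (k + (l + 1))" by (simp add: n_def)
    ultimately have up: "mom (18 * 2 ^ (k + (l + 1))) \<le> 2 * tail \<omega> (dyad (Suc k))" by metis
    \<comment> \<open>The lower bound for the power requires \<open>x \<le> 1 / 2\<close>, hence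
      \<open>k > 0\<close>; the exponent 36 is \<open>2 * x * (18 * 2 ^ k)\<close>.\<close>
    define x where "x = (1/2::real) ^ k"
    have x: "0 \<le> x" "x \<le> 1/2"
      using k power_decreasing[of 1 k "1/2::real"] by (auto simp: x_def)
    have "2 * x * real (18 * 2 ^ k) = 36" by (simp add: x_def power_divide)
    then have "exp (- 36) \<le> (1 - x) ^ (18 * 2 ^ k)" using one_minus_power_ge[OF x, of "18 * 2 ^ k"] by simp
    then have "exp (- 36) * tail \<omega> (dyad k) \<le> dyad k ^ (18 * 2 ^ k) * tail \<omega> (dyad k)"
      using dyad_tail_pos[of k] by (intro mult_right_mono) (auto simp: x_def dyad_def)
    also have "\<dots> \<le> mom (18 * 2 ^ k)" by (intro mom_ge dyad_nonneg)
    also have "\<dots> \<le> D ^ (l + 1) * mom (18 * 2 ^ (k + (l + 1)))" by (rule it)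
    also have "\<dots> \<le> D ^ (l + 1) * (2 * tail \<omega> (dyad (Suc k)))" using D up by (intro mult_left_mono) auto
    finally have "exp (- 36) * tail \<omega> (dyad k) \<le> D ^ (l + 1) * (2 * tail \<omega> (dyad (Suc k)))" .
    then show ?thesis by (simp add: exp_minus field_simps)
  qed
  \<comment> \<open>The single step from \<open>dyad 0\<close>, not covered by \<open>key\<close>,
    is paid for by the actual ratio of the two tails.\<close>
  define C0 where "C0 = tail \<omega> (dyad 0) / tail \<omega> (dyad (Suc 0))"
  define C where "C = max (max 1 C0) (exp 36 * D ^ (l + 1) * 2)"
  have "tail \<omega> (dyad k) \<le> C * tail \<omega> (dyad (Suc k))" for k
  proof (cases "k = 0")
    case True
    have "tail \<omega> (dyad 0) = C0 * tail \<omega> (dyad (Suc 0))" using dyad_tail_pos[of "Suc 0"] by (simp add: C0_def)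
    also have "\<dots> \<le> C * tail \<omega> (dyad (Suc 0))" using dyad_tail_pos[of "Suc 0"] by (intro mult_right_mono) (auto simp: C_def)
    finally show ?thesis using True by simp
  next
    case False
    have "tail \<omega> (dyad k) \<le> exp 36 * D ^ (l + 1) * 2 * tail \<omega> (dyad (Suc k))" using False by (intro key) auto
    also have "\<dots> \<le> C * tail \<omega> (dyad (Suc k))" using dyad_tail_pos[of "Suc k"] by (intro mult_right_mono) (auto simp: C_def)
    finally show ?thesis .
  qed
  moreover have "1 \<le> C" by (simp add: C_def)
  ultimately show ?thesis by (auto simp: doubling_def)
qed

end

section \<open>The Muckenhoupt-type condition as a reverse Hoelder inequality\<close>

lemma powr_lt_1: "0 < x \<Longrightarrow> x < 1 \<Longrightarrow> 0 < a \<Longrightarrow> x powr a < (1::real)"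
  using powr_less_mono2[of a x 1] by simp

text \<open>A contraction over \<open>L\<close> steps spread evenly: \<open>b\<close> is the L-th
  root of \<open>c\<close>. The remainder of \<open>m\<close> modulo \<open>L\<close> is left to
  monotonicity and costs the factor \<open>1 / c\<close>.\<close>

lemma geometric_decay:
  fixes f :: "nat \<Rightarrow> real"
  assumes mono: "\<And>m n. m \<le> n \<Longrightarrow> f n \<le> f m" and f0: "\<And>n. 0 \<le> f n"
    and L: "0 < L" and c: "0 < c" "c < 1" and step: "\<And>k. f (k + L) \<le> c * f k"
  obtains b C where "0 < b" "b < 1" "0 < C" "\<And>k m. f (k + m) \<le> C * b ^ m * f k"
proof -
  define b where "b = c powr (1 / real L)"
  have b: "0 < b" "b < 1" using c L by (auto simp: b_def powr_lt_1)
  have bL: "b ^ L = c" using L c by (simp add: b_def powr_power powr_one)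
  have it: "f (k + n * L) \<le> c ^ n * f k" for k n
  proof (induction n)
    case (Suc n)
    have "f (k + Suc n * L) = f ((k + n * L) + L)" by (simp add: algebra_simps)
    also have "\<dots> \<le> c * f (k + n * L)" by (rule step)
    also have "\<dots> \<le> c * (c ^ n * f k)" using c Suc by (intro mult_left_mono) auto
    finally show ?case by simp
  qed simp
  have "f (k + m) \<le> (1 / c) * b ^ m * f k" for k m
  proof -
    define n where "n = m div L"
    have "m < (n + 1) * L" using L dividend_less_div_times[of L m] by (simp add: n_def algebra_simps)
    then have "b ^ ((n + 1) * L) \<le> b ^ m" using b by (intro power_decreasing) auto
    also have "b ^ ((n + 1) * L) = c ^ (n + 1)" unfolding bL[symmetric] power_mult[symmetric] by (simp only: mult.commute)
    finally have "c ^ (n + 1) \<le> b ^ m" .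
    then have le: "c ^ n \<le> (1 / c) * b ^ m" using c by (simp add: field_simps)
    have "f (k + m) \<le> f (k + n * L)" by (intro mono) (simp add: n_def)
    also have "\<dots> \<le> c ^ n * f k" by (rule it)
    also have "\<dots> \<le> (1 / c) * b ^ m * f k" by (intro mult_right_mono le f0)
    finally show ?thesis .
  qed
  with b c show thesis by (intro that[of b "1 / c"]) auto
qed

locale radial_pq = radial +
  fixes p q :: real
  assumes p: "1 < p" and pq: "1 / p + 1 / q = 1"
begin

lemma q: "1 < q"
  by (rule conjugate_exponent_gt_1[OF p pq])

text \<open>The q-th power of the norm over \<open>[r, s)\<close>, not the norm: it is additive in
  the interval, which the hole-filling argument exploits. It may be infinite until finiteness has
  been shown.\<close>

definition Lq :: "real \<Rightarrow> real \<Rightarrow> ennreal" where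
  "Lq r s = (\<integral>\<^sup>+t. ennreal (wt t powr q) * indicator {r..<s} t \<partial>lebesgue)"

lemma Lq_mono: "r' \<le> r \<Longrightarrow> s \<le> s' \<Longrightarrow> Lq r s \<le> Lq r' s'"
  unfolding Lq_def by (intro nn_integral_mono mult_left_mono) (auto simp: indicator_def)

lemma Lq_add: "r \<le> s \<Longrightarrow> s \<le> t \<Longrightarrow> Lq r t = Lq r s + Lq s t"
  unfolding Lq_def by (subst nn_integral_add[symmetric]) (measurable, auto intro!: nn_integral_cong simp: indicator_def)

lemma tail_1: "tail \<omega> 1 = 0"
  by (simp add: tail_eq)

lemma tail_diff_le:
  assumes r: "0 \<le> r" "r \<le> s" "s \<le> 1" and B: "0 \<le> B" "Lq r s \<le> ennreal (B powr q)"
  shows "tail \<omega> r - tail \<omega> s \<le> (s - r) powr (1 / p) * B"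
proof -
  define f where "f t = (indicator {r..<s} t :: real)" for t
  define g where "g t = wt t * indicator {r..<s} t" for t
  have "ennreal (tail \<omega> r - tail \<omega> s) = (\<integral>\<^sup>+t. ennreal (f t * g t) \<partial>lebesgue)"
  proof -
    have "(\<integral>\<^sup>+t. ennreal (wt t * indicator {r..<s} t) \<partial>lebesgue) = ennreal (tail \<omega> r - tail \<omega> s)"
      unfolding tail_diff[OF r] by (intro nn_integral_eq_integral integrable_wt_indicator) (auto simp: wt_nonneg)
    moreover have "f t * g t = wt t * indicator {r..<s} t" for t by (simp add: f_def g_def indicator_def)
    ultimately show ?thesis by simp
  qed
  also have "\<dots> \<le> ennreal ((s - r) powr (1 / p) * B)"
  proof (rule nn_integral_Holder[OF p pq])
    show "f \<in> borel_measurable lebesgue" unfolding f_def by measurable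
    show "g \<in> borel_measurable lebesgue" unfolding g_def by measurable
    show "0 \<le> f t" "0 \<le> g t" for t by (auto simp: f_def g_def wt_nonneg)
    have "ennreal (f t powr p) = indicator {r..<s} t" for t by (simp add: f_def indicator_def)
    then have "(\<integral>\<^sup>+t. ennreal (f t powr p) \<partial>lebesgue) = emeasure lebesgue {r..<s}" by simp
    then show "(\<integral>\<^sup>+t. ennreal (f t powr p) \<partial>lebesgue) \<le> ennreal (((s - r) powr (1 / p)) powr p)"
      using r p by (simp add: powr_powr)
    have "ennreal (g t powr q) = ennreal (wt t powr q) * indicator {r..<s} t" for t by (simp add: g_def indicator_def)
    then show "(\<integral>\<^sup>+t. ennreal (g t powr q) \<partial>lebesgue) \<le> ennreal (B powr q)" using B by (simp add: Lq_def)
  qed (use B in auto)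
  finally show ?thesis using B by (subst (asm) ennreal_le_iff) auto
qed

text \<open>Hoelder on \<open>[dyad k, 1)\<close>, an interval of length \<open>2 ^ (-k)\<close>,
  gives the opposite inequality with constant 1.\<close>

definition reverse_Holder :: "real \<Rightarrow> bool" where
  "reverse_Holder A \<longleftrightarrow> 0 < A \<and> (\<forall>k. Lq (dyad k) 1 \<le> ennreal ((A * 2 powr (real k / p) * tail \<omega> (dyad k)) powr q))"

lemma half_power_powr: "((1/2) ^ l) powr (1 / p) = 2 powr - (real l / p)"
proof -
  have "(1/2::real) ^ l = 2 powr - real l" by (simp add: powr_minus powr_realpow power_divide field_simps)
  then show ?thesis by (simp add: powr_powr)
qed

text \<open>Hoelder on the short interval \<open>[dyad (k + m), 1)\<close>, whose length supplies
  the powers of 2, with the norm enlarged to \<open>[dyad k, 1)\<close>, where the reverse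
  inequality applies.\<close>

lemma tail_decay:
  assumes A: "reverse_Holder A"
  shows "tail \<omega> (dyad (k + m)) \<le> A * 2 powr - (real m / p) * tail \<omega> (dyad k)"
proof -
  define B where "B = A * 2 powr (real k / p) * tail \<omega> (dyad k)"
  have B: "0 \<le> B" using A dyad_tail_pos[of k] by (simp add: B_def reverse_Holder_def)
  have "Lq (dyad (k + m)) 1 \<le> Lq (dyad k) 1" by (intro Lq_mono dyad_mono) auto
  also have "\<dots> \<le> ennreal (B powr q)" using A by (simp add: reverse_Holder_def B_def)
  finally have "tail \<omega> (dyad (k + m)) - tail \<omega> 1 \<le> (1 - dyad (k + m)) powr (1 / p) * B"
    using dyad_nonneg dyad_less_1 B by (intro tail_diff_le) (auto intro: less_imp_le)
  also have "1 - dyad (k + m) = (1/2) ^ (k + m)" by (simp add: dyad_def)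
  also have "((1/2) ^ (k + m)) powr (1 / p) * B = A * (2 powr - (real (k + m) / p) * 2 powr (real k / p)) * tail \<omega> (dyad k)"
    unfolding half_power_powr by (simp add: B_def mult_ac)
  also have "2 powr - (real (k + m) / p) * 2 powr (real k / p) = 2 powr - (real m / p)"
    by (simp add: add_divide_distrib flip: powr_add)
  finally show ?thesis by (simp add: tail_1)
qed

lemma exists_decay_steps:
  fixes A e :: real
  assumes "0 < A" "0 < e"
  obtains L where "0 < L" "A * 2 powr - (real L / p) \<le> e"
proof -
  have "(\<lambda>L. A * (2 powr - (1 / p)) ^ L) \<longlonglongrightarrow> A * 0"
    using p by (intro tendsto_mult tendsto_const LIMSEQ_realpow_zero) (auto simp: powr_less_one)
  then have "(\<lambda>L. A * 2 powr - (real L / p)) \<longlonglongrightarrow> 0" by (simp add: powr_power)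
  then have "eventually (\<lambda>L. A * 2 powr - (real L / p) < e) sequentially" using assms by (intro order_tendstoD) auto
  then have "eventually (\<lambda>L. 0 < L \<and> A * 2 powr - (real L / p) < e) sequentially"
    using eventually_gt_at_top[of 0] by eventually_elim auto
  then obtain L where "0 < L" "A * 2 powr - (real L / p) < e" using eventually_happens'[OF sequentially_bot] by blast
  then show thesis by (intro that[of L]) auto
qed

text \<open>\<open>L\<close> dyadic steps shrink the tail by the factor \<open>2 * C\<close>.
  Doubling gives up \<open>C\<close> to place \<open>r\<close> between two dyadic points, and a
  factor 2 remains, with \<open>K = 2 ^ L\<close>.\<close>

lemma D_check_of_reverse_Holder:
  assumes "doubling C" "reverse_Holder A"
  shows "\<omega> \<in> D_check"
proof -
  have C: "1 \<le> C" and A: "0 < A" using assms by (auto simp: doubling_def reverse_Holder_def)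
  obtain L where L: "0 < L" "A * 2 powr - (real L / p) \<le> 1 / (2 * C)"
    using exists_decay_steps[of A "1 / (2 * C)"] A C by auto
  have "2 * tail \<omega> (1 - (1 - r) / 2 ^ L) \<le> tail \<omega> r" if r: "r \<in> {0..<1}" for r
  proof -
    obtain k where k: "r \<in> dyad_interval k" using dyad_interval_exists r by auto
    have "dyad (k + L) = 1 - (1/2) ^ k / 2 ^ L" by (simp add: dyad_def power_add power_divide)
    also have "\<dots> \<le> 1 - (1 - r) / 2 ^ L"
      using k by (auto simp: dyad_interval_def dyad_def divide_right_mono)
    finally have "tail \<omega> (1 - (1 - r) / 2 ^ L) \<le> tail \<omega> (dyad (k + L))" by (intro tail_antimono dyad_nonneg)
    also have "\<dots> \<le> A * 2 powr - (real L / p) * tail \<omega> (dyad k)" by (rule tail_decay[OF assms(2)])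
    also have "\<dots> \<le> 1 / (2 * C) * (C * tail \<omega> (dyad (Suc k)))"
      using assms(1) L dyad_tail_pos[of k] C by (intro mult_mono) (auto simp: doubling_def intro: less_imp_le)
    also have "\<dots> = tail \<omega> (dyad (Suc k)) / 2" using C by simp
    also have "tail \<omega> (dyad (Suc k)) \<le> tail \<omega> r" using r k by (intro tail_antimono) (auto simp: dyad_interval_def)
    finally show ?thesis by simp
  qed
  moreover have "(2::real) ^ L > 1" using L by simp
  ultimately show ?thesis unfolding D_check_def by (intro CollectI exI[of _ "2 ^ L :: real"] exI[of _ "2::real"] conjI ballI) auto
qed

text \<open>Hole filling. After \<open>L\<close> steps at most half of the tail is left, so the tail
  at \<open>dyad k\<close> is at most twice the mass of \<open>[dyad k, dyad (k + L))\<close>, to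
  which Hoelder applies. Together with the reverse inequality, the part of the q-th powers on this
  interval controls all of it, and what lies beyond is a fixed fraction.\<close>

lemma Lq_decay:
  assumes A: "reverse_Holder A"
  obtains b K where "0 < b" "b < 1" "0 < K"
    "\<And>j k. j \<le> k \<Longrightarrow> Lq (dyad k) 1 \<le> ennreal ((K * b ^ (k - j) * (2 powr (real j / p) * tail \<omega> (dyad j))) powr q)"
proof -
  define B where "B k = A * (2 powr (real k / p) * tail \<omega> (dyad k))" for k
  have A0: "0 < A" using A by (simp add: reverse_Holder_def)
  have B0: "0 < B k" for k using A0 dyad_tail_pos[of k] by (simp add: B_def)
  have LB: "Lq (dyad k) 1 \<le> ennreal (B k powr q)" for k using A by (simp add: reverse_Holder_def B_def mult_ac)
  have fin: "Lq (dyad k) 1 < top" for k using LB[of k] le_less_trans by (metis ennreal_less_top)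
  define f where "f k = enn2real (Lq (dyad k) 1)" for k
  have fe: "Lq (dyad k) 1 = ennreal (f k)" for k using fin[of k] by (simp add: f_def)
  have f0: "0 \<le> f k" for k by (simp add: f_def)
  have fB: "f k \<le> B k powr q" for k using LB[of k] fe[of k] by simp
  have fmono: "f n \<le> f m" if "m \<le> n" for m n
  proof -
    have "Lq (dyad n) 1 \<le> Lq (dyad m) 1" using that by (intro Lq_mono dyad_mono) auto
    then show ?thesis using fe f0 by simp
  qed
  obtain L where L: "0 < L" "A * 2 powr - (real L / p) \<le> 1 / 2"
    using exists_decay_steps[of A "1 / 2"] A0 by auto
  define E where "E = (2 * A) powr q"
  have E: "E > 0" using A0 by (simp add: E_def)
  \<comment> \<open>The difference is the part of the integral on
    \<open>[dyad k, dyad (k + L))\<close>. Rearranged, the inequality says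
    \<open>f (k + L) \<le> (1 - 1 / E) * f k\<close>.\<close>
  have step: "f k \<le> E * (f k - f (k + L))" for k
  proof -
    have le: "dyad k \<le> dyad (k + L)" "dyad (k + L) \<le> 1" using dyad_less_1 by (auto intro: dyad_mono less_imp_le)
    have "ennreal (f k) = Lq (dyad k) (dyad (k + L)) + ennreal (f (k + L))"
      using Lq_add[OF le] fe by simp
    then have "Lq (dyad k) (dyad (k + L)) = ennreal (f k) - ennreal (f (k + L))" by simp
    then have e: "Lq (dyad k) (dyad (k + L)) = ennreal (f k - f (k + L))" by (simp add: ennreal_minus f0)
    have d: "0 \<le> f k - f (k + L)" using fmono[of k "k + L"] by simp
    define D where "D = (f k - f (k + L)) powr (1 / q)"
    have "tail \<omega> (dyad k) - tail \<omega> (dyad (k + L)) \<le> (dyad (k + L) - dyad k) powr (1 / p) * D"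
      using le dyad_nonneg e d q by (intro tail_diff_le) (auto simp: D_def powr_powr)
    also have "(dyad (k + L) - dyad k) powr (1 / p) \<le> ((1/2) ^ k) powr (1 / p)"
      using p le by (intro powr_mono2) (auto simp: dyad_def)
    also have "\<dots> = 2 powr - (real k / p)" by (rule half_power_powr)
    finally have "tail \<omega> (dyad k) - tail \<omega> (dyad (k + L)) \<le> 2 powr - (real k / p) * D"
      by (simp add: D_def mult_right_mono)
    moreover have "tail \<omega> (dyad (k + L)) \<le> 1 / 2 * tail \<omega> (dyad k)"
      using tail_decay[OF A, of k L] mult_right_mono[OF L(2), of "tail \<omega> (dyad k)"] dyad_tail_pos[of k] by linarith
    ultimately have t: "tail \<omega> (dyad k) \<le> 2 * (2 powr - (real k / p) * D)" by linarith
    have "B k \<le> A * (2 powr (real k / p) * (2 * (2 powr - (real k / p) * D)))"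
      unfolding B_def using t A0 by (intro mult_left_mono) auto
    also have "\<dots> = 2 * A * D * (2 powr (real k / p) * 2 powr - (real k / p))" by (simp add: mult_ac)
    also have "\<dots> = 2 * A * D" by (simp flip: powr_add)
    finally have "B k powr q \<le> (2 * A * D) powr q" using q B0[of k] by (intro powr_mono2) auto
    also have "\<dots> = E * (f k - f (k + L))" using q d by (simp add: E_def D_def powr_mult powr_powr)
    finally show ?thesis using fB[of k] by linarith
  qed
  \<comment> \<open>The maximum keeps the ratio positive whatever the size of
    \<open>E\<close>.\<close>
  define c where "c = max (1/2) (1 - 1 / E)"
  have c: "0 < c" "c < 1" using E by (auto simp: c_def)
  have "f (k + L) \<le> c * f k" for k
  proof -
    have "f (k + L) \<le> (1 - 1 / E) * f k" using step[of k] E by (simp add: field_simps)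
    also have "\<dots> \<le> c * f k" using f0 by (intro mult_right_mono) (auto simp: c_def)
    finally show ?thesis .
  qed
  then obtain b C where b: "0 < b" "b < 1" "0 < C" "\<And>k m. f (k + m) \<le> C * b ^ m * f k"
    using geometric_decay[of f L c] fmono f0 L c by blast
  show thesis
  proof (rule that)
    show "0 < b powr (1 / q)" "b powr (1 / q) < 1" using b q by (auto simp: powr_lt_1)
    show "0 < C powr (1 / q) * A" using b A0 by simp
    fix j k :: nat assume "j \<le> k"
    then have "f k \<le> C * b ^ (k - j) * f j" using b(4)[of j "k - j"] by simp
    also have "\<dots> \<le> C * b ^ (k - j) * B j powr q" using b fB by (intro mult_left_mono) auto
    also have "\<dots> = (C powr (1 / q) * A * (b powr (1 / q)) ^ (k - j) * (2 powr (real j / p) * tail \<omega> (dyad j))) powr q"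
    proof -
      have "(C powr (1 / q)) powr q = C" using b q by (simp add: powr_powr)
      moreover have "((b powr (1 / q)) ^ (k - j)) powr q = b ^ (k - j)" using b q by (simp add: powr_power powr_powr flip: powr_realpow)
      ultimately show ?thesis by (simp only: B_def powr_mult mult_ac)
    qed
    finally show "Lq (dyad k) 1 \<le> ennreal ((C powr (1 / q) * A * (b powr (1 / q)) ^ (k - j) * (2 powr (real j / p) * tail \<omega> (dyad j))) powr q)"
      unfolding fe by (rule ennreal_leI)
  qed
qed

section \<open>Equivalence of the supremum condition with the reverse Hoelder inequality, under
  doubling\<close>

lemma m_const_alt:
  "m_const p q \<omega> = (SUP r\<in>{0<..<1}.
     enn_powr (1 + (\<integral>\<^sup>+t. ennreal (1 / tail \<omega> t powr p) * indicator {0..r} t \<partial>lborel)) (1 / p) * enn_powr (Lq r 1) (1 / q))"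
proof -
  have "(\<integral>\<^sup>+t. ennreal (\<omega> t powr q) \<partial>lebesgue_on {r..<1}) = Lq r 1" if "r \<in> {0<..<1}" for r
  proof -
    have "(\<integral>\<^sup>+t. ennreal (\<omega> t powr q) \<partial>lebesgue_on {r..<1}) = (\<integral>\<^sup>+t. ennreal (\<omega> t powr q) * indicator {r..<1} t \<partial>lebesgue)"
      by (subst nn_integral_restrict_space) auto
    also have "\<dots> = Lq r 1" unfolding Lq_def using that by (intro nn_integral_cong) (auto simp: indicator_def wt_def)
    finally show ?thesis .
  qed
  then show ?thesis unfolding m_const_def by (intro SUP_cong) (auto simp: nn_integral_lebesgue_on_eq)
qed

text \<open>At \<open>r = dyad (Suc k)\<close> the first factor is bounded below by the contribution
  of dyadic interval \<open>k\<close> alone, where \<open>1 / tail\<close> is at least its value at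
  the left end. This compares the norm from \<open>dyad (Suc k)\<close> with the tail at
  \<open>dyad k\<close>; doubling brings both to the same point.\<close>

lemma reverse_Holder_of_m_const:
  assumes C: "doubling C" and m: "m_const p q \<omega> < top"
  obtains A where "reverse_Holder A"
proof -
  have C1: "1 \<le> C" using C by (simp add: doubling_def)
  define M where "M = enn2real (m_const p q \<omega>)"
  have M: "m_const p q \<omega> = ennreal M" "0 \<le> M" using m by (auto simp: M_def)
  define I where "I r = (\<integral>\<^sup>+t. ennreal (1 / tail \<omega> t powr p) * indicator {0..r} t \<partial>lborel)" for r
  have le: "enn_powr (1 + I r) (1 / p) * enn_powr (Lq r 1) (1 / q) \<le> ennreal M" if "r \<in> {0<..<1}" for r
    unfolding M(1)[symmetric] m_const_alt I_def using that by (rule SUP_upper)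
  have 0: "Lq r 1 \<le> ennreal (M powr q)" if r: "r \<in> {0<..<1}" for r
  proof -
    have "1 \<le> enn_powr (1 + I r) (1 / p)"
      using enn_powr_mono[of 1 "1 + I r" "1 / p"] p by (simp add: enn_powr_def)
    then have "1 * enn_powr (Lq r 1) (1 / q) \<le> enn_powr (1 + I r) (1 / p) * enn_powr (Lq r 1) (1 / q)"
      by (rule mult_right_mono) simp
    then have "enn_powr (Lq r 1) (1 / q) \<le> ennreal M" using le[OF r] by (simp add: order_trans)
    then show ?thesis using M q by (intro le_of_enn_powr_le) auto
  qed
  \<comment> \<open>The supremum runs over \<open>r > 0\<close>, so the case of the whole interval
    is a limit: monotone convergence along \<open>1 / (n + 2)\<close>, the point 0 being
    null.\<close>
  have L0: "Lq 0 1 \<le> ennreal (M powr q)"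
  proof -
    have "Lq 0 1 = (\<integral>\<^sup>+t. (SUP n. ennreal (wt t powr q) * indicator {1 / real (n + 2)..<1} t) \<partial>lebesgue)"
      unfolding Lq_def
    proof (rule nn_integral_cong_AE)
      have "AE t in lebesgue. (t::real) \<noteq> 0" by (rule AE_completion) (rule AE_lborel_singleton)
      then show "AE t in lebesgue. ennreal (wt t powr q) * indicator {0..<1} t = (SUP n. ennreal (wt t powr q) * indicator {1 / real (n + 2)..<1} t)"
      proof eventually_elim
        case (elim t)
        show ?case
        proof (cases "t \<in> {0..<1}")
          case True
          then have "t > 0" using elim by auto
          then obtain n where n: "1 / t < real n" using reals_Archimedean2 by blast
          then have "1 / real (n + 2) \<le> t" using \<open>t > 0\<close> by (simp add: field_simps)
          then have "ennreal (wt t powr q) * indicator {0..<1} t \<le> (SUP n. ennreal (wt t powr q) * indicator {1 / real (n + 2)..<1} t)"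
            using True by (intro SUP_upper2[of n]) auto
          moreover have "(SUP n. ennreal (wt t powr q) * indicator {1 / real (n + 2)..<1} t) \<le> ennreal (wt t powr q) * indicator {0..<1} t"
            using True by (intro SUP_least) (auto simp: indicator_def)
          ultimately show ?thesis by (rule antisym)
        qed (simp add: wt_outside)
      qed
    qed
    also have "\<dots> = (SUP n. Lq (1 / real (n + 2)) 1)"
      unfolding Lq_def
    proof (rule nn_integral_monotone_convergence_SUP)
      show "incseq (\<lambda>n t. ennreal (wt t powr q) * indicator {1 / real (n + 2)..<1} t)"
        unfolding incseq_def le_fun_def
      proof (intro allI impI mult_left_mono)
        fix m n :: nat and t assume "m \<le> n"
        then have "1 / real (n + 2) \<le> 1 / real (m + 2)" by (intro divide_left_mono) auto
        then show "indicator {1 / real (m + 2)..<1} t \<le> (indicator {1 / real (n + 2)..<1} t :: ennreal)"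
          by (auto simp: indicator_def)
      qed auto
    qed measurable
    also have "\<dots> \<le> ennreal (M powr q)" by (intro SUP_least 0) auto
    finally show ?thesis .
  qed
  have S: "Lq (dyad (Suc k)) 1 \<le> ennreal ((M * (2 powr (real (Suc k) / p) * tail \<omega> (dyad k))) powr q)" for k
  proof -
    have W: "tail \<omega> (dyad k) > 0" by (rule dyad_tail_pos)
    have d: "dyad (Suc k) \<in> {0<..<1}" using dyad_mono[of 1 "Suc k"] dyad_less_1 by (auto simp: dyad_def)
    define Y where "Y = (1/2) ^ Suc k * (1 / tail \<omega> (dyad k) powr p)"
    have Y: "Y \<ge> 0" by (simp add: Y_def)
    have "ennreal Y = (\<integral>\<^sup>+t. ennreal (1 / tail \<omega> (dyad k) powr p) * indicator (dyad_interval k) t \<partial>lborel)"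
      unfolding Y_def by (subst nn_integral_cmult_indicator) (simp_all add: emeasure_dyad_interval mult.commute flip: ennreal_mult)
    also have "\<dots> \<le> I (dyad (Suc k))"
      unfolding I_def
    proof (rule nn_integral_mono)
      fix t
      show "ennreal (1 / tail \<omega> (dyad k) powr p) * indicator (dyad_interval k) t \<le> ennreal (1 / tail \<omega> t powr p) * indicator {0..dyad (Suc k)} t"
      proof (cases "t \<in> dyad_interval k")
        case True
        then have t: "0 \<le> t" "t < 1" "dyad k \<le> t" "t \<le> dyad (Suc k)" using dyad_interval_subset[of k] by (auto simp: dyad_interval_def)
        have "1 / tail \<omega> (dyad k) powr p \<le> 1 / tail \<omega> t powr p"
          using p tail_pos[OF t(1,2)] t W by (intro divide_left_mono powr_mono2 tail_antimono dyad_nonneg mult_pos_pos) auto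
        then show ?thesis using True t by (simp add: ennreal_leI)
      qed simp
    qed
    also have "I (dyad (Suc k)) \<le> 1 + I (dyad (Suc k))" by (simp add: add_increasing)
    finally have "ennreal (Y powr (1 / p)) \<le> enn_powr (1 + I (dyad (Suc k))) (1 / p)"
      using enn_powr_mono[of "ennreal Y" _ "1 / p"] p Y by (simp add: enn_powr_ennreal)
    then have "ennreal (Y powr (1 / p)) * enn_powr (Lq (dyad (Suc k)) 1) (1 / q) \<le> enn_powr (1 + I (dyad (Suc k))) (1 / p) * enn_powr (Lq (dyad (Suc k)) 1) (1 / q)"
      by (rule mult_right_mono) simp
    also have "\<dots> \<le> ennreal M" by (rule le[OF d])
    finally have X: "ennreal (Y powr (1 / p)) * enn_powr (Lq (dyad (Suc k)) 1) (1 / q) \<le> ennreal M" .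
    define Z where "Z = 2 powr (real (Suc k) / p) * tail \<omega> (dyad k)"
    have YZ: "Z * Y powr (1 / p) = 1"
    proof -
      have "Y powr (1 / p) = 2 powr - (real (Suc k) / p) * (1 / tail \<omega> (dyad k))"
        using W p unfolding Y_def powr_mult half_power_powr by (simp add: powr_divide powr_powr)
      then show ?thesis using W by (simp add: Z_def powr_minus)
    qed
    have "enn_powr (Lq (dyad (Suc k)) 1) (1 / q) = ennreal Z * (ennreal (Y powr (1 / p)) * enn_powr (Lq (dyad (Suc k)) 1) (1 / q))"
      using W YZ by (simp add: Z_def flip: mult.assoc ennreal_mult)
    also have "\<dots> \<le> ennreal Z * ennreal M" by (intro mult_left_mono X) auto
    also have "\<dots> = ennreal (M * Z)" using M W by (simp add: Z_def mult.commute flip: ennreal_mult)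
    finally show ?thesis unfolding Z_def[symmetric] using M W q by (intro le_of_enn_powr_le) (auto simp: Z_def)
  qed
  define A where "A = max 1 (max (M / tail \<omega> (dyad 0)) (M * C))"
  have "Lq (dyad k) 1 \<le> ennreal ((A * 2 powr (real k / p) * tail \<omega> (dyad k)) powr q)" for k
  proof (cases k)
    case 0
    have "M = M / tail \<omega> (dyad 0) * tail \<omega> (dyad 0)" using dyad_tail_pos[of 0] by simp
    also have "\<dots> \<le> A * tail \<omega> (dyad 0)" using dyad_tail_pos[of 0] by (intro mult_right_mono) (auto simp: A_def)
    finally have "ennreal (M powr q) \<le> ennreal ((A * tail \<omega> (dyad 0)) powr q)" using M q by (intro ennreal_leI powr_mono2) auto
    then show ?thesis using L0 0 by (simp add: order_trans)
  next
    case (Suc n)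
    have "M * (2 powr (real k / p) * tail \<omega> (dyad n)) \<le> M * (2 powr (real k / p) * (C * tail \<omega> (dyad k)))"
      using C M Suc by (intro mult_left_mono) (auto simp: doubling_def)
    also have "\<dots> = M * C * (2 powr (real k / p) * tail \<omega> (dyad k))" by (simp add: mult_ac)
    also have "\<dots> \<le> A * (2 powr (real k / p) * tail \<omega> (dyad k))"
      using dyad_tail_pos[of k] by (intro mult_right_mono) (auto simp: A_def)
    finally have "(M * (2 powr (real k / p) * tail \<omega> (dyad n))) powr q \<le> (A * (2 powr (real k / p) * tail \<omega> (dyad k))) powr q"
      using M q dyad_tail_pos[of n] by (intro powr_mono2) (auto simp: less_imp_le)
    then have "ennreal ((M * (2 powr (real k / p) * tail \<omega> (dyad n))) powr q) \<le> ennreal ((A * 2 powr (real k / p) * tail \<omega> (dyad k)) powr q)"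
      by (simp add: ennreal_leI mult.assoc)
    then show ?thesis using S[of n] Suc by (metis order_trans)
  qed
  moreover have "0 < A" by (simp add: A_def)
  ultimately show thesis by (intro that[of A]) (simp add: reverse_Holder_def)
qed

text \<open>For \<open>r\<close> in interval \<open>k\<close> the integral of
  \<open>1 / tail powr p\<close> splits into the intervals \<open>i \<le> k\<close>. After
  multiplication by the p-th power of the norm \<open>Y\<close> the piece \<open>i\<close> is at
  most a constant times \<open>\<beta> ^ (k - i)\<close>, by \<open>Lq_decay\<close> between the
  levels \<open>i\<close> and \<open>k\<close>. The undecayed inequality would give a constant for
  every piece and no bound uniform in \<open>k\<close>.\<close>

lemma m_const_of_reverse_Holder:
  assumes C: "doubling C" and A: "reverse_Holder A"
  shows "m_const p q \<omega> < top"
proof -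
  have C1: "1 \<le> C" using C by (simp add: doubling_def)
  obtain b K where b: "0 < b" "b < 1" "0 < K"
    and dec: "\<And>j k. j \<le> k \<Longrightarrow> Lq (dyad k) 1 \<le> ennreal ((K * b ^ (k - j) * (2 powr (real j / p) * tail \<omega> (dyad j))) powr q)"
    by (rule Lq_decay[OF A]) blast
  define \<beta> where "\<beta> = b powr p"
  have \<beta>: "0 < \<beta>" "\<beta> < 1" using b p by (auto simp: \<beta>_def powr_lt_1)
  define W where "W k = tail \<omega> (dyad k)" for k
  have W: "W k > 0" for k by (simp add: W_def dyad_tail_pos)
  have WC: "W k \<le> C * W (Suc k)" for k using C by (simp add: W_def doubling_def)
  \<comment> \<open>The first summand answers the 1 in front of the integral, by
    \<open>Lq_decay\<close> from level 0; the second is the geometric series over the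
    pieces.\<close>
  define Q where "Q = (K * W 0) powr p + (K * C) powr p / (1 - \<beta>)"
  have Q0: "0 \<le> Q" using \<beta> by (simp add: Q_def)
  have "enn_powr (1 + (\<integral>\<^sup>+t. ennreal (1 / tail \<omega> t powr p) * indicator {0..r} t \<partial>lborel)) (1 / p) * enn_powr (Lq r 1) (1 / q)
     \<le> ennreal (Q powr (1 / p))" if r: "r \<in> {0<..<1}" for r
  proof -
    obtain k where k: "r \<in> dyad_interval k" using dyad_interval_exists[of r] r by auto
    define Y where "Y = enn2real (Lq (dyad k) 1) powr (1 / q)"
    have fin: "Lq (dyad k) 1 = ennreal (enn2real (Lq (dyad k) 1))"
      using le_less_trans[OF dec[of k k] ennreal_less_top] by simp
    have Y: "0 \<le> Y" by (simp add: Y_def)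
    have YW: "Y \<le> K * b ^ (k - j) * (2 powr (real j / p) * W j)" if "j \<le> k" for j
    proof -
      have "enn2real (Lq (dyad k) 1) \<le> (K * b ^ (k - j) * (2 powr (real j / p) * W j)) powr q"
        using dec[OF that] by (intro enn2real_leI) (auto simp: W_def)
      then have "Y \<le> ((K * b ^ (k - j) * (2 powr (real j / p) * W j)) powr q) powr (1 / q)"
        unfolding Y_def using q by (intro powr_mono2) auto
      then show ?thesis using q b W[of j] by (simp add: powr_powr)
    qed
    \<comment> \<open>The tail on interval \<open>i\<close> is bounded below by its value at the
      right end, \<open>W (Suc i)\<close>; doubling later returns to \<open>W i\<close>.\<close>
    define F where "F = (\<Sum>i\<le>k. (1/2) ^ Suc i * (1 / W (Suc i) powr p))"
    have F0: "0 \<le> F" unfolding F_def by (intro sum_nonneg) auto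
    have "(\<integral>\<^sup>+t. ennreal (1 / tail \<omega> t powr p) * indicator {0..r} t \<partial>lborel)
      = (\<integral>\<^sup>+t. (ennreal (1 / tail \<omega> t powr p) * indicator {0..r} t) * indicator {0..<1} t \<partial>lborel)"
      using r by (intro nn_integral_cong) (auto simp: indicator_def)
    also have "\<dots> \<le> (\<Sum>i. ennreal ((1/2) ^ Suc i) * (if i \<le> k then ennreal (1 / W (Suc i) powr p) else 0))"
    proof (rule nn_integral_dyad_le)
      fix i t assume t: "t \<in> dyad_interval i"
      have t': "0 \<le> t" "t < 1" using t dyad_interval_subset[of i] by auto
      show "ennreal (1 / tail \<omega> t powr p) * indicator {0..r} t \<le> (if i \<le> k then ennreal (1 / W (Suc i) powr p) else 0)"
      proof (cases "i \<le> k")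
        case True
        have "1 / tail \<omega> t powr p \<le> 1 / W (Suc i) powr p"
          using p t t' tail_pos[OF t'] W[of "Suc i"] by (intro divide_left_mono powr_mono2) (auto simp: W_def dyad_interval_def intro!: tail_antimono)
        then show ?thesis using True by (auto simp: indicator_def ennreal_leI)
      next
        case False
        then have "dyad (Suc k) \<le> dyad i" by (intro dyad_mono) auto
        then show ?thesis using t k by (auto simp: dyad_interval_def indicator_def)
      qed
    qed
    also have "\<dots> = (\<Sum>i\<le>k. ennreal ((1/2) ^ Suc i) * (if i \<le> k then ennreal (1 / W (Suc i) powr p) else 0))"
      by (rule suminf_finite) auto
    also have "\<dots> = (\<Sum>i\<le>k. ennreal ((1/2) ^ Suc i * (1 / W (Suc i) powr p)))"
      by (intro sum.cong) (auto simp flip: ennreal_mult)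
    also have "\<dots> = ennreal F" unfolding F_def by (rule sum_ennreal) auto
    finally have "1 + (\<integral>\<^sup>+t. ennreal (1 / tail \<omega> t powr p) * indicator {0..r} t \<partial>lborel) \<le> ennreal (1 + F)"
      using F0 by (subst ennreal_plus) (auto intro: add_left_mono)
    then have 1: "enn_powr (1 + (\<integral>\<^sup>+t. ennreal (1 / tail \<omega> t powr p) * indicator {0..r} t \<partial>lborel)) (1 / p) \<le> ennreal ((1 + F) powr (1 / p))"
      using F0 p by (intro enn_powr_le) auto
    have "Lq r 1 \<le> Lq (dyad k) 1" using k by (intro Lq_mono) (auto simp: dyad_interval_def)
    then have 2: "enn_powr (Lq r 1) (1 / q) \<le> ennreal Y"
      using fin q unfolding Y_def by (intro enn_powr_le) auto
    have "(1 + F) * Y powr p = Y powr p + (\<Sum>i\<le>k. (1/2) ^ Suc i * (1 / W (Suc i) powr p) * Y powr p)"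
      by (simp add: F_def distrib_right sum_distrib_right)
    also have "\<dots> \<le> (K * W 0) powr p + (\<Sum>i\<le>k. (K * C) powr p * \<beta> ^ (k - i))"
    proof (intro add_mono sum_mono)
      have "Y \<le> K * b ^ k * W 0" using YW[of 0] by simp
      also have "\<dots> \<le> K * 1 * W 0" using b W[of 0] by (intro mult_right_mono mult_left_mono power_le_one) auto
      finally show "Y powr p \<le> (K * W 0) powr p" using Y p by (intro powr_mono2) auto
      fix i assume "i \<in> {..k}"
      then have "Y \<le> K * b ^ (k - i) * (2 powr (real i / p) * W i)" by (intro YW) auto
      also have "\<dots> \<le> K * b ^ (k - i) * (2 powr (real i / p) * (C * W (Suc i)))"
        using b by (intro mult_left_mono WC) auto
      finally have "Y powr p \<le> (K * b ^ (k - i) * (2 powr (real i / p) * (C * W (Suc i)))) powr p"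
        using Y p by (intro powr_mono2) auto
      also have "\<dots> = K powr p * \<beta> ^ (k - i) * (2 ^ i * (C powr p * W (Suc i) powr p))"
      proof -
        have "(b ^ (k - i)) powr p = \<beta> ^ (k - i)" using b by (simp add: \<beta>_def powr_power powr_powr mult.commute flip: powr_realpow)
        moreover have "(2 powr (real i / p)) powr p = 2 ^ i" using p by (simp add: powr_powr powr_realpow)
        ultimately show ?thesis by (simp only: powr_mult)
      qed
      finally have "(1/2) ^ Suc i * (1 / W (Suc i) powr p) * Y powr p \<le> (1/2) ^ Suc i * (1 / W (Suc i) powr p) * (K powr p * \<beta> ^ (k - i) * (2 ^ i * (C powr p * W (Suc i) powr p)))"
        by (intro mult_left_mono) auto
      also have "\<dots> = (1/2) * ((K * C) powr p * \<beta> ^ (k - i))" using W[of "Suc i"] by (simp add: powr_mult power_divide)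
      also have "\<dots> \<le> (K * C) powr p * \<beta> ^ (k - i)" using \<beta> by simp
      finally show "(1/2) ^ Suc i * (1 / W (Suc i) powr p) * Y powr p \<le> (K * C) powr p * \<beta> ^ (k - i)" .
    qed
    also have "(\<Sum>i\<le>k. (K * C) powr p * \<beta> ^ (k - i)) = (K * C) powr p * (\<Sum>i\<le>k. \<beta> ^ (k - i))" by (simp only: sum_distrib_left)
    also have "(\<Sum>i\<le>k. \<beta> ^ (k - i)) = (\<Sum>i\<le>k. \<beta> ^ i)"
      by (rule sum.reindex_bij_witness[of _ "\<lambda>i. k - i" "\<lambda>i. k - i"]) auto
    also have "\<dots> \<le> 1 / (1 - \<beta>)"
    proof -
      have "(\<lambda>n. \<beta> ^ n) sums (1 / (1 - \<beta>))" using \<beta> by (intro geometric_sums) auto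
      then show ?thesis using sum_le_suminf[of "\<lambda>n. \<beta> ^ n" "{..k}"] \<beta> by (simp add: sums_iff)
    qed
    finally have "(1 + F) * Y powr p \<le> Q" by (simp add: Q_def mult_left_mono)
    then have "((1 + F) * Y powr p) powr (1 / p) \<le> Q powr (1 / p)" using F0 p by (intro powr_mono2) auto
    then have 3: "(1 + F) powr (1 / p) * Y \<le> Q powr (1 / p)" using F0 Y p by (simp add: powr_mult powr_powr)
    have "enn_powr (1 + (\<integral>\<^sup>+t. ennreal (1 / tail \<omega> t powr p) * indicator {0..r} t \<partial>lborel)) (1 / p) * enn_powr (Lq r 1) (1 / q)
      \<le> ennreal ((1 + F) powr (1 / p)) * ennreal Y" by (intro mult_mono 1 2) auto
    also have "\<dots> = ennreal ((1 + F) powr (1 / p) * Y)" using Y by (simp add: ennreal_mult)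
    also have "\<dots> \<le> ennreal (Q powr (1 / p))" by (intro ennreal_leI 3)
    finally show ?thesis .
  qed
  then have "m_const p q \<omega> \<le> ennreal (Q powr (1 / p))" unfolding m_const_alt by (intro SUP_least)
  then show ?thesis by (rule le_less_trans) simp
qed

end

section \<open>Taylor coefficients of the Hilbert-type operator\<close>

context radial
begin

text \<open>The coefficient of \<open>(t * z) ^ n\<close> in the kernel of the operator: integration
  of the Bergman kernel followed by division by \<open>z\<close> contributes the factor
  \<open>1 / (n + 1)\<close>.\<close>

definition coef :: "nat \<Rightarrow> real" where "coef n = 1 / (2 * real (Suc n) * mom (2 * n + 1))"

lemma coef_pos: "0 < coef n"
  using mom_pos[of "2 * n + 1"] by (simp add: coef_def)

text \<open>Moments do not decay exponentially: for every \<open>r < 1\<close> they are at least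
  \<open>r ^ (2 * n + 1)\<close> times a positive tail. Taking \<open>r\<^sup>2 = y\<close> strictly
  between \<open>x\<close> and 1 leaves a geometric series in \<open>x / y\<close>.\<close>

lemma summable_moment_series:
  assumes "0 \<le> x" "x < 1"
  shows "summable (\<lambda>n. x ^ n / (2 * mom (2 * n + 1)))"
proof -
  obtain y where y: "x < y" "y < 1" using assms dense by blast
  define r where "r = sqrt y"
  have r: "0 < r" "r < 1" "r\<^sup>2 = y" using y assms by (auto simp: r_def)
  have W: "tail \<omega> r > 0" using r by (intro tail_pos) auto
  have "summable (\<lambda>n. (1 / (2 * r * tail \<omega> r)) * (x / y) ^ n)"
    using y assms by (intro summable_mult summable_geometric) auto
  then show ?thesis
  proof (rule summable_comparison_test')
    fix n
    have "r * y ^ n * tail \<omega> r \<le> mom (2 * n + 1)"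
    proof -
      have "r ^ (2 * n + 1) = r * y ^ n" using r(3) by (simp add: power_mult)
      then show ?thesis using mom_ge[of r "2 * n + 1"] r by simp
    qed
    moreover have "0 < r * y ^ n * tail \<omega> r" using r y assms W by simp
    ultimately have "x ^ n / (2 * mom (2 * n + 1)) \<le> x ^ n / (2 * (r * y ^ n * tail \<omega> r))"
      using assms by (intro divide_left_mono) (auto intro!: mult_pos_pos mom_pos)
    also have "\<dots> = (1 / (2 * r * tail \<omega> r)) * (x / y) ^ n" by (simp add: power_divide)
    finally show "norm (x ^ n / (2 * mom (2 * n + 1))) \<le> (1 / (2 * r * tail \<omega> r)) * (x / y) ^ n"
      using assms mom_pos[of "2 * n + 1"] by simp
  qed
qed

lemma summable_coef:
  assumes "0 \<le> x" "x < 1"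
  shows "summable (\<lambda>n. coef n * x ^ n)"
proof (rule summable_comparison_test'[OF summable_moment_series[OF assms]])
  fix n
  have "coef n * x ^ n = (x ^ n / (2 * mom (2 * n + 1))) * (1 / real (Suc n))"
    by (simp add: coef_def)
  also have "\<dots> \<le> (x ^ n / (2 * mom (2 * n + 1))) * 1"
    using assms mom_pos[of "2 * n + 1"] by (intro mult_left_mono) auto
  finally show "norm (coef n * x ^ n) \<le> x ^ n / (2 * mom (2 * n + 1))"
    using assms coef_pos[of n] by simp
qed

lemma disc_series_bergman_kernel:
  assumes t: "0 \<le> t" "t < 1"
  shows "disc_series (\<lambda>n. of_real (t ^ n / (2 * mom (2 * n + 1)))) (bergman_kernel \<omega> (of_real t))"
  unfolding disc_series_def
proof
  fix z :: complex assume "z \<in> ball 0 1"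
  then have z: "norm z < 1" by simp
  have "summable (\<lambda>n. norm (of_real (t ^ n / (2 * mom (2 * n + 1))) * z ^ n))"
  proof (rule summable_comparison_test'[OF summable_moment_series[of "norm z"]])
    fix n
    have "norm (of_real (t ^ n / (2 * mom (2 * n + 1))) * z ^ n) = t ^ n * (norm z ^ n / (2 * mom (2 * n + 1)))"
      using t mom_pos[of "2 * n + 1"] by (simp add: norm_mult norm_power norm_divide abs_mult del: of_real_power)
    also have "\<dots> \<le> norm z ^ n / (2 * mom (2 * n + 1))"
      using t mom_pos[of "2 * n + 1"] by (intro mult_left_le_one_le power_le_one) auto
    finally show "norm (norm (of_real (t ^ n / (2 * mom (2 * n + 1))) * z ^ n)) \<le> norm z ^ n / (2 * mom (2 * n + 1))" by simp
  qed (use z in auto)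
  then have s: "summable (\<lambda>n. of_real (t ^ n / (2 * mom (2 * n + 1))) * z ^ n)" by (rule summable_norm_cancel)
  have "bergman_kernel \<omega> (of_real t) z = (\<Sum>n. of_real (t ^ n / (2 * mom (2 * n + 1))) * z ^ n)"
    unfolding bergman_kernel_def by (intro suminf_cong) (simp add: power_mult_distrib add.commute)
  with s show "(\<lambda>n. of_real (t ^ n / (2 * mom (2 * n + 1))) * z ^ n) sums bergman_kernel \<omega> (of_real t) z"
    by (simp add: sums_iff)
qed

text \<open>\<open>F\<close>, which is \<open>z\<close> times the claimed series, is a primitive of
  the Bergman kernel on the disc, as comparison of coefficients shows, and it vanishes at 0. So the
  contour integral along the segment is \<open>F z\<close>.\<close>

lemma hilbert_kernel_sums:
  assumes t: "0 \<le> t" "t < 1" and z: "norm z < 1"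
  shows "(\<lambda>n. of_real (coef n * t ^ n) * z ^ n) sums hilbert_kernel \<omega> t z"
proof -
  \<comment> \<open>The coefficients of \<open>F\<close>, shifted by one place because of the factor
    \<open>z\<close>.\<close>
  define c where "c n = complex_of_real (case n of 0 \<Rightarrow> 0 | Suc m \<Rightarrow> coef m * t ^ m)" for n
  have s: "summable (\<lambda>n. of_real (coef n * t ^ n) * w ^ n)" if "norm w < 1" for w :: complex
  proof (rule summable_norm_cancel, rule summable_comparison_test'[OF summable_coef[of "norm w"]])
    fix n
    have "norm (norm (of_real (coef n * t ^ n) * w ^ n)) = t ^ n * (coef n * norm w ^ n)"
      using t coef_pos[of n] by (simp add: norm_mult norm_power)
    also have "\<dots> \<le> coef n * norm w ^ n"
      using t coef_pos[of n] by (intro mult_left_le_one_le power_le_one) auto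
    finally show "norm (norm (of_real (coef n * t ^ n) * w ^ n)) \<le> coef n * norm w ^ n" .
  qed (use that in auto)
  define F :: "complex \<Rightarrow> complex" where "F w = (\<Sum>n. of_real (coef n * t ^ n) * w ^ n) * w" for w
  have F: "disc_series c F"
    unfolding disc_series_def
  proof
    fix w :: complex assume w: "w \<in> ball 0 1"
    then have "(\<lambda>n. of_real (coef n * t ^ n) * w ^ n * w) sums F w"
      unfolding F_def by (intro sums_mult2 summable_sums s) auto
    then have "(\<lambda>n. c (Suc n) * w ^ Suc n) sums F w" by (simp add: c_def mult_ac)
    then show "(\<lambda>n. c n * w ^ n) sums F w" by (subst (asm) sums_Suc_iff) (simp add: c_def)
  qed
  have "(\<lambda>n. of_nat (Suc n) * c (Suc n)) = (\<lambda>n. of_real (t ^ n / (2 * mom (2 * n + 1))))"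
  proof
    fix n
    have "real (Suc n) * (coef n * t ^ n) = t ^ n / (2 * mom (2 * n + 1))"
      unfolding coef_def by (simp del: of_nat_Suc of_nat_add of_nat_mult)
    then have "complex_of_real (real (Suc n) * (coef n * t ^ n)) = of_real (t ^ n / (2 * mom (2 * n + 1)))" by (rule arg_cong)
    then show "of_nat (Suc n) * c (Suc n) = of_real (t ^ n / (2 * mom (2 * n + 1)))"
      by (simp only: c_def nat.case of_real_mult of_real_of_nat_eq)
  qed
  then have dF: "disc_series (\<lambda>n. of_real (t ^ n / (2 * mom (2 * n + 1)))) (deriv F)"
    using disc_series_deriv[OF F] by simp
  have eq: "deriv F w = bergman_kernel \<omega> (of_real t) w" if "w \<in> ball 0 1" for w
    using disc_seriesD[OF dF, of w] disc_seriesD[OF disc_series_bergman_kernel[OF t], of w] that sums_unique2 by auto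
  have "(F has_field_derivative bergman_kernel \<omega> (of_real t) w) (at w within ball 0 1)" if "w \<in> ball 0 1" for w
    using holomorphic_derivI[OF disc_series_holomorphic[OF F] _ that] eq[OF that] by (auto intro: has_field_derivative_at_within)
  then have "(bergman_kernel \<omega> (of_real t) has_contour_integral (F (pathfinish (linepath 0 z)) - F (pathstart (linepath 0 z)))) (linepath 0 z)"
    by (rule contour_integral_primitive) (use z in \<open>auto simp: closed_segment_subset\<close>)
  then have ci: "contour_integral (linepath 0 z) (bergman_kernel \<omega> (of_real t)) = F z"
    by (simp add: contour_integral_unique F_def)
  have "hilbert_kernel \<omega> t z = (\<Sum>n. of_real (coef n * t ^ n) * z ^ n)"
  proof (cases "z = 0")
    case True
    have "bergman_kernel \<omega> (of_real t) 0 = of_real (1 / (2 * mom 1))"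
      using disc_series_0[OF disc_series_bergman_kernel[OF t]] by simp
    moreover have "(\<Sum>n. complex_of_real (coef n * t ^ n) * 0 ^ n) = of_real (coef 0)"
      using powser_zero[of "\<lambda>n. complex_of_real (coef n * t ^ n)"] by simp
    ultimately show ?thesis using True by (simp add: hilbert_kernel_def coef_def)
  next
    case False
    then show ?thesis by (simp add: hilbert_kernel_def ci F_def)
  qed
  then show ?thesis using s[OF z] by (simp add: sums_iff)
qed

text \<open>On [0,1) the powers of \<open>t\<close> are at most 1, so the terms of the kernel series
  are dominated by \<open>coef n * norm z ^ n\<close> times the integrable function
  \<open>norm (F t)\<close>, and sum and integral may be exchanged. This also proves that the
  operator is defined at \<open>f\<close>.\<close>

lemma hilbert_op_series:
  fixes f :: "real \<Rightarrow> complex"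
  assumes F: "integrable lebesgue (\<lambda>t. f t * of_real (wt t))"
  obtains g where "hilbert_op \<omega> f = Some g"
    "disc_series (\<lambda>n. of_real (coef n) * (\<integral>t. of_real (t ^ n) * (f t * of_real (wt t)) \<partial>lebesgue)) g"
proof -
  define F where "F t = f t * of_real (wt t)" for t
  have intF: "integrable lebesgue F" using F by (simp add: F_def[abs_def])
  have [measurable]: "F \<in> borel_measurable lebesgue" using intF by (rule borel_measurable_integrable)
  have F0: "F t = 0" if "t \<notin> {0..<1}" for t using that by (simp add: F_def wt_outside)
  have le: "norm (of_real (t ^ n) * F t) \<le> norm (F t)" for n t
  proof (cases "t \<in> {0..<1}")
    case True
    then have "t ^ n * norm (F t) \<le> norm (F t)" by (intro mult_left_le_one_le power_le_one) auto
    then show ?thesis using True by (simp add: norm_mult norm_power)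
  qed (simp add: F0)
  have intn: "integrable lebesgue (\<lambda>t. of_real (t ^ n) * F t)" for n
  proof (rule Bochner_Integration.integrable_bound[OF intF])
    have [measurable]: "(\<lambda>t::real. of_real (t ^ n) :: complex) \<in> borel_measurable lebesgue"
      by (intro measurable_completion) measurable
    show "(\<lambda>t. of_real (t ^ n) * F t) \<in> borel_measurable lebesgue" by measurable
  qed (use le in \<open>auto intro!: AE_I2\<close>)
  define c where "c n = complex_of_real (coef n) * (\<integral>t. of_real (t ^ n) * F t \<partial>lebesgue)" for n
  define G where "G z t = (\<Sum>n. of_real (coef n) * z ^ n * (of_real (t ^ n) * F t))" for z t
  have main: "integrable lebesgue (G z)" "(\<lambda>n. c n * z ^ n) sums (\<integral>t. G z t \<partial>lebesgue)" if z: "norm z < 1" for z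
  proof -
    define h where "h n t = of_real (coef n) * z ^ n * (of_real (t ^ n) * F t)" for n t
    have nh: "norm (h n t) \<le> coef n * norm z ^ n * norm (F t)" for n t
      using mult_left_mono[OF le[of t n], of "coef n * norm z ^ n"] coef_pos[of n]
      by (simp add: h_def norm_mult norm_power)
    have sc: "summable (\<lambda>n. coef n * norm z ^ n)" using z by (intro summable_coef) auto
    have ih: "integrable lebesgue (h n)" for n unfolding h_def by (intro integrable_mult_right intn)
    have s1: "AE t in lebesgue. summable (\<lambda>n. norm (h n t))"
      using nh by (intro AE_I2 summable_comparison_test'[OF summable_mult2[OF sc]]) auto
    have s2: "summable (\<lambda>n. \<integral>t. norm (h n t) \<partial>lebesgue)"
    proof (rule summable_comparison_test'[OF summable_mult2[OF sc, of "\<integral>t. norm (F t) \<partial>lebesgue"]])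
      fix n
      have "(\<integral>t. norm (h n t) \<partial>lebesgue) \<le> (\<integral>t. coef n * norm z ^ n * norm (F t) \<partial>lebesgue)"
        using nh ih intF by (intro integral_mono) auto
      then show "norm (\<integral>t. norm (h n t) \<partial>lebesgue) \<le> coef n * norm z ^ n * (\<integral>t. norm (F t) \<partial>lebesgue)" by simp
    qed
    have G: "G z = (\<lambda>t. \<Sum>n. h n t)" by (simp add: G_def[abs_def] h_def)
    show "integrable lebesgue (G z)" unfolding G by (rule integrable_suminf[OF ih s1 s2])
    have "(\<lambda>n. \<integral>t. h n t \<partial>lebesgue) sums (\<integral>t. G z t \<partial>lebesgue)" unfolding G by (rule sums_integral[OF ih s1 s2])
    moreover have "(\<integral>t. h n t \<partial>lebesgue) = c n * z ^ n" for n
      unfolding h_def integral_mult_right_zero c_def by (simp only: mult_ac)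
    ultimately show "(\<lambda>n. c n * z ^ n) sums (\<integral>t. G z t \<partial>lebesgue)" by simp
  qed
  have K: "indicator {0..<1} t *\<^sub>R (f t * hilbert_kernel \<omega> t z * of_real (\<omega> t)) = G z t" if z: "norm z < 1" for z t
  proof (cases "t \<in> {0..<1}")
    case True
    then have "(\<lambda>n. of_real (coef n * t ^ n) * z ^ n * F t) sums (hilbert_kernel \<omega> t z * F t)"
      using z by (intro sums_mult2 hilbert_kernel_sums) auto
    then have "hilbert_kernel \<omega> t z * F t = G z t" by (simp add: sums_iff G_def mult_ac)
    then show ?thesis using True by (simp add: F_def wt_eq mult_ac)
  qed (simp add: G_def F0)
  have int: "integrable (lebesgue_on {0..<1}) (\<lambda>t. f t * hilbert_kernel \<omega> t z * of_real (\<omega> t))" if "norm z < 1" for z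
    using main(1)[OF that] K[OF that] by (subst integrable_restrict_space) auto
  define g where "g z = (\<integral>t. f t * hilbert_kernel \<omega> t z * of_real (\<omega> t) \<partial>lebesgue_on {0..<1})" for z
  have gG: "g z = (\<integral>t. G z t \<partial>lebesgue)" if "norm z < 1" for z
    unfolding g_def using K[OF that] by (subst integral_restrict_space) auto
  show thesis
  proof (rule that)
    show "hilbert_op \<omega> f = Some g" using int by (simp add: hilbert_op_def g_def[abs_def])
    show "disc_series (\<lambda>n. of_real (coef n) * (\<integral>t. of_real (t ^ n) * (f t * of_real (wt t)) \<partial>lebesgue)) g"
      using main(2) gG by (simp add: disc_series_def c_def F_def)
  qed
qed

end

section \<open>Sufficiency\<close>

context radial_pq
begin

section \<open>Moments of a function in \<open>L^p\<close> against the weight\<close>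

lemma interval_Holder:
  fixes \<psi> :: "real \<Rightarrow> real"
  assumes [measurable]: "\<psi> \<in> borel_measurable lebesgue" and \<psi>: "\<And>t. 0 \<le> \<psi> t"
    and a: "0 \<le> a" "(\<integral>\<^sup>+t. ennreal (\<psi> t powr p) * indicator (dyad_interval k) t \<partial>lebesgue) \<le> ennreal (a powr p)"
    and B: "0 \<le> B" "Lq (dyad k) 1 \<le> ennreal (B powr q)"
  shows "(\<integral>\<^sup>+t. ennreal (\<psi> t * wt t) * indicator (dyad_interval k) t \<partial>lebesgue) \<le> ennreal (a * B)"
proof -
  have [measurable]: "dyad_interval k \<in> sets lebesgue" by simp
  define f where "f t = \<psi> t * indicator (dyad_interval k) t" for t
  define g where "g t = wt t * indicator (dyad_interval k) t" for t
  have "(\<integral>\<^sup>+t. ennreal (f t * g t) \<partial>lebesgue) \<le> ennreal (a * B)"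
  proof (rule nn_integral_Holder[OF p pq])
    show "f \<in> borel_measurable lebesgue" unfolding f_def by measurable
    show "g \<in> borel_measurable lebesgue" unfolding g_def by measurable
    show "0 \<le> f t" "0 \<le> g t" for t using \<psi> wt_nonneg by (auto simp: f_def g_def)
    have "ennreal (f t powr p) = ennreal (\<psi> t powr p) * indicator (dyad_interval k) t" for t
      by (simp add: f_def indicator_def)
    then show "(\<integral>\<^sup>+t. ennreal (f t powr p) \<partial>lebesgue) \<le> ennreal (a powr p)" using a by simp
    have "(\<integral>\<^sup>+t. ennreal (g t powr q) \<partial>lebesgue) \<le> Lq (dyad k) 1"
      unfolding Lq_def using dyad_less_1[of "Suc k"]
      by (intro nn_integral_mono) (auto simp: g_def indicator_def dyad_interval_def)
    then show "(\<integral>\<^sup>+t. ennreal (g t powr q) \<partial>lebesgue) \<le> ennreal (B powr q)" using B by (simp add: order_trans)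
  qed (use a B in auto)
  moreover have "ennreal (f t * g t) = ennreal (\<psi> t * wt t) * indicator (dyad_interval k) t" for t
    by (simp add: f_def g_def indicator_def)
  ultimately show ?thesis by simp
qed

text \<open>The moments are measured in units of
  \<open>2 powr (j / p) * tail \<omega> (dyad j)\<close>; division of the tail by a moment of
  \<omega> will later cancel the tail. One sequence \<open>x\<close> in little l^p has to serve all
  orders \<open>n\<close> with \<open>2 ^ j \<le> n + 1\<close> at once.\<close>

definition weighted_moments_bounded :: "real \<Rightarrow> bool" where
  "weighted_moments_bounded E \<longleftrightarrow> (\<forall>\<psi> H. \<psi> \<in> borel_measurable lebesgue \<longrightarrow> (\<forall>t. 0 \<le> \<psi> t) \<longrightarrow> 0 \<le> H \<longrightarrow>
    (\<integral>\<^sup>+t. ennreal (\<psi> t powr p) * indicator {0..<1} t \<partial>lebesgue) \<le> ennreal H \<longrightarrow>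
    (\<exists>x. (\<forall>j. 0 \<le> x j) \<and> (\<Sum>j. ennreal (x j powr p)) \<le> ennreal (E * H) \<and>
      (\<forall>j n. 2 ^ j \<le> Suc n \<longrightarrow> (\<integral>\<^sup>+t. ennreal (t ^ n * (\<psi> t * wt t)) \<partial>lebesgue) \<le> ennreal (2 powr (real j / p) * tail \<omega> (dyad j) * x j))))"

text \<open>Hoelder on each dyadic interval \<open>k\<close>, with the norms \<phi> of \<psi> there.
  For \<open>k \<ge> j\<close> the power of \<open>t\<close> is dropped and \<open>Lq_decay\<close>
  gives the geometric factor. For \<open>k < j\<close> the smallness of the power outweighs the
  ratio of the tails at levels \<open>k\<close> and \<open>j\<close>. So \<open>x\<close> is a
  constant times a geometric convolution of \<phi>.\<close>

lemma weighted_moment_bound: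
  assumes C: "doubling C" and A: "reverse_Holder A"
  shows "\<exists>E>0. weighted_moments_bounded E"
proof -
  have C1: "1 \<le> C" using C by (simp add: doubling_def)
  define W where "W k = tail \<omega> (dyad k)" for k
  have W: "W k > 0" for k by (simp add: W_def dyad_tail_pos)
  obtain b0 K where b0: "0 < b0" "b0 < 1" "0 < K"
    and dec: "\<And>j k. j \<le> k \<Longrightarrow> Lq (dyad k) 1 \<le> ennreal ((K * b0 ^ (k - j) * (2 powr (real j / p) * W j)) powr q)"
    unfolding W_def by (rule Lq_decay[OF A]) blast
  obtain D where D: "D > 0" "\<And>m::nat. C ^ m * exp (- ((1/2) * 2 ^ m)) \<le> D * (1/2) ^ m"
    using superexponential_decay[of C "1/2"] C1 by auto
  define b where "b = max (1/2) b0"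
  have b: "0 < b" "b < 1" using b0 by (auto simp: b_def)
  \<comment> \<open>The value 1 serves the intervals from level \<open>j\<close> on,
    \<open>exp 1 * D\<close> those before it.\<close>
  define M where "M = K * max 1 (exp 1 * D)"
  have M: "M > 0" using b0 by (simp add: M_def less_max_iff_disj)
  obtain E where E: "E > 0" and conv: "geometric_convolution_bounded b p E"
    using geometric_convolution_bound[OF b p] by blast
  have "\<exists>x. (\<forall>j. 0 \<le> x j) \<and> (\<Sum>j. ennreal (x j powr p)) \<le> ennreal (M powr p * E * H) \<and>
      (\<forall>j n. 2 ^ j \<le> Suc n \<longrightarrow> (\<integral>\<^sup>+t. ennreal (t ^ n * (\<psi> t * wt t)) \<partial>lebesgue) \<le> ennreal (2 powr (real j / p) * W j * x j))"
    if [measurable]: "\<psi> \<in> borel_measurable lebesgue" and \<psi>: "\<forall>t. 0 \<le> \<psi> t" and H: "0 \<le> H"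
      and \<psi>H: "(\<integral>\<^sup>+t. ennreal (\<psi> t powr p) * indicator {0..<1} t \<partial>lebesgue) \<le> ennreal H" for \<psi> H
  proof -
    have [measurable]: "dyad_interval k \<in> sets lebesgue" for k by simp
    define I where "I k = (\<integral>\<^sup>+t. ennreal (\<psi> t powr p) * indicator (dyad_interval k) t \<partial>lebesgue)" for k
    have "(\<Sum>k. I k) = (\<integral>\<^sup>+t. ennreal (\<psi> t powr p) * indicator {0..<1} t \<partial>lebesgue)"
      unfolding I_def by (rule nn_integral_dyad[symmetric]) measurable
    then have sI: "(\<Sum>k. I k) \<le> ennreal H" using \<psi>H by simp
    define \<phi> where "\<phi> k = enn2real (I k) powr (1 / p)" for k
    have \<phi>0: "0 \<le> \<phi> k" for k by (simp add: \<phi>_def)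
    have I\<phi>: "I k = ennreal (\<phi> k powr p)" for k
    proof -
      have "I k \<le> (\<Sum>k. I k)" using sum_le_suminf[of I "{k}"] by simp
      then have "I k < top" using sI by (meson ennreal_less_top le_less_trans)
      then show ?thesis using p by (simp add: \<phi>_def powr_powr)
    qed
    have s\<phi>: "(\<Sum>k. ennreal (\<phi> k powr p)) \<le> ennreal H" using sI by (simp add: I\<phi>)
    note cv = geometric_convolution_boundedD[OF conv, OF \<phi>0 H s\<phi>]
    define x where "x i = M * (\<Sum>j. b ^ ((i - j) + (j - i)) * \<phi> j)" for i
    have x0: "0 \<le> x i" for i unfolding x_def using M b cv by (intro mult_nonneg_nonneg suminf_nonneg) (auto simp: \<phi>0)
    have piece: "(\<integral>\<^sup>+t. ennreal (t ^ n * (\<psi> t * wt t)) * indicator (dyad_interval k) t \<partial>lebesgue)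
        \<le> ennreal (2 powr (real j / p) * W j * M) * ennreal (b ^ ((j - k) + (k - j)) * \<phi> k)" if n: "2 ^ j \<le> Suc n" for n j k
    proof (cases "j \<le> k")
      case True
      have "(\<integral>\<^sup>+t. ennreal (t ^ n * (\<psi> t * wt t)) * indicator (dyad_interval k) t \<partial>lebesgue)
        \<le> (\<integral>\<^sup>+t. ennreal (\<psi> t * wt t) * indicator (dyad_interval k) t \<partial>lebesgue)"
      proof (rule nn_integral_mono)
        fix t
        show "ennreal (t ^ n * (\<psi> t * wt t)) * indicator (dyad_interval k) t \<le> ennreal (\<psi> t * wt t) * indicator (dyad_interval k) t"
        proof (cases "t \<in> dyad_interval k")
          case True
          then have "0 \<le> t" "t < 1" using dyad_interval_subset[of k] by auto
          then have "t ^ n * (\<psi> t * wt t) \<le> \<psi> t * wt t"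
            using \<psi> wt_nonneg[of t] by (intro mult_left_le_one_le power_le_one mult_nonneg_nonneg) auto
          then show ?thesis using True by (simp add: ennreal_leI)
        qed simp
      qed
      also have "\<dots> \<le> ennreal (\<phi> k * (K * b0 ^ (k - j) * (2 powr (real j / p) * W j)))"
        using dec[OF True] b0 W[of j] \<psi> by (intro interval_Holder) (auto simp: \<phi>0 I\<phi>[symmetric] I_def[symmetric] less_imp_le)
      also have "\<dots> \<le> ennreal (\<phi> k * (M * b ^ (k - j) * (2 powr (real j / p) * W j)))"
        using b0 W[of j] by (intro ennreal_leI mult_left_mono mult_right_mono mult_mono power_mono) (auto simp: \<phi>0 b_def M_def)
      also have "\<dots> = ennreal (2 powr (real j / p) * W j * M) * ennreal (b ^ ((j - k) + (k - j)) * \<phi> k)"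
        using True M W[of j] b \<phi>0[of k] by (simp add: mult_ac flip: ennreal_mult)
      finally show ?thesis .
    next
      case False
      then have k: "k \<le> j" by simp
      define \<tau> where "\<tau> = exp 1 * exp (- (2 ^ j / 2 ^ Suc k) :: real)"
      have "(2::real) ^ j / 2 ^ Suc k = (1/2) * 2 ^ (j - k)" using k by (simp add: power_diff)
      then have \<tau>: "\<tau> = exp 1 * exp (- ((1/2) * 2 ^ (j - k)))" by (simp only: \<tau>_def)
      have "(\<integral>\<^sup>+t. ennreal (t ^ n * (\<psi> t * wt t)) * indicator (dyad_interval k) t \<partial>lebesgue)
        \<le> (\<integral>\<^sup>+t. ennreal \<tau> * (ennreal (\<psi> t * wt t) * indicator (dyad_interval k) t) \<partial>lebesgue)"
      proof (rule nn_integral_mono)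
        fix t
        show "ennreal (t ^ n * (\<psi> t * wt t)) * indicator (dyad_interval k) t \<le> ennreal \<tau> * (ennreal (\<psi> t * wt t) * indicator (dyad_interval k) t)"
        proof (cases "t \<in> dyad_interval k")
          case True
          then have "0 \<le> t" "t \<le> dyad (Suc k)" using dyad_interval_subset[of k] by (auto simp: dyad_interval_def)
          then have "t ^ n \<le> \<tau>" unfolding \<tau>_def using n by (rule power_le_exp_dyad)
          then have "t ^ n * (\<psi> t * wt t) \<le> \<tau> * (\<psi> t * wt t)"
            using \<psi> wt_nonneg[of t] by (intro mult_right_mono mult_nonneg_nonneg) auto
          then show ?thesis using True \<psi> wt_nonneg[of t] by (simp add: ennreal_leI \<tau>_def flip: ennreal_mult)
        qed simp
      qed
      also have "\<dots> = ennreal \<tau> * (\<integral>\<^sup>+t. ennreal (\<psi> t * wt t) * indicator (dyad_interval k) t \<partial>lebesgue)"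
        by (rule nn_integral_cmult) measurable
      also have "\<dots> \<le> ennreal \<tau> * ennreal (\<phi> k * (K * b0 ^ (k - k) * (2 powr (real k / p) * W k)))"
        using dec[of k k] b0 W[of k] \<psi> by (intro mult_left_mono interval_Holder) (auto simp: \<phi>0 I\<phi>[symmetric] I_def[symmetric] less_imp_le)
      also have "\<dots> = ennreal (\<phi> k * K * (\<tau> * (2 powr (real k / p) * W k)))"
        using \<phi>0[of k] b0 W[of k] by (simp add: \<tau>_def mult_ac flip: ennreal_mult)
      also have "\<dots> \<le> ennreal (\<phi> k * K * (\<tau> * (2 powr (real j / p) * (C ^ (j - k) * W j))))"
        using k doubling_iterate[OF C, of k "j - k"] b0 p W[of k]
        by (intro ennreal_leI mult_left_mono mult_mono) (auto simp: \<phi>0 \<tau>_def W_def divide_right_mono)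
      also have "\<phi> k * K * (\<tau> * (2 powr (real j / p) * (C ^ (j - k) * W j))) = \<phi> k * K * exp 1 * (2 powr (real j / p) * W j) * (C ^ (j - k) * exp (- ((1/2) * 2 ^ (j - k))))"
        unfolding \<tau> by (simp only: mult_ac)
      also have "ennreal \<dots> \<le> ennreal (\<phi> k * K * exp 1 * (2 powr (real j / p) * W j) * (D * b ^ (j - k)))"
      proof (intro ennreal_leI mult_left_mono)
        have "C ^ (j - k) * exp (- ((1/2) * 2 ^ (j - k))) \<le> D * (1/2) ^ (j - k)" by (rule D)
        also have "\<dots> \<le> D * b ^ (j - k)" using D by (intro mult_left_mono power_mono) (auto simp: b_def)
        finally show "C ^ (j - k) * exp (- ((1/2) * 2 ^ (j - k))) \<le> D * b ^ (j - k)" .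
      qed (use b0 W[of j] \<phi>0[of k] in auto)
      also have "\<phi> k * K * exp 1 * (2 powr (real j / p) * W j) * (D * b ^ (j - k)) = \<phi> k * (2 powr (real j / p) * W j) * b ^ (j - k) * (K * (exp 1 * D))"
        by (simp only: mult_ac)
      also have "ennreal \<dots> \<le> ennreal (\<phi> k * (2 powr (real j / p) * W j) * b ^ (j - k) * M)"
        unfolding M_def using b b0 W[of j] \<phi>0[of k] by (intro ennreal_leI mult_left_mono) auto
      also have "\<dots> = ennreal (2 powr (real j / p) * W j * M) * ennreal (b ^ ((j - k) + (k - j)) * \<phi> k)"
        using k M W[of j] b \<phi>0[of k] by (simp add: mult_ac flip: ennreal_mult)
      finally show ?thesis .
    qed
    have "(\<integral>\<^sup>+t. ennreal (t ^ n * (\<psi> t * wt t)) \<partial>lebesgue) \<le> ennreal (2 powr (real j / p) * W j * x j)" if n: "2 ^ j \<le> Suc n" for j n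
    proof -
      have "(\<integral>\<^sup>+t. ennreal (t ^ n * (\<psi> t * wt t)) \<partial>lebesgue) = (\<integral>\<^sup>+t. ennreal (t ^ n * (\<psi> t * wt t)) * indicator {0..<1} t \<partial>lebesgue)"
        by (intro nn_integral_cong) (auto simp: wt_outside indicator_def)
      also have "\<dots> = (\<Sum>k. \<integral>\<^sup>+t. ennreal (t ^ n * (\<psi> t * wt t)) * indicator (dyad_interval k) t \<partial>lebesgue)"
        by (rule nn_integral_dyad) measurable
      also have "\<dots> \<le> (\<Sum>k. ennreal (2 powr (real j / p) * W j * M) * ennreal (b ^ ((j - k) + (k - j)) * \<phi> k))"
        by (intro suminf_le piece n) auto
      also have "\<dots> = ennreal (2 powr (real j / p) * W j * M) * (\<Sum>k. ennreal (b ^ ((j - k) + (k - j)) * \<phi> k))"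
        by (rule ennreal_suminf_cmult)
      also have "(\<Sum>k. ennreal (b ^ ((j - k) + (k - j)) * \<phi> k)) = ennreal (\<Sum>k. b ^ ((j - k) + (k - j)) * \<phi> k)"
        using cv b by (intro suminf_ennreal2) (auto simp: \<phi>0)
      also have "ennreal (2 powr (real j / p) * W j * M) * ennreal (\<Sum>k. b ^ ((j - k) + (k - j)) * \<phi> k) = ennreal (2 powr (real j / p) * W j * x j)"
        using W[of j] M unfolding x_def by (subst ennreal_mult'[symmetric]) (simp_all add: mult.assoc)
      finally show ?thesis .
    qed
    moreover have "(\<Sum>j. ennreal (x j powr p)) \<le> ennreal (M powr p * E * H)"
    proof -
      have "(\<Sum>j. ennreal (x j powr p)) = (\<Sum>i. ennreal (M powr p) * ennreal ((\<Sum>j. b ^ ((i - j) + (j - i)) * \<phi> j) powr p))"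
        by (simp add: x_def powr_mult ennreal_mult)
      also have "\<dots> = ennreal (M powr p) * (\<Sum>i. ennreal ((\<Sum>j. b ^ ((i - j) + (j - i)) * \<phi> j) powr p))" by (rule ennreal_suminf_cmult)
      also have "\<dots> \<le> ennreal (M powr p) * ennreal (E * H)" using cv by (intro mult_left_mono) auto
      finally show ?thesis using E H by (simp add: mult.assoc flip: ennreal_mult)
    qed
    ultimately show ?thesis using x0 by blast
  qed
  moreover have "M powr p * E > 0" using M E by simp
  ultimately show ?thesis unfolding W_def weighted_moments_bounded_def by blast
qed

text \<open>\<open>coef n\<close> is the increasing sequence \<open>\<beta> n\<close> times the
  decreasing \<open>1 / (n + 1)\<close>. It need not be monotone itself, but its variation is at
  most the sum of the contributions of both factors, each of which telescopes. The bound is assumed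
  up to the first index of the next block, which the last difference involves.\<close>

lemma coef_variation:
  assumes B: "\<And>n. n \<le> 2 * 2 ^ j - 1 \<Longrightarrow> 1 / (2 * mom (2 * n + 1)) \<le> B"
  shows "2 ^ j * (\<Sum>n\<in>block j. \<bar>coef (Suc n) - coef n\<bar>) \<le> 2 * B"
proof -
  define \<beta> where "\<beta> n = 1 / (2 * mom (2 * n + 1))" for n
  have \<beta>0: "0 \<le> \<beta> n" for n using mom_pos[of "2 * n + 1"] by (simp add: \<beta>_def)
  have \<beta>mono: "\<beta> m \<le> \<beta> n" if "m \<le> n" for m n
    unfolding \<beta>_def using mom_antimono[of "2 * m + 1" "2 * n + 1"] that mom_pos[of "2 * m + 1"] mom_pos[of "2 * n + 1"]
    by (intro divide_left_mono mult_pos_pos) auto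
  have ca: "coef n = \<beta> n / real (Suc n)" for n by (simp add: coef_def \<beta>_def)
  \<comment> \<open>Built so that one increment is the growth of \<beta> divided by
    \<open>2 ^ j\<close> plus \<open>B\<close> times the drop of \<open>1 / (n + 1)\<close>, a
    majorant of the absolute difference of \<open>coef\<close>.\<close>
  define \<gamma> where "\<gamma> n = \<beta> n / 2 ^ j - B / real (Suc n)" for n
  have "(\<Sum>n\<in>block j. \<bar>coef (Suc n) - coef n\<bar>) \<le> (\<Sum>n\<in>block j. \<gamma> (Suc n) - \<gamma> n)"
  proof (rule sum_mono)
    fix n assume n: "n \<in> block j"
    then have n': "2 ^ j \<le> Suc n" "Suc n < 2 * 2 ^ j" by (auto simp: block_def)
    have j: "2 ^ j \<le> real (Suc (Suc n))" using n'(1) by (metis of_nat_le_iff of_nat_numeral of_nat_power le_Suc_eq)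
    have eq: "coef (Suc n) - coef n = (\<beta> (Suc n) - \<beta> n) / real (Suc (Suc n)) - \<beta> n * (1 / real (Suc n) - 1 / real (Suc (Suc n)))"
      unfolding ca by (simp add: diff_divide_distrib algebra_simps)
    have "0 \<le> (\<beta> (Suc n) - \<beta> n) / real (Suc (Suc n))" using \<beta>mono[of n "Suc n"] by simp
    moreover have "0 \<le> \<beta> n * (1 / real (Suc n) - 1 / real (Suc (Suc n)))" using \<beta>0[of n] by (intro mult_nonneg_nonneg) (auto simp: frac_le)
    moreover have "(\<beta> (Suc n) - \<beta> n) / real (Suc (Suc n)) \<le> (\<beta> (Suc n) - \<beta> n) / 2 ^ j"
      using \<beta>mono[of n "Suc n"] j by (intro divide_left_mono) auto
    moreover have "\<beta> n * (1 / real (Suc n) - 1 / real (Suc (Suc n))) \<le> B * (1 / real (Suc n) - 1 / real (Suc (Suc n)))"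
      using B[of n] n' by (intro mult_right_mono) (auto simp: \<beta>_def frac_le)
    ultimately show "\<bar>coef (Suc n) - coef n\<bar> \<le> \<gamma> (Suc n) - \<gamma> n"
      unfolding eq \<gamma>_def by (simp add: diff_divide_distrib algebra_simps)
  qed
  also have "\<dots> = \<gamma> (2 ^ Suc j - 1) - \<gamma> (2 ^ j - 1)"
    unfolding block_def by (rule sum_Suc_diff') auto
  also have "\<dots> \<le> \<beta> (2 ^ Suc j - 1) / 2 ^ j + B / 2 ^ j"
  proof -
    have "0 \<le> B" using B[of 0] \<beta>0[of 0] unfolding \<beta>_def by (rule order_trans[rotated]) simp
    moreover have "real (Suc (2 ^ j - 1)) = 2 ^ j" by simp
    ultimately show ?thesis using \<beta>0[of "2 ^ j - 1"] by (simp add: \<gamma>_def field_simps)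
  qed
  also have "\<beta> (2 ^ Suc j - 1) \<le> B" unfolding \<beta>_def by (rule B) simp
  finally show ?thesis by (simp add: field_simps divide_right_mono)
qed


definition wmom :: "(real \<Rightarrow> real) \<Rightarrow> nat \<Rightarrow> real" where
  "wmom \<psi> n = (\<integral>t. t ^ n * (\<psi> t * wt t) \<partial>lebesgue)"

text \<open>The coefficients of the image are \<open>coef n * \<nu> n\<close>, with \<nu> the
  moments of \<open>f\<close> against the weight. The tail in the bound for the moments cancels the
  one in \<open>R / W j\<close>, which bounds \<open>2 ^ j * coef n\<close>. The variation is
  treated by the product rule for differences.\<close>

lemma hilbert_op_bounded:
  assumes C: "doubling C" and A: "reverse_Holder A" and Y: "dyadic_sufficient p Y"
  shows "\<exists>M>0. \<forall>f H. f \<in> borel_measurable (lebesgue_on {0..<1}) \<longrightarrow> 0 \<le> H \<longrightarrow>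
    (\<integral>\<^sup>+t. ennreal (norm (f t) powr p) \<partial>lebesgue_on {0..<1}) \<le> ennreal H \<longrightarrow>
    (\<exists>g. hilbert_op \<omega> f = Some g \<and> g holomorphic_on ball 0 1 \<and> Y g \<le> ennreal ((M * H) powr (1 / p)))"
proof -
  have C1: "1 \<le> C" using C by (simp add: doubling_def)
  obtain E where E: "E > 0" and wmb: "weighted_moments_bounded E"
    using weighted_moment_bound[OF C A] by blast
  obtain M where M: "M > 0" and Yb: "\<forall>c h H g. dyadic_bound p c h \<longrightarrow> disc_series c g \<longrightarrow> 0 \<le> H \<longrightarrow>
     (\<Sum>j. ennreal (h j powr p)) \<le> ennreal H \<longrightarrow> Y g \<le> ennreal ((M * H) powr (1 / p))"
    using Y unfolding dyadic_sufficient_def by blast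
  define W where "W j = tail \<omega> (dyad j)" for j
  have W: "W j > 0" for j by (simp add: W_def dyad_tail_pos)
  define R where "R = C * exp 4"
  have R: "R > 0" using C1 by (simp add: R_def)
  have \<beta>: "1 / (2 * mom (2 * n + 1)) \<le> R / W j" if "n \<le> 2 * 2 ^ j - 1" for n j
  proof -
    have "2 * n + 1 \<le> 4 * 2 ^ j" using that by (cases "n = 0") auto
    then have "W j \<le> R * mom (2 * n + 1)" unfolding W_def R_def by (rule tail_le_mom[OF C])
    moreover have "0 < R * mom (2 * n + 1)" by (intro mult_pos_pos R mom_pos)
    ultimately have "W j \<le> 2 * (R * mom (2 * n + 1))" by linarith
    then show ?thesis using W[of j] mom_pos[of "2 * n + 1"] by (simp add: field_simps)
  qed
  have coef_le: "2 ^ j * coef n \<le> R / W j" if n: "2 ^ j \<le> Suc n" "n \<le> 2 * 2 ^ j - 1" for n j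
  proof -
    have j: "2 ^ j \<le> real (Suc n)" using n(1) by (metis of_nat_le_iff of_nat_numeral of_nat_power)
    have "2 ^ j * coef n = (2 ^ j / real (Suc n)) * (1 / (2 * mom (2 * n + 1)))" by (simp add: coef_def)
    also have "\<dots> \<le> 1 * (1 / (2 * mom (2 * n + 1)))"
      using j mom_pos[of "2 * n + 1"] by (intro mult_right_mono) auto
    also have "\<dots> \<le> R / W j" using \<beta>[OF n(2)] by simp
    finally show ?thesis .
  qed
  define Q where "Q = M * (3 * R) powr p * E"
  have "\<exists>g. hilbert_op \<omega> f = Some g \<and> g holomorphic_on ball 0 1 \<and> Y g \<le> ennreal ((Q * H) powr (1 / p))"
    if f: "f \<in> borel_measurable (lebesgue_on {0..<1})" and H: "0 \<le> H"
      and fH: "(\<integral>\<^sup>+t. ennreal (norm (f t) powr p) \<partial>lebesgue_on {0..<1}) \<le> ennreal H" for f :: "real \<Rightarrow> complex" and H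
  proof -
    define f0 where "f0 t = indicator {0..<1} t *\<^sub>R f t" for t
    have [measurable]: "f0 \<in> borel_measurable lebesgue"
      using f unfolding f0_def by (simp add: borel_measurable_restrict_space_iff)
    define \<psi> where "\<psi> t = norm (f0 t)" for t
    have \<psi>m [measurable]: "\<psi> \<in> borel_measurable lebesgue" unfolding \<psi>_def by measurable
    have \<psi>0: "0 \<le> \<psi> t" for t by (simp add: \<psi>_def)
    have "(\<integral>\<^sup>+t. ennreal (\<psi> t powr p) * indicator {0..<1} t \<partial>lebesgue) = (\<integral>\<^sup>+t. ennreal (norm (f t) powr p) \<partial>lebesgue_on {0..<1})"
      by (subst nn_integral_restrict_space) (auto intro!: nn_integral_cong simp: \<psi>_def f0_def indicator_def)
    then have "(\<integral>\<^sup>+t. ennreal (\<psi> t powr p) * indicator {0..<1} t \<partial>lebesgue) \<le> ennreal H" using fH by (simp only:)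
    from wmb[unfolded weighted_moments_bounded_def, rule_format, OF \<psi>m \<psi>0 H this]
    obtain x where x: "\<forall>j. 0 \<le> x j" "(\<Sum>j. ennreal (x j powr p)) \<le> ennreal (E * H)"
      and xm: "\<forall>j n. 2 ^ j \<le> Suc n \<longrightarrow> (\<integral>\<^sup>+t. ennreal (t ^ n * (\<psi> t * wt t)) \<partial>lebesgue) \<le> ennreal (2 powr (real j / p) * W j * x j)"
      unfolding W_def by blast
    have nn: "0 \<le> t ^ n * (\<psi> t * wt t)" for n t
      by (cases "t \<in> {0..<1}") (auto simp: wt_outside \<psi>0 wt_nonneg)
    have int: "integrable lebesgue (\<lambda>t. t ^ n * (\<psi> t * wt t))" for n
    proof (rule integrableI_nonneg)
      show "(\<integral>\<^sup>+t. ennreal (t ^ n * (\<psi> t * wt t)) \<partial>lebesgue) < \<infinity>"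
        using xm[rule_format, of 0 n] by (simp add: le_less_trans)
    qed (use nn in \<open>auto intro!: AE_I2\<close>)
    have \<mu>le: "wmom \<psi> n \<le> 2 powr (real j / p) * W j * x j" if "2 ^ j \<le> Suc n" for n j
    proof -
      have "ennreal (wmom \<psi> n) = (\<integral>\<^sup>+t. ennreal (t ^ n * (\<psi> t * wt t)) \<partial>lebesgue)"
        unfolding wmom_def by (rule nn_integral_eq_integral[symmetric, OF int]) (use nn in auto)
      also have "\<dots> \<le> ennreal (2 powr (real j / p) * W j * x j)" using xm that by blast
      finally show ?thesis using x(1) W[of j] by (subst (asm) ennreal_le_iff) (auto intro: less_imp_le)
    qed
    have \<mu>0: "0 \<le> wmom \<psi> n" for n unfolding wmom_def using nn by (intro integral_nonneg_AE) auto
    have [measurable]: "(\<lambda>t::real. of_real (t ^ n) :: complex) \<in> borel_measurable lebesgue" for n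
      by (intro measurable_completion) measurable
    define F where "F t = f t * of_real (wt t)" for t
    have Ff: "F t = f0 t * of_real (wt t)" for t by (cases "t \<in> {0..<1}") (auto simp: F_def f0_def wt_outside)
    have [measurable]: "F \<in> borel_measurable lebesgue" unfolding Ff[abs_def] by measurable
    have nF: "norm (of_real (t ^ n) * F t) = t ^ n * (\<psi> t * wt t)" for t n
      by (cases "t \<in> {0..<1}") (auto simp: Ff \<psi>_def norm_mult norm_power wt_nonneg wt_outside)
    have intF: "integrable lebesgue (\<lambda>t. of_real (t ^ n) * F t)" for n
    proof (rule Bochner_Integration.integrable_bound[OF int[of n]])
      show "AE t in lebesgue. norm (of_real (t ^ n) * F t) \<le> norm (t ^ n * (\<psi> t * wt t))"
        unfolding nF using nn by auto
    qed measurable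
    define \<nu> where "\<nu> n = (\<integral>t. of_real (t ^ n) * F t \<partial>lebesgue)" for n
    have \<nu>: "norm (\<nu> n) \<le> wmom \<psi> n" for n
    proof -
      have "norm (\<nu> n) \<le> (\<integral>t. norm (of_real (t ^ n) * F t) \<partial>lebesgue)" unfolding \<nu>_def by (rule integral_norm_bound)
      then show ?thesis by (simp only: nF wmom_def)
    qed
    \<comment> \<open>As \<open>t ^ n - t ^ Suc n\<close> is nonnegative on [0,1), the differences
      of complex moments are dominated by the decrements of those of \<psi>, which telescope over a
      block.\<close>
    have d\<nu>: "norm (\<nu> (Suc n) - \<nu> n) \<le> wmom \<psi> n - wmom \<psi> (Suc n)" for n
    proof -
      have "norm (\<nu> n - \<nu> (Suc n)) = norm (\<integral>t. of_real (t ^ n) * F t - of_real (t ^ Suc n) * F t \<partial>lebesgue)"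
        unfolding \<nu>_def using intF[of n] intF[of "Suc n"] by simp
      also have "\<dots> \<le> (\<integral>t. norm (of_real (t ^ n) * F t - of_real (t ^ Suc n) * F t) \<partial>lebesgue)" by (rule integral_norm_bound)
      also have "\<dots> = (\<integral>t. t ^ n * (\<psi> t * wt t) - t ^ Suc n * (\<psi> t * wt t) \<partial>lebesgue)"
      proof (rule Bochner_Integration.integral_cong[OF refl])
        fix t
        show "norm (of_real (t ^ n) * F t - of_real (t ^ Suc n) * F t) = t ^ n * (\<psi> t * wt t) - t ^ Suc n * (\<psi> t * wt t)"
        proof (cases "t \<in> {0..<1}")
          case True
          have "of_real (t ^ n) * F t - of_real (t ^ Suc n) * F t = of_real (1 - t) * (of_real (t ^ n) * F t)" by (simp add: algebra_simps)
          then have "norm (of_real (t ^ n) * F t - of_real (t ^ Suc n) * F t) = norm (of_real (1 - t) * (of_real (t ^ n) * F t))"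
            by (rule arg_cong)
          also have "\<dots> = \<bar>1 - t\<bar> * norm (of_real (t ^ n) * F t)"
            by (simp only: norm_mult[of "of_real (1 - t)"] norm_of_real)
          also have "\<dots> = (1 - t) * (t ^ n * (\<psi> t * wt t))" using True unfolding nF by simp
          finally show ?thesis by (simp add: algebra_simps)
        qed (simp add: Ff wt_outside)
      qed
      also have "\<dots> = wmom \<psi> n - wmom \<psi> (Suc n)"
        unfolding wmom_def by (rule Bochner_Integration.integral_diff[OF int int])
      finally show ?thesis by (simp add: norm_minus_commute)
    qed
    have \<mu>mono: "wmom \<psi> n \<le> wmom \<psi> m" if "m \<le> n" for m n
      using that
    proof (induction rule: dec_induct)
      case (step k)
      have "wmom \<psi> (Suc k) \<le> wmom \<psi> k" using d\<nu>[of k] norm_ge_zero[of "\<nu> (Suc k) - \<nu> k"] by linarith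
      then show ?case using step by linarith
    qed simp
    have "integrable lebesgue F" using intF[of 0] by simp
    then obtain g where g: "hilbert_op \<omega> f = Some g" "disc_series (\<lambda>n. of_real (coef n) * \<nu> n) g"
      using hilbert_op_series[of f] unfolding F_def \<nu>_def by blast
    define c where "c n = complex_of_real (coef n) * \<nu> n" for n
    \<comment> \<open>Twice \<open>R * x j\<close> from the variation of \<open>coef\<close>, once
      from the variation of the moments.\<close>
    define h where "h j = 3 * R * x j" for j
    have "dyadic_bound p c h"
      unfolding dyadic_bound_def
    proof (intro allI conjI ballI)
      fix j
      show "0 \<le> h j" using x R by (simp add: h_def)
      define m where "m = wmom \<psi> (2 ^ j - 1)"
      have m: "m \<le> 2 powr (real j / p) * W j * x j" unfolding m_def by (rule \<mu>le) simp
      have m0: "0 \<le> m" unfolding m_def by (rule \<mu>0)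
      have mR: "R / W j * m \<le> 2 powr (real j / p) * (R * x j)"
        using mult_left_mono[OF m, of "R / W j"] W[of j] R by (simp add: mult_ac)
      {
        fix n assume "n \<in> block j"
        then have n: "2 ^ j \<le> Suc n" "n \<le> 2 * 2 ^ j - 1" "2 ^ j - 1 \<le> n" by (auto simp: block_def)
        have "2 ^ j * norm (c n) = (2 ^ j * coef n) * norm (\<nu> n)" using coef_pos[of n] by (simp add: c_def norm_mult)
        also have "\<dots> \<le> R / W j * m"
          using coef_le[OF n(1,2)] \<nu>[of n] \<mu>mono[OF n(3)] R W[of j] by (intro mult_mono) (auto simp: m_def less_imp_le)
        also have "\<dots> \<le> 2 powr (real j / p) * (R * x j)" by (rule mR)
        also have "\<dots> \<le> 2 powr (real j / p) * h j" using R x by (intro mult_left_mono) (auto simp: h_def)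
        finally show "2 ^ j * norm (c n) \<le> 2 powr (real j / p) * h j" .
      }
      have v: "norm (c (Suc n) - c n) \<le> \<bar>coef (Suc n) - coef n\<bar> * m + (R / W j / 2 ^ j) * (wmom \<psi> n - wmom \<psi> (Suc n))" if "n \<in> block j" for n
      proof -
        have n: "2 ^ j \<le> Suc (Suc n)" "Suc n \<le> 2 * 2 ^ j - 1" "2 ^ j - 1 \<le> n" using that by (auto simp: block_def)
        have "c (Suc n) - c n = of_real (coef (Suc n) - coef n) * \<nu> n + of_real (coef (Suc n)) * (\<nu> (Suc n) - \<nu> n)"
          by (simp add: c_def algebra_simps)
        then have "norm (c (Suc n) - c n) \<le> norm (of_real (coef (Suc n) - coef n) * \<nu> n) + norm (of_real (coef (Suc n)) * (\<nu> (Suc n) - \<nu> n))"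
          by (metis norm_triangle_ineq)
        also have "\<dots> = \<bar>coef (Suc n) - coef n\<bar> * norm (\<nu> n) + coef (Suc n) * norm (\<nu> (Suc n) - \<nu> n)"
          using coef_pos[of "Suc n"] by (simp add: norm_mult flip: of_real_diff)
        also have "\<dots> \<le> \<bar>coef (Suc n) - coef n\<bar> * m + (R / W j / 2 ^ j) * (wmom \<psi> n - wmom \<psi> (Suc n))"
        proof (intro add_mono mult_mono)
          show "norm (\<nu> n) \<le> m" using \<nu>[of n] \<mu>mono[OF n(3)] by (simp add: m_def)
          show "coef (Suc n) \<le> R / W j / 2 ^ j" using coef_le[OF n(1,2)] by (subst pos_le_divide_eq) (simp_all add: mult.commute)
        qed (use d\<nu> R W[of j] in auto)
        finally show ?thesis .
      qed
      have "(\<Sum>n\<in>block j. norm (c (Suc n) - c n)) \<le> (\<Sum>n\<in>block j. \<bar>coef (Suc n) - coef n\<bar> * m + (R / W j / 2 ^ j) * (wmom \<psi> n - wmom \<psi> (Suc n)))"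
        by (rule sum_mono) (rule v)
      also have "\<dots> = (\<Sum>n\<in>block j. \<bar>coef (Suc n) - coef n\<bar>) * m + (R / W j / 2 ^ j) * (\<Sum>n\<in>block j. wmom \<psi> n - wmom \<psi> (Suc n))"
        by (simp only: sum.distrib sum_distrib_left sum_distrib_right)
      also have "(\<Sum>n\<in>block j. wmom \<psi> n - wmom \<psi> (Suc n)) = wmom \<psi> (2 ^ j - 1) - wmom \<psi> (2 ^ Suc j - 1)"
      proof -
        have "(\<Sum>n\<in>block j. (- wmom \<psi> (Suc n)) - (- wmom \<psi> n)) = (- wmom \<psi> (2 ^ Suc j - 1)) - (- wmom \<psi> (2 ^ j - 1))"
          unfolding block_def by (rule sum_Suc_diff'[of _ _ "\<lambda>n. - wmom \<psi> n"]) auto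
        then show ?thesis by (simp add: algebra_simps)
      qed
      finally have "2 ^ j * (\<Sum>n\<in>block j. norm (c (Suc n) - c n)) \<le> 2 ^ j * ((\<Sum>n\<in>block j. \<bar>coef (Suc n) - coef n\<bar>) * m + (R / W j / 2 ^ j) * (wmom \<psi> (2 ^ j - 1) - wmom \<psi> (2 ^ Suc j - 1)))"
        by (intro mult_left_mono) auto
      also have "\<dots> = (2 ^ j * (\<Sum>n\<in>block j. \<bar>coef (Suc n) - coef n\<bar>)) * m + R / W j * (m - wmom \<psi> (2 ^ Suc j - 1))"
        by (simp add: m_def distrib_left mult.assoc)
      also have "\<dots> \<le> 2 * (R / W j) * m + R / W j * m"
        using coef_variation[of j "R / W j", OF \<beta>] m0 \<mu>0 R W[of j] by (intro add_mono mult_right_mono mult_left_mono) auto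
      also have "\<dots> = 3 * (R / W j * m)" by simp
      also have "\<dots> \<le> 3 * (2 powr (real j / p) * (R * x j))" using mR by simp
      also have "\<dots> = 2 powr (real j / p) * h j" by (simp add: h_def mult_ac)
      finally show "2 ^ j * (\<Sum>n\<in>block j. norm (c (Suc n) - c n)) \<le> 2 powr (real j / p) * h j" .
    qed
    moreover have "(\<Sum>j. ennreal (h j powr p)) \<le> ennreal ((3 * R) powr p * (E * H))"
    proof -
      have "(\<Sum>j. ennreal (h j powr p)) = (\<Sum>j. ennreal ((3 * R) powr p) * ennreal (x j powr p))"
        by (simp add: h_def powr_mult ennreal_mult)
      also have "\<dots> = ennreal ((3 * R) powr p) * (\<Sum>j. ennreal (x j powr p))" by (rule ennreal_suminf_cmult)
      also have "\<dots> \<le> ennreal ((3 * R) powr p) * ennreal (E * H)" by (intro mult_left_mono x) auto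
      finally show ?thesis using E H by (simp flip: ennreal_mult)
    qed
    moreover have "disc_series c g" using g(2) by (simp only: c_def[abs_def])
    moreover have "0 \<le> (3 * R) powr p * (E * H)" using E H by simp
    ultimately have "Y g \<le> ennreal ((M * ((3 * R) powr p * (E * H))) powr (1 / p))"
      using Yb by blast
    then have "Y g \<le> ennreal ((Q * H) powr (1 / p))" by (simp only: Q_def mult.assoc)
    then show ?thesis using g disc_series_holomorphic by blast
  qed
  moreover have "Q > 0" using M R E by (simp add: Q_def)
  ultimately show ?thesis by blast
qed

end

context radial_pq
begin

text \<open>The second operator is the first one applied to \<open>norm (f t)\<close>, which has the
  same norm as \<open>f\<close>, so one estimate serves both.\<close>

lemma bounded_from_Lp_of_reverse_Holder:
  assumes C: "doubling C" and A: "reverse_Holder A" and Y: "dyadic_sufficient p Y"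
    and T: "T \<in> {hilbert_op \<omega>, hilbert_op_abs \<omega>}"
  shows "bounded_from_Lp p Y T"
proof -
  obtain M where M: "M > 0" and hb: "\<forall>f H. f \<in> borel_measurable (lebesgue_on {0..<1}) \<longrightarrow> 0 \<le> H \<longrightarrow>
    (\<integral>\<^sup>+t. ennreal (norm (f t) powr p) \<partial>lebesgue_on {0..<1}) \<le> ennreal H \<longrightarrow>
    (\<exists>g. hilbert_op \<omega> f = Some g \<and> g holomorphic_on ball 0 1 \<and> Y g \<le> ennreal ((M * H) powr (1 / p)))"
    using hilbert_op_bounded[OF C A Y] by blast
  have Tb: "\<exists>g. T f = Some g \<and> g holomorphic_on ball 0 1 \<and> Y g \<le> ennreal ((M * H) powr (1 / p))"
    if f: "f \<in> borel_measurable (lebesgue_on {0..<1})" and H: "0 \<le> H"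
      and fH: "(\<integral>\<^sup>+t. ennreal (norm (f t) powr p) \<partial>lebesgue_on {0..<1}) \<le> ennreal H" for f :: "real \<Rightarrow> complex" and H
  proof -
    have "(\<lambda>t. complex_of_real (norm (f t))) \<in> borel_measurable (lebesgue_on {0..<1})" using f by measurable
    moreover have "(\<integral>\<^sup>+t. ennreal (norm (complex_of_real (norm (f t))) powr p) \<partial>lebesgue_on {0..<1}) \<le> ennreal H" using fH by simp
    ultimately have "\<exists>g. hilbert_op_abs \<omega> f = Some g \<and> g holomorphic_on ball 0 1 \<and> Y g \<le> ennreal ((M * H) powr (1 / p))"
      unfolding hilbert_op_abs_def using hb H by blast
    moreover have "\<exists>g. hilbert_op \<omega> f = Some g \<and> g holomorphic_on ball 0 1 \<and> Y g \<le> ennreal ((M * H) powr (1 / p))"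
      using hb f H fH by blast
    ultimately show ?thesis using T by auto
  qed
  have "\<exists>g. T f = Some g \<and> g \<in> analytic_space Y" if f: "f \<in> space_Lp p" for f
  proof -
    define I where "I = (\<integral>\<^sup>+t. ennreal (norm (f t) powr p) \<partial>lebesgue_on {0..<1})"
    have "I < top" using f finite_of_enn_powr[of I "1 / p"] by (simp add: space_Lp_def norm_Lp_def I_def)
    then have "I \<le> ennreal (enn2real I)" by simp
    then obtain g where "T f = Some g" "g holomorphic_on ball 0 1" "Y g \<le> ennreal ((M * enn2real I) powr (1 / p))"
      using Tb[of f "enn2real I"] f by (auto simp: space_Lp_def I_def)
    then show ?thesis by (auto simp: analytic_space_def intro: le_less_trans)
  qed
  moreover have "(SUP f\<in>{f \<in> space_Lp p. norm_Lp p f \<le> 1}. Y (the (T f))) \<le> ennreal ((M * 1) powr (1 / p))"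
  proof (rule SUP_least)
    fix f assume f: "f \<in> {f \<in> space_Lp p. norm_Lp p f \<le> 1}"
    have "(\<integral>\<^sup>+t. ennreal (norm (f t) powr p) \<partial>lebesgue_on {0..<1}) \<le> ennreal (1 powr p)"
      using f p by (intro le_of_enn_powr_le) (auto simp: norm_Lp_def)
    then obtain g where "T f = Some g" "Y g \<le> ennreal ((M * 1) powr (1 / p))"
      using Tb[of f 1] f by (auto simp: space_Lp_def)
    then show "Y (the (T f)) \<le> ennreal ((M * 1) powr (1 / p))" by simp
  qed
  then have "(SUP f\<in>{f \<in> space_Lp p. norm_Lp p f \<le> 1}. Y (the (T f))) < top" by (rule le_less_trans) simp
  ultimately show ?thesis by (simp add: bounded_from_Lp_def)
qed

section \<open>Necessity\<close>

text \<open>Boundedness of \<open>F\<close> makes \<open>F t * wt t\<close> integrable, so the image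
  is a power series with coefficients \<open>coef n * wmom F n\<close>. The estimate is uniform in
  \<open>b\<close>, which lets the truncation level go to infinity later.\<close>

definition block_tested :: "real \<Rightarrow> bool" where
  "block_tested K \<longleftrightarrow> (\<forall>F A N b. F \<in> borel_measurable lebesgue \<longrightarrow> (\<forall>t. 0 \<le> F t \<and> F t \<le> b) \<longrightarrow> 0 < A \<longrightarrow> 0 < N \<longrightarrow>
    (\<integral>\<^sup>+t. ennreal (F t powr p) * indicator {0..<1} t \<partial>lebesgue) \<le> ennreal (A powr p) \<longrightarrow>
    (\<Sum>n\<in>{N - 1..<2 * N - 1}. coef n * wmom F n) \<le> K * real N powr (1 / p) * A)"

lemma block_test:
  assumes Y: "block_growth p Y" and T: "T \<in> {hilbert_op \<omega>, hilbert_op_abs \<omega>}" and bdd: "bounded_from_Lp p Y T"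
  shows "\<exists>K>0. block_tested K"
proof -
  obtain K where K: "K > 0" and bg: "\<forall>c g B N. (\<forall>n. 0 \<le> c n) \<longrightarrow> disc_series (\<lambda>n. of_real (c n)) g \<longrightarrow> 0 \<le> B \<longrightarrow>
     Y g \<le> ennreal B \<longrightarrow> 0 < N \<longrightarrow> (\<Sum>n\<in>{N - 1..<2 * N - 1}. c n) \<le> K * real N powr (1 / p) * B"
    using Y unfolding block_growth_def by blast
  define S where "S = (SUP f\<in>{f \<in> space_Lp p. norm_Lp p f \<le> 1}. Y (the (T f)))"
  have S: "S < top" using bdd by (simp add: bounded_from_Lp_def S_def)
  define B where "B = enn2real S + 1"
  have B: "B > 0" by (simp add: B_def add_nonneg_pos)
  have SB: "S \<le> ennreal B"
  proof -
    have "S = ennreal (enn2real S)" using S by simp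
    also have "\<dots> \<le> ennreal B" by (intro ennreal_leI) (simp add: B_def)
    finally show ?thesis .
  qed
  have "(\<Sum>n\<in>{N - 1..<2 * N - 1}. coef n * wmom F n) \<le> (K * B) * real N powr (1 / p) * A"
    if [measurable]: "F \<in> borel_measurable lebesgue" and F: "\<forall>t. 0 \<le> F t \<and> F t \<le> b" and A: "0 < A" and N: "0 < N"
      and FA: "(\<integral>\<^sup>+t. ennreal (F t powr p) * indicator {0..<1} t \<partial>lebesgue) \<le> ennreal (A powr p)" for F A b and N :: nat
  proof -
    define f where "f t = complex_of_real (F t / A)" for t
    have [measurable]: "f \<in> borel_measurable lebesgue" unfolding f_def by measurable
    have fm: "f \<in> borel_measurable (lebesgue_on {0..<1})" by (rule measurable_restrict_space1) measurable
    have "(\<integral>\<^sup>+t. ennreal (norm (f t) powr p) \<partial>lebesgue_on {0..<1}) = (\<integral>\<^sup>+t. ennreal (norm (f t) powr p) * indicator {0..<1} t \<partial>lebesgue)"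
      by (subst nn_integral_restrict_space) auto
    also have "\<dots> = (\<integral>\<^sup>+t. ennreal (1 / A powr p) * (ennreal (F t powr p) * indicator {0..<1} t) \<partial>lebesgue)"
    proof (intro nn_integral_cong)
      fix t
      have "norm (f t) powr p = (1 / A powr p) * F t powr p"
        using F A by (simp add: f_def powr_divide norm_divide)
      then have "ennreal (norm (f t) powr p) = ennreal (1 / A powr p) * ennreal (F t powr p)"
        by (simp only:) (rule ennreal_mult, auto)
      then show "ennreal (norm (f t) powr p) * indicator {0..<1} t = ennreal (1 / A powr p) * (ennreal (F t powr p) * indicator {0..<1} t)"
        by (simp only: mult.assoc)
    qed
    also have "\<dots> = ennreal (1 / A powr p) * (\<integral>\<^sup>+t. ennreal (F t powr p) * indicator {0..<1} t \<partial>lebesgue)"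
      by (rule nn_integral_cmult) measurable
    also have "\<dots> \<le> ennreal (1 / A powr p) * ennreal (A powr p)" by (intro mult_left_mono FA) auto
    also have "\<dots> = ennreal 1" using A by (simp flip: ennreal_mult)
    finally have "norm_Lp p f \<le> ennreal (1 powr (1 / p))"
      unfolding norm_Lp_def using p by (intro enn_powr_le) auto
    then have f1: "norm_Lp p f \<le> 1" by simp
    then have fL: "f \<in> {f \<in> space_Lp p. norm_Lp p f \<le> 1}" using fm by (auto simp: space_Lp_def intro: le_less_trans)
    have b0: "0 \<le> b" using F[rule_format, of 0] by linarith
    have int: "integrable lebesgue (\<lambda>t. t ^ n * (F t * wt t))" for n
    proof (rule Bochner_Integration.integrable_bound[OF integrable_mult_right[OF integrable_power_wt[of n], of b]])
      show "AE t in lebesgue. norm (t ^ n * (F t * wt t)) \<le> norm (b * (t ^ n * wt t))"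
      proof (rule AE_I2)
        fix t
        have "\<bar>F t\<bar> * \<bar>t ^ n * wt t\<bar> \<le> \<bar>b\<bar> * \<bar>t ^ n * wt t\<bar>" using F b0 by (intro mult_right_mono) auto
        then show "norm (t ^ n * (F t * wt t)) \<le> norm (b * (t ^ n * wt t))" by (simp add: abs_mult mult_ac)
      qed
    qed measurable
    have "integrable lebesgue (\<lambda>t. complex_of_real (1 / A * (t ^ 0 * (F t * wt t))))"
      by (intro integrable_of_real integrable_mult_right int)
    then have "integrable lebesgue (\<lambda>t. f t * of_real (wt t))" by (simp add: f_def)
    then obtain g where g: "hilbert_op \<omega> f = Some g"
      "disc_series (\<lambda>n. of_real (coef n) * (\<integral>t. of_real (t ^ n) * (f t * of_real (wt t)) \<partial>lebesgue)) g"
      by (rule hilbert_op_series)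
    \<comment> \<open>On nonnegative functions the two operators coincide.\<close>
    have "(\<lambda>t. complex_of_real (norm (f t))) = f" using F A by (intro ext) (simp add: f_def norm_divide)
    then have Tf: "T f = Some g" using T g(1) by (auto simp: hilbert_op_abs_def)
    have "Y (the (T f)) \<le> S" unfolding S_def using fL by (rule SUP_upper)
    then have Yg: "Y g \<le> ennreal B" using Tf SB by simp
    define c where "c n = coef n * (wmom F n / A)" for n
    have "(\<integral>t. of_real (t ^ n) * (f t * of_real (wt t)) \<partial>lebesgue) = complex_of_real (wmom F n / A)" for n
    proof -
      have "(\<integral>t. of_real (t ^ n) * (f t * of_real (wt t)) \<partial>lebesgue) = (\<integral>t. complex_of_real (1 / A * (t ^ n * (F t * wt t))) \<partial>lebesgue)"
        by (intro Bochner_Integration.integral_cong refl) (simp add: f_def)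
      also have "\<dots> = complex_of_real (\<integral>t. 1 / A * (t ^ n * (F t * wt t)) \<partial>lebesgue)" by (rule integral_of_real) (intro integrable_mult_right int)
      also have "(\<integral>t. 1 / A * (t ^ n * (F t * wt t)) \<partial>lebesgue) = 1 / A * wmom F n" unfolding wmom_def by (rule integral_mult_right_zero)
      finally show ?thesis by simp
    qed
    then have "disc_series (\<lambda>n. of_real (c n)) g" using g(2) by (simp add: c_def)
    moreover have "0 \<le> c n" for n
    proof -
      have "0 \<le> t ^ n * (F t * wt t)" for t using F by (cases "t \<in> {0..<1}") (auto simp: wt_outside wt_nonneg)
      then have "0 \<le> wmom F n" unfolding wmom_def by (intro integral_nonneg_AE) auto
      then show ?thesis using A coef_pos[of n] by (simp add: c_def)
    qed
    ultimately have "(\<Sum>n\<in>{N - 1..<2 * N - 1}. c n) \<le> K * real N powr (1 / p) * B"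
      using bg[rule_format, of c g B N] Yg B N by auto
    moreover have "(\<Sum>n\<in>{N - 1..<2 * N - 1}. c n) = (\<Sum>n\<in>{N - 1..<2 * N - 1}. coef n * wmom F n) / A"
      by (simp add: c_def sum_divide_distrib)
    ultimately show ?thesis using A by (simp add: pos_divide_le_eq mult_ac)
  qed
  then show ?thesis unfolding block_tested_def using K B by (intro exI[of _ "K * B"] conjI) (simp, blast)
qed

text \<open>
  Tested on \<open>t ^ m\<close>, the coefficients are \<open>coef n * mom (n + m)\<close>. For \<open>7 * m \<le> n + 1 < 8 * m\<close> we have
  \<open>n + m \<le> 9 * m\<close> and \<open>2 * n + 1 \<ge> 14 * m - 1\<close>, hence \<open>mom (9 * m) \<le> D * mom (14 * m - 1)\<close>. The ratio is
  less than 2, but using this at \<open>2 * m\<close> and then at \<open>3 * m\<close> leads from \<open>18 * m\<close> beyond \<open>36 * m\<close>.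
\<close>

lemma doubling_of_bounded:
  assumes Y: "block_growth p Y" and T: "T \<in> {hilbert_op \<omega>, hilbert_op_abs \<omega>}" and bdd: "bounded_from_Lp p Y T"
  shows "\<exists>C. doubling C"
proof -
  obtain K where K: "K > 0" and bt: "block_tested K"
    using block_test[OF assms] by blast
  \<comment> \<open>16 bounds \<open>2 * (n + 1) / m\<close> on the indices used, and
    \<open>4 powr (1 / p)\<close> comes from testing with \<open>N = 4 * m\<close>, whose range up
    to \<open>8 * m - 1\<close> contains them.\<close>
  define D where "D = 16 * K * 4 powr (1 / p)"
  have D: "D > 0" using K by (simp add: D_def)
  have key: "mom (9 * m) \<le> D * mom (14 * m - 1)" if m: "0 < m" for m
  proof -
    define F where "F t = t ^ m * indicator {0..<1} t" for t :: real
    have [measurable]: "F \<in> borel_measurable lebesgue" unfolding F_def by measurable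
    have F: "\<forall>t. 0 \<le> F t \<and> F t \<le> 1" by (auto simp: F_def indicator_def power_le_one)
    \<comment> \<open>The integral of \<open>t powr (m * p)\<close> is
      \<open>1 / (m * p + 1)\<close>, at most \<open>1 / m\<close>; so \<open>A\<close> bounds the
      norm of the power and cancels the growth of \<open>N powr (1 / p)\<close>.\<close>
    define A where "A = (1 / real m) powr (1 / p)"
    have A: "A > 0" "A powr p = 1 / real m" using m p by (auto simp: A_def powr_powr)
    have "(\<integral>\<^sup>+t. ennreal (F t powr p) * indicator {0..<1} t \<partial>lebesgue) \<le> (\<integral>\<^sup>+t. ennreal (t powr (real m * p)) * indicator {0..1} t \<partial>lborel)"
      unfolding nn_integral_completion
    proof (rule nn_integral_mono)
      fix t :: real
      show "ennreal (F t powr p) * indicator {0..<1} t \<le> ennreal (t powr (real m * p)) * indicator {0..1} t"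
      proof (cases "t \<in> {0..<1}")
        case True
        have "F t powr p = t powr (real m * p)"
          using True m p by (cases "t = 0") (auto simp: F_def powr_powr simp flip: powr_realpow)
        then show ?thesis using True by simp
      qed simp
    qed
    also have "\<dots> = ennreal (1 / (real m * p + 1))"
    proof -
      have mp: "0 \<le> real m * p" using p by simp
      have hi: "((\<lambda>t. t powr (real m * p)) has_integral (1 powr (real m * p + 1) / (real m * p + 1))) {0..1}"
        using mp by (intro has_integral_powr_from_0) auto
      show ?thesis using nn_integral_has_integral_lebesgue'[OF _ hi] by simp
    qed
    also have "\<dots> \<le> ennreal (A powr p)"
    proof (intro ennreal_leI)
      have "real m * 1 \<le> real m * p" using p by (intro mult_left_mono) auto
      then have "real m \<le> real m * p + 1" by simp
      then show "1 / (real m * p + 1) \<le> A powr p" unfolding A(2) using m by (intro divide_left_mono) auto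
    qed
    finally have "(\<Sum>n\<in>{4 * m - 1..<2 * (4 * m) - 1}. coef n * wmom F n) \<le> K * real (4 * m) powr (1 / p) * A"
      using bt[unfolded block_tested_def, rule_format, of F 1 A "4 * m"] F A(1) m by simp
    also have "\<dots> = K * 4 powr (1 / p)"
      using m by (simp add: A_def powr_mult powr_divide)
    finally have up: "(\<Sum>n\<in>{4 * m - 1..<2 * (4 * m) - 1}. coef n * wmom F n) \<le> K * 4 powr (1 / p)" .
    have wF: "wmom F n = mom (n + m)" for n
    proof -
      have "t ^ n * (F t * wt t) = t ^ (n + m) * wt t" for t
        by (cases "t \<in> {0..<1}") (auto simp: F_def power_add wt_outside)
      then show ?thesis unfolding wmom_def moment_eq by (simp only:)
    qed
    have "mom (9 * m) / (16 * mom (14 * m - 1)) = (\<Sum>n\<in>{7 * m - 1..<8 * m - 1}. mom (9 * m) / (16 * real m * mom (14 * m - 1)))"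
      using m by simp
    also have "\<dots> \<le> (\<Sum>n\<in>{7 * m - 1..<8 * m - 1}. coef n * wmom F n)"
    proof (rule sum_mono)
      fix n assume n: "n \<in> {7 * m - 1..<8 * m - 1}"
      have "real (Suc n) \<le> 8 * real m" using n by auto
      have mm: "mom (2 * n + 1) \<le> mom (14 * m - 1)" using n m by (intro mom_antimono) auto
      have "mom (9 * m) / (16 * real m * mom (14 * m - 1)) = (1 / (16 * real m * mom (14 * m - 1))) * mom (9 * m)" by simp
      also have "\<dots> \<le> coef n * mom (n + m)"
      proof (rule mult_mono)
        have "2 * real (Suc n) * mom (2 * n + 1) \<le> 16 * real m * mom (14 * m - 1)"
          using \<open>real (Suc n) \<le> 8 * real m\<close> mm mom_pos[of "2 * n + 1"] by (intro mult_mono[of "2 * real (Suc n)"]) auto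
        then show "1 / (16 * real m * mom (14 * m - 1)) \<le> coef n"
          unfolding coef_def using mom_pos[of "2 * n + 1"] mom_pos[of "14 * m - 1"] m by (intro divide_left_mono mult_pos_pos) auto
        show "mom (9 * m) \<le> mom (n + m)" using n by (intro mom_antimono) auto
      qed (use coef_pos[of n] mom_pos[of "9 * m"] in \<open>auto intro: less_imp_le\<close>)
      finally show "mom (9 * m) / (16 * real m * mom (14 * m - 1)) \<le> coef n * wmom F n" by (simp add: wF)
    qed
    also have "\<dots> \<le> (\<Sum>n\<in>{4 * m - 1..<2 * (4 * m) - 1}. coef n * wmom F n)"
    proof (rule sum_mono2)
      show "0 \<le> coef n * wmom F n" for n
        using coef_pos[of n] mom_pos[of "n + m"] unfolding wF by (intro mult_nonneg_nonneg less_imp_le)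
    qed (use m in auto)
    also have "\<dots> \<le> K * 4 powr (1 / p)" by (rule up)
    finally show ?thesis using mom_pos[of "14 * m - 1"] by (simp add: D_def field_simps)
  qed
  have "mom (18 * m) \<le> (D * D) * mom (36 * m)" if m: "0 < m" for m
  proof -
    have "mom (18 * m) \<le> D * mom (14 * (2 * m) - 1)" using key[of "2 * m"] m by simp
    \<comment> \<open>The hand-over between the two uses: \<open>28 * m - 1 \<ge> 27 * m\<close>.
      The second use ends at \<open>42 * m - 1\<close>, beyond \<open>36 * m\<close>.\<close>
    also have "\<dots> \<le> D * mom (9 * (3 * m))" using D m by (intro mult_left_mono mom_antimono) auto
    also have "\<dots> \<le> D * (D * mom (14 * (3 * m) - 1))" using D m by (intro mult_left_mono key) auto
    also have "\<dots> \<le> D * (D * mom (36 * m))" using D m by (intro mult_left_mono mom_antimono) auto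
    finally show ?thesis by (simp add: mult.assoc)
  qed
  then show ?thesis using D by (intro doubling_of_mom[of "D * D"]) auto
qed

text \<open>The test function \<open>F\<close> is the extremal one for Hoelder's inequality,
  \<open>v powr (q - 1)\<close> on \<open>[dyad k, 1)\<close> with \<open>v\<close> the truncation
  of the weight. The p-th power of \<open>F\<close> is \<open>v powr q\<close>, and \<open>F\<close>
  times the weight is at least \<open>v powr q\<close>. So the same integral \<open>J\<close> stands
  on both sides, once to the power 1 and once to the power \<open>1 / p\<close>; truncation makes it
  finite, and it can be divided out.\<close>

lemma reverse_Holder_of_bounded:
  assumes C: "doubling C"
    and Y: "block_growth p Y" and T: "T \<in> {hilbert_op \<omega>, hilbert_op_abs \<omega>}" and bdd: "bounded_from_Lp p Y T"
  shows "\<exists>A. reverse_Holder A"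
proof -
  obtain K where K: "K > 0" and bt: "block_tested K"
    using block_test[OF Y T bdd] by blast
  obtain L where L: "L > 0" "\<And>n j. 2 ^ j \<le> Suc n \<Longrightarrow> mom n \<le> L * tail \<omega> (dyad j)"
    using mom_le_tail[OF C] by blast
  define W where "W k = tail \<omega> (dyad k)" for k
  have W: "W k > 0" for k by (simp add: W_def dyad_tail_pos)
  have qp: "(q - 1) * p = q"
  proof -
    have "q + p = p * q" using pq p q by (simp add: field_simps)
    then show ?thesis by (simp add: algebra_simps)
  qed
  \<comment> \<open>\<open>exp 4\<close> from \<open>dyad k ^ n\<close> on block \<open>k\<close>, 4
    from \<open>2 * (n + 1) \<le> 4 * 2 ^ k\<close>, and \<open>L\<close> from bounding the moments
    by the tail.\<close>
  define A0 where "A0 = 4 * exp 4 * L * K"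
  have A0: "A0 > 0" using K L by (simp add: A0_def)
  have main: "(\<integral>\<^sup>+t. ennreal (min (wt t) M powr q) * indicator {dyad k..<1} t \<partial>lebesgue) \<le> ennreal ((A0 * 2 powr (real k / p) * W k) powr q)"
    if M: "0 < M" for M k
  proof -
    define v where "v t = min (wt t) M" for t
    have [measurable]: "v \<in> borel_measurable lebesgue" unfolding v_def by measurable
    have v: "0 \<le> v t" "v t \<le> M" "v t \<le> wt t" for t using M wt_nonneg by (auto simp: v_def)
    define F where "F t = v t powr (q - 1) * indicator {dyad k..<1} t" for t
    have [measurable]: "F \<in> borel_measurable lebesgue" unfolding F_def by measurable
    have F: "\<forall>t. 0 \<le> F t \<and> F t \<le> M powr (q - 1)" using v q by (auto simp: F_def indicator_def intro!: powr_mono2)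
    have Fp: "ennreal (F t powr p) = ennreal (v t powr q) * indicator {dyad k..<1} t" for t
      using qp by (auto simp: F_def indicator_def powr_powr)
    define J where "J = (\<integral>t. v t powr q * indicator {dyad k..<1} t \<partial>lebesgue)"
    have vq0: "0 \<le> v t powr q * indicator {dyad k..<1} t" for t by simp
    have int: "integrable lebesgue (\<lambda>t. v t powr q * indicator {dyad k..<1} t)"
    proof (rule Bochner_Integration.integrable_bound)
      show "integrable lebesgue (\<lambda>t. M powr q * indicator {dyad k..<1} t)"
        by (intro integrable_mult_right integrable_real_indicator) (auto simp: dyad_less_1 less_imp_le)
      show "AE t in lebesgue. norm (v t powr q * indicator {dyad k..<1} t) \<le> norm (M powr q * indicator {dyad k..<1} t)"
        using v q by (auto simp: indicator_def intro!: powr_mono2)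
    qed measurable
    have J0: "0 \<le> J" unfolding J_def using vq0 by (intro integral_nonneg_AE) auto
    have Je: "(\<integral>\<^sup>+t. ennreal (v t powr q) * indicator {dyad k..<1} t \<partial>lebesgue) = ennreal J"
    proof -
      have "(\<integral>\<^sup>+t. ennreal (v t powr q * indicator {dyad k..<1} t) \<partial>lebesgue) = ennreal J"
        unfolding J_def by (rule nn_integral_eq_integral[OF int]) simp
      moreover have "ennreal (v t powr q * indicator {dyad k..<1} t) = ennreal (v t powr q) * indicator {dyad k..<1} t" for t
        by (simp add: indicator_def)
      ultimately show ?thesis by simp
    qed
    have "J \<le> (A0 * 2 powr (real k / p) * W k) powr q"
    proof (cases "J = 0")
      case False
      then have Jp: "J > 0" using J0 by simp
      define A where "A = J powr (1 / p)"
      have A: "A > 0" "A powr p = J" using Jp p by (auto simp: A_def powr_powr)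
      have "(\<integral>\<^sup>+t. ennreal (F t powr p) * indicator {0..<1} t \<partial>lebesgue) \<le> (\<integral>\<^sup>+t. ennreal (v t powr q) * indicator {dyad k..<1} t \<partial>lebesgue)"
        unfolding Fp by (intro nn_integral_mono) (auto simp: indicator_def)
      then have "(\<integral>\<^sup>+t. ennreal (F t powr p) * indicator {0..<1} t \<partial>lebesgue) \<le> ennreal (A powr p)"
        unfolding Je A(2) .
      then have up: "(\<Sum>n\<in>{2 ^ k - 1..<2 * 2 ^ k - 1}. coef n * wmom F n) \<le> K * real (2 ^ k) powr (1 / p) * A"
        using bt[unfolded block_tested_def, rule_format, of F "M powr (q - 1)" A "2 ^ k"] F A(1) by auto
      have wF: "exp (- 4) * J \<le> wmom F n" if n: "n \<in> block k" for n
      proof -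
        have "exp (- 4) \<le> dyad k ^ n"
        \<comment> \<open>For \<open>k = 0\<close> the base is 0, but the block consists of
          \<open>n = 0\<close> alone and the power is 1.\<close>
        proof (cases "k = 0")
          case True
          then have "n = 0" using n by (simp add: block_def)
          then show ?thesis by simp
        next
          case False
          define x where "x = (1/2::real) ^ k"
          have x: "0 \<le> x" "x \<le> 1/2" using False power_decreasing[of 1 k "1/2::real"] by (auto simp: x_def)
          have "Suc n \<le> 2 * 2 ^ k" using blockD(2)[OF n] by simp
          then have "real (Suc n) \<le> real (2 * 2 ^ k)" by (simp only: of_nat_le_iff)
          then have "real n \<le> 2 * 2 ^ k" by simp
          then have "2 * x * real n \<le> 2 * x * (2 * 2 ^ k)" using x by (intro mult_left_mono) auto
          also have "\<dots> = 4" by (simp add: x_def power_divide)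
          finally have "exp (- 4) \<le> exp (- (2 * x * real n))" by simp
          also have "\<dots> \<le> (1 - x) ^ n" by (rule one_minus_power_ge[OF x])
          finally show ?thesis by (simp add: dyad_def x_def)
        qed
        then have "exp (- 4) * J \<le> dyad k ^ n * J" using J0 by (intro mult_right_mono) auto
        also have "\<dots> = (\<integral>t. dyad k ^ n * (v t powr q * indicator {dyad k..<1} t) \<partial>lebesgue)" by (simp add: J_def)
        also have "\<dots> \<le> wmom F n"
          unfolding wmom_def
        proof (rule integral_mono)
          show "integrable lebesgue (\<lambda>t. dyad k ^ n * (v t powr q * indicator {dyad k..<1} t))" by (intro integrable_mult_right int)
          show "integrable lebesgue (\<lambda>t. t ^ n * (F t * wt t))"
          proof (rule Bochner_Integration.integrable_bound[OF integrable_mult_right[OF integrable_power_wt[of n], of "M powr (q - 1)"]])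
            show "AE t in lebesgue. norm (t ^ n * (F t * wt t)) \<le> norm (M powr (q - 1) * (t ^ n * wt t))"
            proof (rule AE_I2)
              fix t
              have "\<bar>F t\<bar> * \<bar>t ^ n * wt t\<bar> \<le> \<bar>M powr (q - 1)\<bar> * \<bar>t ^ n * wt t\<bar>" using F by (intro mult_right_mono) auto
              then show "norm (t ^ n * (F t * wt t)) \<le> norm (M powr (q - 1) * (t ^ n * wt t))" by (simp add: abs_mult mult_ac)
            qed
          qed measurable
          fix t
          show "dyad k ^ n * (v t powr q * indicator {dyad k..<1} t) \<le> t ^ n * (F t * wt t)"
          proof (cases "t \<in> {dyad k..<1}")
            case True
            have "v t powr q = v t powr (q - 1) * v t" using v(1)[of t] powr_mult_base[of "v t" "q - 1"] by (simp add: mult.commute)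
            also have "\<dots> \<le> F t * wt t" using True v[of t] by (auto simp: F_def intro!: mult_left_mono)
            finally have "v t powr q \<le> F t * wt t" .
            then show ?thesis using True dyad_nonneg[of k] by (auto intro!: mult_mono power_mono)
          next
            case False
            then show ?thesis by (auto simp: F_def)
          qed
        qed
        finally show ?thesis .
      qed
      have cl: "1 / (4 * 2 ^ k * (L * W k)) \<le> coef n" if n: "n \<in> block k" for n
      proof -
        have "Suc n \<le> 2 * 2 ^ k" using blockD(2)[OF n] by simp
        then have "real (Suc n) \<le> real (2 * 2 ^ k)" by (simp only: of_nat_le_iff)
        then have s: "real (Suc n) \<le> 2 * 2 ^ k" by simp
        have "2 ^ k \<le> Suc (2 * n + 1)" using blockD(1)[OF n] by simp
        then have "mom (2 * n + 1) \<le> L * W k" unfolding W_def by (rule L(2))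
        moreover have "2 * real (Suc n) \<le> 4 * 2 ^ k" using mult_left_mono[OF s, of 2] by simp
        ultimately have "2 * real (Suc n) * mom (2 * n + 1) \<le> 4 * 2 ^ k * (L * W k)"
          using mom_pos[of "2 * n + 1"] by (intro mult_mono[of "2 * real (Suc n)"]) (auto intro: less_imp_le)
        then show ?thesis unfolding coef_def using mom_pos[of "2 * n + 1"] L(1) W[of k] by (intro divide_left_mono mult_pos_pos) auto
      qed
      have "exp (- 4) * J / (4 * L * W k) = (\<Sum>n\<in>block k. (1 / (4 * 2 ^ k * (L * W k))) * (exp (- 4) * J))" by simp
      also have "\<dots> \<le> (\<Sum>n\<in>block k. coef n * wmom F n)"
        using J0 coef_pos by (intro sum_mono mult_mono cl wF) (auto intro: less_imp_le)
      also have "\<dots> \<le> K * real (2 ^ k) powr (1 / p) * A" using up by (simp add: block_def)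
      also have "real (2 ^ k) powr (1 / p) = 2 powr (real k / p)" by (simp add: powr_realpow[symmetric] powr_powr)
      finally have "exp (- 4) * J / (4 * L * W k) \<le> K * 2 powr (real k / p) * A" .
      then have le: "J \<le> A0 * 2 powr (real k / p) * W k * A"
        using L(1) W[of k] by (simp add: A0_def exp_minus field_simps)
      \<comment> \<open>\<open>A\<close> is \<open>J powr (1 / p)\<close>; cancelling it leaves the
        norm of the truncated weight.\<close>
      have "J = J powr (1 / q) * A"
        using Jp pq unfolding A_def by (simp add: add.commute flip: powr_add)
      then have "J powr (1 / q) * A \<le> A0 * 2 powr (real k / p) * W k * A" using le by simp
      then have "J powr (1 / q) \<le> A0 * 2 powr (real k / p) * W k" using A(1) by (simp only: mult_le_cancel_right_pos)
      then have "(J powr (1 / q)) powr q \<le> (A0 * 2 powr (real k / p) * W k) powr q" using q by (intro powr_mono2) auto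
      then show ?thesis using q Jp by (simp add: powr_powr)
    qed simp
    then show ?thesis using Je by (simp add: v_def ennreal_leI)
  qed
  have "Lq (dyad k) 1 \<le> ennreal ((A0 * 2 powr (real k / p) * W k) powr q)" for k
  proof -
    \<comment> \<open>The bound does not depend on the truncation level, so monotone convergence
      passes it to the weight itself.\<close>
    have "Lq (dyad k) 1 = (\<integral>\<^sup>+t. (SUP M. ennreal (min (wt t) (real (Suc M)) powr q) * indicator {dyad k..<1} t) \<partial>lebesgue)"
      unfolding Lq_def
    proof (intro nn_integral_cong antisym)
      fix t
      obtain M where "wt t \<le> real M" using real_arch_simple by blast
      then show "ennreal (wt t powr q) * indicator {dyad k..<1} t \<le> (SUP M. ennreal (min (wt t) (real (Suc M)) powr q) * indicator {dyad k..<1} t)"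
        by (intro SUP_upper2[of M]) (auto simp: min_def)
      show "(SUP M. ennreal (min (wt t) (real (Suc M)) powr q) * indicator {dyad k..<1} t) \<le> ennreal (wt t powr q) * indicator {dyad k..<1} t"
        using q wt_nonneg[of t] by (intro SUP_least mult_right_mono ennreal_leI powr_mono2) auto
    qed
    also have "\<dots> = (SUP M. \<integral>\<^sup>+t. ennreal (min (wt t) (real (Suc M)) powr q) * indicator {dyad k..<1} t \<partial>lebesgue)"
    proof (rule nn_integral_monotone_convergence_SUP)
      show "incseq (\<lambda>M t. ennreal (min (wt t) (real (Suc M)) powr q) * indicator {dyad k..<1} t)"
        unfolding incseq_def le_fun_def
        using q wt_nonneg by (intro allI impI mult_right_mono ennreal_leI powr_mono2) auto
    qed measurable
    also have "\<dots> \<le> ennreal ((A0 * 2 powr (real k / p) * W k) powr q)" by (intro SUP_least main) auto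
    finally show ?thesis .
  qed
  then show ?thesis using A0 by (intro exI[of _ A0]) (simp add: reverse_Holder_def W_def)
qed

section \<open>Combination of the two directions\<close>

lemma bounded_from_Lp_iff:
  assumes Y: "block_growth p Y" "dyadic_sufficient p Y" and T: "T \<in> {hilbert_op \<omega>, hilbert_op_abs \<omega>}"
  shows "(bounded_from_Lp p Y T \<longleftrightarrow> \<omega> \<in> D_class \<and> m_const p q \<omega> < top) \<and>
         (bounded_from_Lp p Y T \<longleftrightarrow> \<omega> \<in> D_hat \<and> m_const p q \<omega> < top)"
proof -
  have 1: "\<omega> \<in> D_hat \<and> \<omega> \<in> D_check \<and> m_const p q \<omega> < top" if bdd: "bounded_from_Lp p Y T"
  proof -
    obtain C where C: "doubling C" using doubling_of_bounded[OF Y(1) T bdd] by blast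
    obtain A where A: "reverse_Holder A" using reverse_Holder_of_bounded[OF C Y(1) T bdd] by blast
    show ?thesis
      using C D_hat_iff_doubling D_check_of_reverse_Holder[OF C A] m_const_of_reverse_Holder[OF C A] by blast
  qed
  have 2: "bounded_from_Lp p Y T" if h: "\<omega> \<in> D_hat" "m_const p q \<omega> < top"
  proof -
    obtain C where C: "doubling C" using h D_hat_iff_doubling by blast
    obtain A where A: "reverse_Holder A" using reverse_Holder_of_m_const[OF C h(2)] by blast
    show ?thesis by (rule bounded_from_Lp_of_reverse_Holder[OF C A Y(2) T])
  qed
  show ?thesis using 1 2 by (auto simp: D_class_def)
qed

end

theorem corollary3:
  fixes \<omega> :: "real \<Rightarrow> real" and p q :: real
    and N :: "(complex \<Rightarrow> complex) \<Rightarrow> ennreal"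
    and T :: "(real \<Rightarrow> complex) \<rightharpoonup> (complex \<Rightarrow> complex)"
  assumes "radial_weight \<omega>"
    and "1 < p" and "1 / p + 1 / q = 1"
    and "N \<in> {norm_H_infty p, norm_Hardy p, norm_Dirichlet p, norm_HL p}"
    and "T \<in> {hilbert_op \<omega>, hilbert_op_abs \<omega>}"
  shows "(bounded_from_Lp p N T \<longleftrightarrow> \<omega> \<in> D_class \<and> m_const p q \<omega> < top) \<and>
         (bounded_from_Lp p N T \<longleftrightarrow> \<omega> \<in> D_hat \<and> m_const p q \<omega> < top)"
proof -
  interpret radial_pq \<omega> p q
    using assms by unfold_locales
  have "block_growth p N" "dyadic_sufficient p N"
    using assms(4) block_growth_H_infty[OF p] block_growth_Hardy[OF p] block_growth_Dirichlet[OF p] block_growth_HL[OF p]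
      dyadic_sufficient_H_infty[OF p] dyadic_sufficient_Hardy[OF p] dyadic_sufficient_Dirichlet[OF p] dyadic_sufficient_HL[OF p]
    by auto
  then show ?thesis by (rule bounded_from_Lp_iff) (rule assms(5))
qed

end
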